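(* The operator $$\mathscr{L}:=\partial_{(u,\omega)}\mathcal{F}(0,u_\infty,\omega_\infty):H^2_r(\mathbb{R}^3)\times\mathbb{R}\to H^2_r(\mathbb{R}^3)\times\mathbb{R},$$ that is, the Fréchet derivative of $\mathcal{F}$ with respect to $(u,\omega)$ at $(0,u_\infty,\omega_\infty)$, given explicitly by $$\mathscr{L}(\phi,\tau)=\left(\phi-R_{0,\omega_\infty}\mathcal{N}'(u_\infty)\phi+\tau R_{0,\omega_\infty}^2\mathcal{N}(u_\infty),\ 2\langle u_\infty,\phi\rangle\right)=\left(R_{0,\omega_\infty}(\mathcal{L}\phi+\tau u_\infty),\ 2\langle u_\infty,\phi\rangle\right),$$ is invertible (bijective with bounded inverse).
   Context: Fix $m>0$. Functions are real-valued, $H^s_r(\mathbb{R}^3)$ denotes the subspace of radial functions in $H^s(\mathbb{R}^3)$, and $\langle\cdot,\cdot\rangle$ is the $L^2(\mathbb{R}^3)$ scalar product. For $c>0$ let $P_c(D)=\sqrt{-c^2\Delta+m^2c^4}-mc^2$ (Fourier multiplier with symbol $\sqrt{c^2|\xi|^2+m^2c^4}-mc^2$) and $P_\infty(D)=-\frac{1}{2m}\Delta$. For $\omega>0$ set $R_{0,\omega}=(P_\infty(D)+\omega)^{-1}$ and $R_{\beta,\omega}=(P_{1/\beta}(D)+\omega)^{-1}$ for $\beta>0$. Let $\mathcal{N}(u)=(|x|^{-1}*u^2)u$, with derivative $\mathcal{N}'(u)\phi=(|x|^{-1}*u^2)\phi+2\big(|x|^{-1}*(u\phi)\big)u$. The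 function $u_\infty$ is the unique positive radial minimizer of $$\mathcal{E}_\infty(u)=\langle P_\infty(D)u,u\rangle-\frac12\int_{\mathbb{R}^3}(|x|^{-1}*u^2)u^2\,dx$$ (first term in the quadratic form sense) subject to $\|u\|_{L^2}=1$, and $\omega_\infty>0$ is its Lagrange multiplier, so that $$P_\infty(D)u_\infty+\omega_\infty u_\infty=\mathcal{N}(u_\infty),\qquad \|u_\infty\|_{L^2}=1.$$ It is known that $u_\infty$ is symmetric-decreasing and belongs to $H^s(\mathbb{R}^3)$ for every $s>0$. Put $\mathcal{L}\phi=P_\infty(D)\phi+\omega_\infty\phi-\mathcal{N}'(u_\infty)\phi$. It is a known fact (nondegeneracy of $u_\infty$) that $\mathcal{L}:H^{s+2}_r(\mathbb{R}^3)\to H^s_r(\mathbb{R}^3)$ is invertible for each $s\ge0$. Fix $\beta_0>0$ and a compact interval $I\subset(0,\infty)$ containing $\omega_\infty$ in its interior. The map $\mathcal{F}:[0,\beta_0)\times H^2_r(\mathbb{R}^3)\times I\to H^2_r(\mathbb{R}^3)\times\mathbb{R}$ is $$\mathcal{F}(\beta,u,\omega)=\left(u-R_{\beta,\omega}\mathcal{N}(u),\ \|u\|_{L^2}^2-1\right).$$ *)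

theory Defs
  imports "HOL-Probability.Probability"
begin

type_synonym R3 = "real ^ 3"

definition square_integrable :: "(R3 \<Rightarrow> 'b::euclidean_space) \<Rightarrow> bool" where
  "square_integrable f \<longleftrightarrow> f \<in> borel_measurable lborel \<and> integrable lborel (\<lambda>x. (norm (f x))\<^sup>2)"

lemma square_integrable_0: "square_integrable (\<lambda>x. 0)"
  by (simp add: square_integrable_def)

lemma square_integrable_add:
  assumes "square_integrable f" "square_integrable g"
  shows "square_integrable (\<lambda>x. f x + g x)"
proof -
  have m[measurable]: "f \<in> borel_measurable lborel" "g \<in> borel_measurable lborel"
    using assms by (auto simp: square_integrable_def)
  have i: "integrable lborel (\<lambda>x. 2 * (norm (f x))\<^sup>2 + 2 * (norm (g x))\<^sup>2)"
    using assms by (auto simp: square_integrable_def)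
  have b: "(norm (f x + g x))\<^sup>2 \<le> 2 * (norm (f x))\<^sup>2 + 2 * (norm (g x))\<^sup>2" for x
  proof -
    have "(norm (f x + g x))\<^sup>2 \<le> (norm (f x) + norm (g x))\<^sup>2"
      by (intro power_mono norm_triangle_ineq) auto
    also have "\<dots> \<le> 2 * (norm (f x))\<^sup>2 + 2 * (norm (g x))\<^sup>2"
      using sum_squares_bound[of "norm (f x)" "norm (g x)"] by (simp add: power2_sum)
    finally show ?thesis .
  qed
  have "integrable lborel (\<lambda>x. (norm (f x + g x))\<^sup>2)"
    by (rule Bochner_Integration.integrable_bound[OF i]) (use b in \<open>auto simp: abs_of_nonneg\<close>)
  then show ?thesis by (simp add: square_integrable_def)
qed

lemma square_integrable_scaleR:
  "square_integrable f \<Longrightarrow> square_integrable (\<lambda>x. c *\<^sub>R f x)"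
  by (auto simp: square_integrable_def power_mult_distrib)

lemma square_integrable_minus:
  "square_integrable f \<Longrightarrow> square_integrable (\<lambda>x. - f x)"
  by (auto simp: square_integrable_def)

lemma square_integrable_diff:
  "square_integrable f \<Longrightarrow> square_integrable g \<Longrightarrow> square_integrable (\<lambda>x. f x - g x)"
  using square_integrable_add[of f "\<lambda>x. - g x"] square_integrable_minus[of g] by simp

lemma square_integrable_cong_AE:
  assumes "square_integrable f" "g \<in> borel_measurable lborel" "AE x in lborel. f x = g x"
  shows "square_integrable g"
proof -
  have [measurable]: "f \<in> borel_measurable lborel" "g \<in> borel_measurable lborel"
    using assms by (auto simp: square_integrable_def)
  have "integrable lborel (\<lambda>x. (norm (f x))\<^sup>2) \<longleftrightarrow> integrable lborel (\<lambda>x. (norm (g x))\<^sup>2)"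
    by (rule integrable_cong_AE) (use assms(3) in \<open>auto\<close>)
  then show ?thesis using assms by (auto simp: square_integrable_def)
qed

lemma square_integrable_norm_mult:
  assumes "square_integrable f" "square_integrable g"
  shows "integrable lborel (\<lambda>x. norm (f x) * norm (g x))"
proof -
  have [measurable]: "f \<in> borel_measurable lborel" "g \<in> borel_measurable lborel"
    using assms by (auto simp: square_integrable_def)
  have i: "integrable lborel (\<lambda>x. (norm (f x))\<^sup>2 + (norm (g x))\<^sup>2)"
    using assms by (auto simp: square_integrable_def)
  have b: "norm (f x) * norm (g x) \<le> (norm (f x))\<^sup>2 + (norm (g x))\<^sup>2" for x
    using sum_squares_bound[of "norm (f x)" "norm (g x)"]
      mult_nonneg_nonneg[OF norm_ge_zero norm_ge_zero, of "f x" "g x"] by linarith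
  show ?thesis
    by (rule Bochner_Integration.integrable_bound[OF i]) (use b in \<open>auto simp: abs_of_nonneg\<close>)
qed

lemma square_integrable_inner:
  assumes "square_integrable f" "square_integrable g"
  shows "integrable lborel (\<lambda>x. f x \<bullet> g x)"
proof -
  have [measurable]: "f \<in> borel_measurable lborel" "g \<in> borel_measurable lborel"
    using assms by (auto simp: square_integrable_def)
  show ?thesis
    by (rule Bochner_Integration.integrable_bound[OF square_integrable_norm_mult[OF assms]])
      (auto simp: Cauchy_Schwarz_ineq2)
qed

(* A partial quotient: abs_l2 f is meaningful only for square-integrable f. *)

quotient_type (overloaded) 'b l2 = "R3 \<Rightarrow> 'b::euclidean_space" / partial:
  "\<lambda>f g. square_integrable f \<and> square_integrable g \<and> (AE x in lborel. f x = g x)"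
proof (rule part_equivpI)
  show "\<exists>f::R3 \<Rightarrow> 'b. square_integrable f \<and> square_integrable f \<and> (AE x in lborel. f x = f x)"
    using square_integrable_0 by auto
  show "symp (\<lambda>f (g::R3 \<Rightarrow> 'b). square_integrable f \<and> square_integrable g \<and> (AE x in lborel. f x = g x))"
    by (auto simp: symp_def)
  show "transp (\<lambda>f (g::R3 \<Rightarrow> 'b). square_integrable f \<and> square_integrable g \<and> (AE x in lborel. f x = g x))"
  proof (rule transpI, intro conjI; (elim conjE)?)
    fix f g h :: "R3 \<Rightarrow> 'b"
    assume "AE x in lborel. f x = g x" "AE x in lborel. g x = h x"
    then show "AE x in lborel. f x = h x" by eventually_elim simp
  qed
qed

instantiation l2 :: (euclidean_space) real_vector
begin

lift_definition zero_l2 :: "'a l2" is "\<lambda>x. 0"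
  by (auto intro: square_integrable_0)
lift_definition plus_l2 :: "'a l2 \<Rightarrow> 'a l2 \<Rightarrow> 'a l2" is "\<lambda>f g x. f x + g x"
  by (auto intro: square_integrable_add)
lift_definition minus_l2 :: "'a l2 \<Rightarrow> 'a l2 \<Rightarrow> 'a l2" is "\<lambda>f g x. f x - g x"
  by (auto intro: square_integrable_diff)
lift_definition uminus_l2 :: "'a l2 \<Rightarrow> 'a l2" is "\<lambda>f x. - f x"
  by (auto intro: square_integrable_minus)
lift_definition scaleR_l2 :: "real \<Rightarrow> 'a l2 \<Rightarrow> 'a l2" is "\<lambda>c f x. c *\<^sub>R f x"
  by (auto intro: square_integrable_scaleR)
instance
proof
  fix u v w :: "'a l2" and r s :: real
  show "u + v + w = u + (v + w)"
    by transfer (auto intro: square_integrable_add simp: add.assoc)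
  show "u + v = v + u"
    by transfer (auto intro: square_integrable_add simp: add.commute)
  show "0 + u = u" by transfer auto
  show "- u + u = 0" by transfer (auto intro: square_integrable_0)
  show "u - v = u + - v" by transfer (auto intro: square_integrable_diff)
  show "r *\<^sub>R (u + v) = r *\<^sub>R u + r *\<^sub>R v"
    by transfer (auto intro!: square_integrable_add square_integrable_scaleR simp: scaleR_add_right
        simp del: scaleR_add_right[symmetric])
  show "(r + s) *\<^sub>R u = r *\<^sub>R u + s *\<^sub>R u"
    by transfer (auto intro!: square_integrable_add square_integrable_scaleR simp: scaleR_add_left)
  show "r *\<^sub>R s *\<^sub>R u = (r * s) *\<^sub>R u"
    by transfer (auto intro!: square_integrable_scaleR)
  show "1 *\<^sub>R u = u" by transfer auto
qed

end

instantiation l2 :: (euclidean_space) real_inner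
begin

lift_definition inner_l2 :: "'a l2 \<Rightarrow> 'a l2 \<Rightarrow> real" is "\<lambda>f g. LINT x|lborel. f x \<bullet> g x"
  by (rule integral_cong_AE) (auto simp: square_integrable_def)

definition norm_l2 :: "'a l2 \<Rightarrow> real" where "norm_l2 u = sqrt (u \<bullet> u)"
definition dist_l2 :: "'a l2 \<Rightarrow> 'a l2 \<Rightarrow> real" where "dist_l2 u v = norm (u - v)"
definition sgn_l2 :: "'a l2 \<Rightarrow> 'a l2" where "sgn_l2 u = u /\<^sub>R norm u"
definition uniformity_l2 :: "('a l2 \<times> 'a l2) filter" where
  "uniformity_l2 = (INF e\<in>{0 <..}. principal {(x, y). dist x y < e})"
definition open_l2 :: "'a l2 set \<Rightarrow> bool" where
  "open_l2 U \<longleftrightarrow> (\<forall>x\<in>U. eventually (\<lambda>(x', y). x' = x \<longrightarrow> y \<in> U) uniformity)"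

instance
proof
  fix u v w :: "'a l2" and r :: real and U :: "'a l2 set"
  show "dist u v = norm (u - v)" by (rule dist_l2_def)
  show "sgn u = u /\<^sub>R norm u" by (rule sgn_l2_def)
  show "(uniformity :: ('a l2 \<times> 'a l2) filter) = (INF e\<in>{0 <..}. principal {(x, y). dist x y < e})"
    by (rule uniformity_l2_def)
  show "open U \<longleftrightarrow> (\<forall>x\<in>U. eventually (\<lambda>(x', y). x' = x \<longrightarrow> y \<in> U) uniformity)"
    by (rule open_l2_def)
  show "u \<bullet> v = v \<bullet> u" by transfer (simp add: inner_commute)
  show "(u + v) \<bullet> w = u \<bullet> w + v \<bullet> w"
    by transfer (simp add: inner_add_left square_integrable_inner)
  show "(r *\<^sub>R u) \<bullet> v = r * (u \<bullet> v)" by transfer simp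
  show "0 \<le> u \<bullet> u" by transfer simp
  show "u \<bullet> u = 0 \<longleftrightarrow> u = 0"
  proof transfer
    fix f :: "R3 \<Rightarrow> 'a"
    assume "square_integrable f \<and> square_integrable f \<and> (AE x in lborel. f x = f x)"
    then have f: "square_integrable f" by simp
    have "(LINT x|lborel. f x \<bullet> f x) = 0 \<longleftrightarrow> (AE x in lborel. f x \<bullet> f x = 0)"
      by (rule integral_nonneg_eq_0_iff_AE) (auto intro: square_integrable_inner f)
    then show "((LINT x|lborel. f x \<bullet> f x) = 0) \<longleftrightarrow>
        (square_integrable f \<and> square_integrable (\<lambda>x. 0::'a) \<and> (AE x in lborel. f x = 0))"
      using f square_integrable_0 by auto
  qed
  show "norm u = sqrt (u \<bullet> u)" by (rule norm_l2_def)
qed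

end

lemma square_integrable_rep: "square_integrable (rep_l2 u)"
  using Quotient3_rep_reflp[OF Quotient3_l2] by auto

lemma abs_rep_l2: "abs_l2 (rep_l2 u) = u"
  by (rule Quotient3_abs_rep[OF Quotient3_l2])

lemma abs_l2_eq_iff:
  assumes "square_integrable f" "square_integrable g"
  shows "abs_l2 f = abs_l2 g \<longleftrightarrow> (AE x in lborel. f x = g x)"
  using Quotient3_rel[OF Quotient3_l2, of f g] assms by auto

lemma rep_abs_l2:
  assumes "square_integrable f"
  shows "AE x in lborel. rep_l2 (abs_l2 f) x = f x"
  using abs_l2_eq_iff[OF square_integrable_rep assms, of "abs_l2 f"] abs_rep_l2 by auto

lemma abs_l2_add:
  assumes "square_integrable f" "square_integrable g"
  shows "abs_l2 f + abs_l2 g = abs_l2 (\<lambda>x. f x + g x)"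
  using assms by (intro plus_l2.abs_eq) auto

lemma abs_l2_scaleR:
  assumes "square_integrable f"
  shows "c *\<^sub>R abs_l2 f = abs_l2 (\<lambda>x. c *\<^sub>R f x)"
  using assms by (intro scaleR_l2.abs_eq) auto

lemma rep_l2_add: "AE x in lborel. rep_l2 (u + v) x = rep_l2 u x + rep_l2 v x"
  using abs_l2_add[OF square_integrable_rep square_integrable_rep, of u v]
    rep_abs_l2[OF square_integrable_add[OF square_integrable_rep square_integrable_rep, of u v]]
  by (simp add: abs_rep_l2)

lemma rep_l2_scaleR: "AE x in lborel. rep_l2 (c *\<^sub>R u) x = c *\<^sub>R rep_l2 u x"
  using abs_l2_scaleR[OF square_integrable_rep, of c u]
    rep_abs_l2[OF square_integrable_scaleR[OF square_integrable_rep, of c u]]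
  by (simp add: abs_rep_l2)

lemma borel_measurable_cis[measurable (raw)]:
  "f \<in> borel_measurable M \<Longrightarrow> (\<lambda>x. cis (f x)) \<in> borel_measurable M"
  unfolding cis_conv_exp by measurable

lemma gaussian_fourier_1:
  fixes x s :: real
  assumes s: "s > 0"
  shows "integrable lborel (\<lambda>\<xi>. cis (x * \<xi>) * complex_of_real (exp (- (s * \<xi>)\<^sup>2 / 2)))"
    and "(LINT \<xi>|lborel. cis (x * \<xi>) * complex_of_real (exp (- (s * \<xi>)\<^sup>2 / 2)))
       = complex_of_real (sqrt (2 * pi) / s * exp (- (x / s)\<^sup>2 / 2))"
proof -
  have std: "integrable lborel (\<lambda>t. std_normal_density t)"
    by (rule integrable_normal_density) simp
  have i1: "integrable lborel (\<lambda>t. cis (y * t) * complex_of_real (exp (- t\<^sup>2 / 2)))" for y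
  proof -
    have "integrable lborel (\<lambda>t. sqrt (2 * pi) * std_normal_density t)"
      using std by simp
    then have "integrable lborel (\<lambda>t::real. exp (- t\<^sup>2 / 2))"
      by (simp add: std_normal_density_def)
    then show ?thesis
      by (rule Bochner_Integration.integrable_bound) (auto simp: norm_mult)
  qed
  have v1: "(LINT t|lborel. cis (y * t) * complex_of_real (exp (- t\<^sup>2 / 2)))
      = complex_of_real (sqrt (2 * pi) * exp (- y\<^sup>2 / 2))" for y
  proof -
    have "char std_normal_distribution y = (LINT t|lborel. std_normal_density t *\<^sub>R iexp (y * t))"
      unfolding char_def by (subst integral_density) auto
    also have "\<dots> = (LINT t|lborel. complex_of_real (1 / sqrt (2 * pi)) *
        (cis (y * t) * complex_of_real (exp (- t\<^sup>2 / 2))))"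
      by (intro Bochner_Integration.integral_cong)
        (auto simp: std_normal_density_def cis_conv_exp scaleR_conv_of_real mult_ac)
    also have "\<dots> = complex_of_real (1 / sqrt (2 * pi)) *
        (LINT t|lborel. cis (y * t) * complex_of_real (exp (- t\<^sup>2 / 2)))"
      by simp
    finally show ?thesis
      by (simp add: char_std_normal_distribution field_simps)
  qed
  have "integrable lborel (\<lambda>\<xi>. (\<lambda>t. cis (x / s * t) * complex_of_real (exp (- t\<^sup>2 / 2))) (0 + s * \<xi>))"
    using s by (intro lborel_integrable_real_affine i1) auto
  then show "integrable lborel (\<lambda>\<xi>. cis (x * \<xi>) * complex_of_real (exp (- (s * \<xi>)\<^sup>2 / 2)))"
    using s by simp
  have "complex_of_real (sqrt (2 * pi) * exp (- (x / s)\<^sup>2 / 2)) =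
     \<bar>s\<bar> *\<^sub>R (LINT \<xi>|lborel. (\<lambda>t. cis (x / s * t) * complex_of_real (exp (- t\<^sup>2 / 2))) (0 + s * \<xi>))"
    using s by (subst v1[symmetric], intro lborel_integral_real_affine) auto
  then show "(LINT \<xi>|lborel. cis (x * \<xi>) * complex_of_real (exp (- (s * \<xi>)\<^sup>2 / 2)))
       = complex_of_real (sqrt (2 * pi) / s * exp (- (x / s)\<^sup>2 / 2))"
    using s by (simp add: scaleR_conv_of_real field_simps)
qed

lemma lborel_prod_Basis:
  fixes f :: "'a::euclidean_space \<Rightarrow> real \<Rightarrow> complex"
  assumes f: "\<And>b. b \<in> Basis \<Longrightarrow> integrable lborel (f b)"
  shows "integrable lborel (\<lambda>\<xi>::'a. \<Prod>b\<in>Basis. f b (\<xi> \<bullet> b))"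
    and "(LINT \<xi>|lborel. (\<Prod>b\<in>Basis. f b (\<xi> \<bullet> b))) = (\<Prod>b\<in>Basis. (LINT t|lborel. f b t))"
proof -
  interpret product_sigma_finite "\<lambda>_::'a. lborel :: real measure" ..
  have [measurable]: "f b \<in> borel_measurable borel" if "b \<in> Basis" for b
    using f[OF that] by auto
  have c: "(\<Prod>b\<in>Basis. f b ((\<Sum>b\<in>Basis. g b *\<^sub>R b) \<bullet> b)) = (\<Prod>b\<in>Basis. f b (g b))" for g
    by (intro prod.cong refl) (simp add: inner_sum_left inner_Basis if_distrib comm_monoid_add_class.sum.delta cong: if_cong)
  show "integrable lborel (\<lambda>\<xi>::'a. \<Prod>b\<in>Basis. f b (\<xi> \<bullet> b))"
    apply (subst lborel_eq)
    apply (subst integrable_distr_eq)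
      apply measurable
    unfolding c
    by (rule product_integrable_prod) (auto intro: f)
  show "(LINT \<xi>|lborel. (\<Prod>b\<in>Basis. f b (\<xi> \<bullet> b))) = (\<Prod>b\<in>Basis. (LINT t|lborel. f b t))"
    apply (subst lborel_eq)
    apply (subst integral_distr)
      apply measurable
    unfolding c
    by (rule product_integral_prod) (auto intro: f)
qed

lemma gaussian_fourier:
  fixes y :: "'a::euclidean_space" and s :: real
  assumes s: "s > 0"
  shows "integrable lborel (\<lambda>\<xi>. cis (y \<bullet> \<xi>) * complex_of_real (exp (- (s * norm \<xi>)\<^sup>2 / 2)))"
    and "(LINT \<xi>|lborel. cis (y \<bullet> \<xi>) * complex_of_real (exp (- (s * norm \<xi>)\<^sup>2 / 2)))
       = complex_of_real ((sqrt (2 * pi) / s) ^ DIM('a) * exp (- (norm y / s)\<^sup>2 / 2))"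
proof -
  have sq: "(norm z)\<^sup>2 = (\<Sum>b\<in>Basis. (z \<bullet> b)\<^sup>2)" for z :: 'a
  proof -
    have "(norm z)\<^sup>2 = z \<bullet> z" by (rule power2_norm_eq_inner)
    also have "\<dots> = (\<Sum>b\<in>Basis. (z \<bullet> b)\<^sup>2)"
      unfolding power2_eq_square by (rule euclidean_inner)
    finally show ?thesis .
  qed
  have cs: "cis (\<Sum>b\<in>A. g b) = (\<Prod>b\<in>A. cis (g b))" if "finite A" for A :: "'a set" and g
    using that by induction (auto simp: cis_mult[symmetric])
  have p: "cis (y \<bullet> \<xi>) * complex_of_real (exp (- (s * norm \<xi>)\<^sup>2 / 2)) =
     (\<Prod>b\<in>Basis. cis ((y \<bullet> b) * (\<xi> \<bullet> b)) * complex_of_real (exp (- (s * (\<xi> \<bullet> b))\<^sup>2 / 2)))" for \<xi>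
  proof -
    have "- (s * norm \<xi>)\<^sup>2 / 2 = (\<Sum>b\<in>Basis. - (s * (\<xi> \<bullet> b))\<^sup>2 / 2)"
      by (simp add: power_mult_distrib sq sum_distrib_left sum_negf sum_divide_distrib)
    then show ?thesis
      by (simp add: euclidean_inner[of y \<xi>] cs exp_sum prod.distrib)
  qed
  have i: "integrable lborel (\<lambda>t. cis ((y \<bullet> b) * t) * complex_of_real (exp (- (s * t)\<^sup>2 / 2)))" for b
    by (rule gaussian_fourier_1[OF s])
  show "integrable lborel (\<lambda>\<xi>. cis (y \<bullet> \<xi>) * complex_of_real (exp (- (s * norm \<xi>)\<^sup>2 / 2)))"
    unfolding p by (rule lborel_prod_Basis(1)[OF i])
  have "(\<Prod>b\<in>Basis. sqrt (2 * pi) / s * exp (- ((y \<bullet> b) / s)\<^sup>2 / 2)) =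
      (sqrt (2 * pi) / s) ^ DIM('a) * exp (- (norm y / s)\<^sup>2 / 2)"
  proof -
    have "- (norm y / s)\<^sup>2 / 2 = (\<Sum>b\<in>Basis. - ((y \<bullet> b) / s)\<^sup>2 / 2)"
      by (simp add: power_divide sq sum_negf sum_divide_distrib)
    then show ?thesis
      unfolding prod.distrib prod_constant by (simp only: exp_sum finite_Basis)
  qed
  then show "(LINT \<xi>|lborel. cis (y \<bullet> \<xi>) * complex_of_real (exp (- (s * norm \<xi>)\<^sup>2 / 2)))
       = complex_of_real ((sqrt (2 * pi) / s) ^ DIM('a) * exp (- (norm y / s)\<^sup>2 / 2))"
    unfolding p lborel_prod_Basis(2)[OF i] gaussian_fourier_1(2)[OF s]
    by (metis of_real_prod)
qed

lemma lborel_integral_affine: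
  fixes f :: "'a::euclidean_space \<Rightarrow> 'b::euclidean_space"
  assumes [measurable]: "f \<in> borel_measurable borel" and c: "c \<noteq> 0"
  shows "(LINT x|lborel. f x) = \<bar>c\<bar> ^ DIM('a) *\<^sub>R (LINT x|lborel. f (t + c *\<^sub>R x))"
  apply (subst lborel_affine[OF c, of t])
  apply (subst integral_density)
  by (auto simp: integral_distr)

lemma lborel_integrable_affine:
  fixes f :: "'a::euclidean_space \<Rightarrow> 'b::euclidean_space"
  assumes f: "integrable lborel f" and c: "c \<noteq> 0"
  shows "integrable lborel (\<lambda>x. f (t + c *\<^sub>R x))"
proof -
  have [measurable]: "f \<in> borel_measurable borel" using f by auto
  have "integrable (density (distr lborel borel (\<lambda>x. t + c *\<^sub>R x)) (\<lambda>_. \<bar>c\<bar> ^ DIM('a))) f"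
    using f by (subst (asm) lborel_affine[OF c, of t])
  then have "integrable lborel (\<lambda>x. \<bar>c\<bar> ^ DIM('a) *\<^sub>R f (t + c *\<^sub>R x))"
    by (subst (asm) integrable_density) (auto simp: integrable_distr_eq)
  then have "integrable lborel (\<lambda>x. inverse (\<bar>c\<bar> ^ DIM('a)) *\<^sub>R \<bar>c\<bar> ^ DIM('a) *\<^sub>R f (t + c *\<^sub>R x))"
    by (rule integrable_scaleR_right)
  moreover have "inverse (\<bar>c\<bar> ^ DIM('a)) *\<^sub>R \<bar>c\<bar> ^ DIM('a) *\<^sub>R v = v" for v :: 'b
    using c by simp
  ultimately show ?thesis by simp
qed

lemma AE_eq_0_if_box_integrals_0:
  fixes f :: "'a::euclidean_space \<Rightarrow> real"
  assumes i: "\<And>a b. integrable lborel (\<lambda>x. indicator (box a b) x * f x)"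
    and m[measurable]: "f \<in> borel_measurable borel"
    and z: "\<And>a b. (LINT x|lborel. indicator (box a b) x * f x) = 0"
  shows "AE x in lborel. f x = 0"
proof -
  let ?p = "density lborel (\<lambda>x. ennreal (max 0 (f x)))"
  let ?n = "density lborel (\<lambda>x. ennreal (max 0 (- f x)))"
  have ip: "integrable lborel (\<lambda>x. indicator (box a b) x * max 0 (f x))"
    and in': "integrable lborel (\<lambda>x. indicator (box a b) x * max 0 (- f x))" for a b
    by (rule Bochner_Integration.integrable_bound[OF i[of a b]], auto split: split_indicator)+
  have ep: "emeasure ?p (box a b) = ennreal (LINT x|lborel. indicator (box a b) x * max 0 (f x))"
    and en: "emeasure ?n (box a b) = ennreal (LINT x|lborel. indicator (box a b) x * max 0 (- f x))"
    for a b
    using ip[of a b] in'[of a b]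
    by (auto simp: emeasure_density nn_integral_eq_integral[symmetric] ennreal_indicator[symmetric]
        ennreal_mult'[symmetric] mult.commute intro!: nn_integral_cong split: split_indicator)
  have eq: "(LINT x|lborel. indicator (box a b) x * max 0 (f x)) =
      (LINT x|lborel. indicator (box a b) x * max 0 (- f x))" for a b
  proof -
    have "(LINT x|lborel. indicator (box a b) x * max 0 (f x)) -
      (LINT x|lborel. indicator (box a b) x * max 0 (- f x)) =
      (LINT x|lborel. indicator (box a b) x * max 0 (f x) - indicator (box a b) x * max 0 (- f x))"
      using ip in' by simp
    also have "\<dots> = (LINT x|lborel. indicator (box a b) x * f x)"
      by (intro Bochner_Integration.integral_cong) (auto split: split_indicator)
    finally show ?thesis using z by simp
  qed
  have "?p = ?n"
  proof (rule measure_eqI_generator_eq[where E="range (\<lambda>(a, b). box a b)" and \<Omega>=UNIV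
        and A="\<lambda>n::nat. box (- real n *\<^sub>R One) (real n *\<^sub>R One)"])
    show "Int_stable (range (\<lambda>(a, b). box a b :: 'a set))"
      by (auto simp: Int_stable_def box_Int_box)
    show "sets ?p = sigma_sets UNIV (range (\<lambda>(a, b). box a b))"
      by (simp add: borel_eq_box sets_measure_of)
    show "sets ?n = sigma_sets UNIV (range (\<lambda>(a, b). box a b))"
      by (simp add: borel_eq_box sets_measure_of)
    show "(\<Union>n. box (- real n *\<^sub>R One) (real n *\<^sub>R One)) = (UNIV :: 'a set)"
    proof (intro set_eqI iffI UNIV_I)
      fix x :: 'a
      obtain n :: nat where n: "norm x < real n" using reals_Archimedean2 by blast
      have "x \<in> box (- real n *\<^sub>R One) (real n *\<^sub>R One)"
        unfolding mem_box using Basis_le_norm[of _ x] n by (force simp: abs_less_iff)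
      then show "x \<in> (\<Union>n. box (- real n *\<^sub>R One) (real n *\<^sub>R One))" by blast
    qed
    show "emeasure ?p X = emeasure ?n X" if "X \<in> range (\<lambda>(a, b). box a b)" for X
      using that ep en eq by (elim rangeE) (simp only: split_beta)
    show "emeasure ?p (box (- real i *\<^sub>R One) (real i *\<^sub>R One)) \<noteq> \<infinity>" for i
      by (subst ep) simp
  qed auto
  then have "AE x in lborel. ennreal (max 0 (f x)) = ennreal (max 0 (- f x))"
    by (intro sigma_finite_measure.density_unique[OF sigma_finite_lborel]) auto
  then show ?thesis
    by eventually_elim (auto simp: max_def split: if_splits)
qed

lemma norm_abs_l2:
  assumes "square_integrable f"
  shows "norm (abs_l2 f) = sqrt (LINT x|lborel. (norm (f x))\<^sup>2)"
proof -
  have "abs_l2 f \<bullet> abs_l2 f = (LINT x|lborel. f x \<bullet> f x)"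
    using assms by (intro inner_l2.abs_eq) auto
  then show ?thesis
    by (simp add: norm_eq_sqrt_inner[of "abs_l2 f"] power2_norm_eq_inner)
qed

lemma square_integrable_of_norm:
  "square_integrable f \<Longrightarrow> square_integrable (\<lambda>x. norm (f x))"
  by (auto simp: square_integrable_def)

lemma L2_Cauchy_Schwarz:
  fixes f :: "R3 \<Rightarrow> 'b::euclidean_space" and g :: "R3 \<Rightarrow> 'c::euclidean_space"
  assumes f: "square_integrable f" and g: "square_integrable g"
  shows "(LINT x|lborel. norm (f x) * norm (g x)) \<le> norm (abs_l2 f) * norm (abs_l2 g)"
proof -
  let ?f = "\<lambda>x. norm (f x)" and ?g = "\<lambda>x. norm (g x)"
  have "(LINT x|lborel. norm (f x) * norm (g x)) = abs_l2 ?f \<bullet> abs_l2 ?g"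
    using f g by (subst inner_l2.abs_eq) (auto simp: square_integrable_of_norm)
  also have "\<dots> \<le> norm (abs_l2 ?f) * norm (abs_l2 ?g)"
    by (rule norm_cauchy_schwarz)
  also have "norm (abs_l2 ?f) = norm (abs_l2 f)"
    using f by (simp add: norm_abs_l2 square_integrable_of_norm)
  also have "norm (abs_l2 ?g) = norm (abs_l2 g)"
    using g by (simp add: norm_abs_l2 square_integrable_of_norm)
  finally show ?thesis .
qed

(* Unitary normalisation, with no constant in Plancherel's identity.  The transform of an
   L^2 function is the L^2 limit, as R tends to infinity, of the transforms of its restrictions to
   the balls of radius R.  For every u such a limit exists by Plancherel's theorem; it is a premise
   in the definition of the Sobolev spaces below. *)

definition fourier_trunc :: "(R3 \<Rightarrow> real) \<Rightarrow> real \<Rightarrow> R3 \<Rightarrow> complex" where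
  "fourier_trunc f R \<xi> = complex_of_real ((2 * pi) powr (- 3 / 2)) *
     (LINT x:cball 0 R|lborel. cis (- (\<xi> \<bullet> x)) * complex_of_real (f x))"

definition has_fourier :: "real l2 \<Rightarrow> complex l2 \<Rightarrow> bool" where
  "has_fourier u v \<longleftrightarrow> (\<forall>R. square_integrable (fourier_trunc (rep_l2 u) R)) \<and>
     ((\<lambda>R. abs_l2 (fourier_trunc (rep_l2 u) R)) \<longlongrightarrow> v) at_top"

definition fourier :: "real l2 \<Rightarrow> complex l2" where
  "fourier u = (THE v. has_fourier u v)"

lemma square_integrable_indicator_cball:
  "square_integrable (indicator (cball a r) :: R3 \<Rightarrow> real)"
proof -
  have "(\<lambda>x. (norm (indicator (cball a r) x :: real))\<^sup>2) = (indicator (cball a r) :: R3 \<Rightarrow> real)"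
    by (auto split: split_indicator)
  then show ?thesis
    unfolding square_integrable_def
    by (intro conjI borel_measurable_indicator) (auto intro!: integrable_real_indicator emeasure_lborel_cball_finite)
qed

lemma square_integrable_gaussian:
  assumes "s > 0"
  shows "square_integrable (\<lambda>x. exp (- (norm (x - a) / s)\<^sup>2 / 2) :: real)"
proof -
  let ?G = "\<lambda>x::R3. exp (- (1 / s * norm x)\<^sup>2 / 2)"
  have "integrable lborel ?G"
    using integrable_norm[OF gaussian_fourier(1)[of "1 / s" "0::R3"]] assms by (simp add: norm_mult)
  from lborel_integrable_affine[OF this, of 1 "- a"]
  have i: "integrable lborel (\<lambda>x. exp (- (norm (x - a) / s)\<^sup>2 / 2))"
    by (simp add: algebra_simps)
  have "integrable lborel (\<lambda>x. (norm (exp (- (norm (x - a) / s)\<^sup>2 / 2)))\<^sup>2)"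
    by (rule Bochner_Integration.integrable_bound[OF i])
      (auto simp: power2_eq_square mult_le_cancel_left1)
  then show ?thesis by (auto simp: square_integrable_def)
qed

lemma fourier_trunc_measurable[measurable]:
  assumes "f \<in> borel_measurable borel"
  shows "fourier_trunc f R \<in> borel_measurable borel"
proof -
  have [measurable]: "cball 0 R \<in> sets (borel :: R3 measure)" by simp
  note assms[measurable]
  have "(\<lambda>(\<xi>, x). indicator (cball 0 R) x *\<^sub>R (cis (- (\<xi> \<bullet> x)) * complex_of_real (f x)))
      \<in> borel_measurable (borel \<Otimes>\<^sub>M borel)"
    by measurable
  then have "(\<lambda>(\<xi>, x). indicator (cball 0 R) x *\<^sub>R (cis (- (\<xi> \<bullet> x)) * complex_of_real (f x)))
      \<in> borel_measurable (borel \<Otimes>\<^sub>M lborel)"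
    by (subst measurable_cong_sets[OF sets_pair_measure_cong[OF refl sets_lborel] refl])
  then have "(\<lambda>\<xi>. LINT x|lborel. indicator (cball 0 R) x *\<^sub>R (cis (- (\<xi> \<bullet> x)) * complex_of_real (f x)))
      \<in> borel_measurable borel"
    by (rule lborel.borel_measurable_lebesgue_integral)
  then show ?thesis
    unfolding fourier_trunc_def set_lebesgue_integral_def
    by (intro borel_measurable_times borel_measurable_const)
qed

lemma DIM_R3: "DIM(R3) = 3"
  by simp

lemma fourier_trunc_gaussian:
  assumes f: "square_integrable f" and s: "s > 0"
    and q: "\<And>R. square_integrable (fourier_trunc f R)"
    and l: "((\<lambda>R. abs_l2 (fourier_trunc f R)) \<longlongrightarrow> 0) at_top"
  shows "(LINT x|lborel. f x * exp (- (norm (x - a) / s)\<^sup>2 / 2)) = 0"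
proof -
  have [measurable]: "f \<in> borel_measurable borel"
    using f by (auto simp: square_integrable_def)
  let ?g = "\<lambda>x. exp (- (norm (x - a) / s)\<^sup>2 / 2) :: real"
  let ?h = "\<lambda>\<xi>::R3. exp (- (s * norm \<xi>)\<^sup>2 / 2) :: real"
  let ?k = "complex_of_real ((2 * pi) powr (- 3 / 2))"
  let ?c = "complex_of_real ((sqrt (2 * pi) / s) ^ 3)"
  define \<phi> where "\<phi> \<xi> = cis (\<xi> \<bullet> a) * complex_of_real (?h \<xi>)" for \<xi> :: R3
  have hq: "square_integrable ?h"
    using square_integrable_gaussian[of "1 / s" 0] s by (simp add: mult.commute)
  have hi: "integrable lborel ?h"
    using integrable_norm[OF gaussian_fourier(1)[OF s, of "0::R3"]] by (simp add: norm_mult)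
  have [measurable]: "\<phi> \<in> borel_measurable borel"
    unfolding \<phi>_def by measurable
  have n\<phi>: "norm (\<phi> \<xi>) = ?h \<xi>" for \<xi>
    by (simp add: \<phi>_def norm_mult)
  have \<phi>q: "square_integrable \<phi>"
    using hq by (auto simp: square_integrable_def n\<phi>)
  have fi: "integrable lborel (\<lambda>x. indicator (cball 0 R) x * f x)" for R
    using square_integrable_inner[OF square_integrable_indicator_cball f] by simp
  have pair: "(LINT \<xi>|lborel. fourier_trunc f R \<xi> * \<phi> \<xi>) =
      ?k * ?c * complex_of_real (LINT x|lborel. indicator (cball 0 R) x * (f x * ?g x))" for R
  proof -
    let ?F = "\<lambda>\<xi> x. indicator (cball 0 R) x *\<^sub>R (cis (- (\<xi> \<bullet> x)) * complex_of_real (f x)) * \<phi> \<xi>"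
    have nF: "norm (?F \<xi> x) = norm (indicator (cball 0 R) x * f x) * ?h \<xi>" for \<xi> x
      by (simp add: norm_mult n\<phi> split: split_indicator)
    have int: "integrable (lborel \<Otimes>\<^sub>M lborel) (\<lambda>(\<xi>, x). ?F \<xi> x)"
    proof (rule lborel_pair.Fubini_integrable)
      have [measurable]: "cball 0 R \<in> sets (borel :: R3 measure)" by simp
      have "(\<lambda>(\<xi>, x). ?F \<xi> x) \<in> borel_measurable (borel \<Otimes>\<^sub>M borel)" by measurable
      then show "(\<lambda>(\<xi>, x). ?F \<xi> x) \<in> borel_measurable (lborel \<Otimes>\<^sub>M lborel)"
        by (simp add: borel_prod lborel_prod)
      have "integrable lborel (\<lambda>\<xi>. (LINT x|lborel. norm (indicator (cball 0 R) x * f x)) * ?h \<xi>)"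
        using hi by (intro integrable_mult_right) auto
      then show "integrable lborel (\<lambda>\<xi>. LINT x|lborel. norm (case (\<xi>, x) of (\<xi>, x) \<Rightarrow> ?F \<xi> x))"
        unfolding prod.case nF by simp
      show "AE \<xi> in lborel. integrable lborel (\<lambda>x. case (\<xi>, x) of (\<xi>, x) \<Rightarrow> ?F \<xi> x)"
      proof (rule AE_I2)
        fix \<xi> :: R3
        have "integrable lborel (\<lambda>x. norm (indicator (cball 0 R) x * f x) * ?h \<xi>)"
          using fi[of R] by (intro integrable_mult_left) (rule integrable_norm)
        then have "integrable lborel (\<lambda>x. norm (?F \<xi> x))"
          unfolding nF .
        moreover have "?F \<xi> \<in> borel_measurable lborel" by measurable
        ultimately have "integrable lborel (?F \<xi>)"
          by (rule integrable_norm_cancel)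
        then show "integrable lborel (\<lambda>x. case (\<xi>, x) of (\<xi>, x) \<Rightarrow> ?F \<xi> x)" by simp
      qed
    qed
    have "(LINT \<xi>|lborel. fourier_trunc f R \<xi> * \<phi> \<xi>) = (LINT \<xi>|lborel. ?k * (LINT x|lborel. ?F \<xi> x))"
      unfolding fourier_trunc_def set_lebesgue_integral_def
      by (intro Bochner_Integration.integral_cong refl)
        (simp only: mult.assoc integral_mult_left_zero[symmetric])
    also have "\<dots> = ?k * (LINT \<xi>|lborel. (LINT x|lborel. ?F \<xi> x))" by simp
    also have "(LINT \<xi>|lborel. (LINT x|lborel. ?F \<xi> x)) = (LINT x|lborel. (LINT \<xi>|lborel. ?F \<xi> x))"
      by (rule lborel_pair.Fubini_integral[OF int, symmetric])
    also have "\<dots> = (LINT x|lborel. ?c * complex_of_real (indicator (cball 0 R) x * (f x * ?g x)))"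
    proof (intro Bochner_Integration.integral_cong refl)
      fix x :: R3
      have "?F \<xi> x = complex_of_real (indicator (cball 0 R) x * f x) *
          (cis ((a - x) \<bullet> \<xi>) * complex_of_real (?h \<xi>))" for \<xi>
      proof -
        have e: "cis ((a - x) \<bullet> \<xi>) = cis (- (\<xi> \<bullet> x)) * cis (\<xi> \<bullet> a)"
          by (simp add: cis_mult inner_diff_right inner_commute)
        show ?thesis
          unfolding \<phi>_def e scaleR_conv_of_real of_real_mult by (simp only: mult_ac)
      qed
      then have "(LINT \<xi>|lborel. ?F \<xi> x) = complex_of_real (indicator (cball 0 R) x * f x) *
          (LINT \<xi>|lborel. cis ((a - x) \<bullet> \<xi>) * complex_of_real (?h \<xi>))"
        by (simp only: integral_mult_right_zero)
      also have "\<dots> = ?c * complex_of_real (indicator (cball 0 R) x * (f x * ?g x))"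
        unfolding gaussian_fourier(2)[OF s] norm_minus_commute[of a x] DIM_R3 of_real_mult
        by (simp only: mult_ac)
      finally show "(LINT \<xi>|lborel. ?F \<xi> x) = ?c * complex_of_real (indicator (cball 0 R) x * (f x * ?g x))" .
    qed
    also have "\<dots> = ?c * complex_of_real (LINT x|lborel. indicator (cball 0 R) x * (f x * ?g x))"
      by (simp only: integral_mult_right_zero integral_complex_of_real)
    finally show ?thesis by (simp only: mult.assoc)
  qed
  have "((\<lambda>R. norm (abs_l2 (fourier_trunc f R)) * norm (abs_l2 \<phi>)) \<longlongrightarrow> 0) at_top"
    using tendsto_norm[OF l] by (intro tendsto_mult_left_zero) simp
  then have "((\<lambda>R. LINT \<xi>|lborel. fourier_trunc f R \<xi> * \<phi> \<xi>) \<longlongrightarrow> 0) at_top"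
  proof (rule Lim_null_comparison[rotated], intro always_eventually allI)
    fix R
    have "norm (LINT \<xi>|lborel. fourier_trunc f R \<xi> * \<phi> \<xi>) \<le>
        (LINT \<xi>|lborel. norm (fourier_trunc f R \<xi>) * norm (\<phi> \<xi>))"
      using integral_norm_bound[of lborel "\<lambda>\<xi>. fourier_trunc f R \<xi> * \<phi> \<xi>"] by (simp add: norm_mult)
    also have "\<dots> \<le> norm (abs_l2 (fourier_trunc f R)) * norm (abs_l2 \<phi>)"
      by (rule L2_Cauchy_Schwarz[OF q \<phi>q])
    finally show "norm (LINT \<xi>|lborel. fourier_trunc f R \<xi> * \<phi> \<xi>) \<le>
        norm (abs_l2 (fourier_trunc f R)) * norm (abs_l2 \<phi>)" .
  qed
  then have l': "((\<lambda>R. ?k * ?c * complex_of_real (LINT x|lborel. indicator (cball 0 R) x * (f x * ?g x)))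
      \<longlongrightarrow> ?k * ?c * complex_of_real 0) at_top"
    unfolding pair of_real_0 mult_zero_right .
  have "?k * ?c \<noteq> 0" using s by simp
  from l' have "((\<lambda>R. complex_of_real (LINT x|lborel. indicator (cball 0 R) x * (f x * ?g x)))
      \<longlongrightarrow> complex_of_real 0) at_top"
    unfolding tendsto_mult_left_iff[OF \<open>?k * ?c \<noteq> 0\<close>] .
  then have "((\<lambda>R. LINT x|lborel. indicator (cball 0 R) x * (f x * ?g x)) \<longlongrightarrow> 0) at_top"
    by (subst (asm) tendsto_of_real_iff)
  then have 0: "(\<lambda>n. LINT x|lborel. indicator (cball 0 (real n)) x * (f x * ?g x)) \<longlonglongrightarrow> 0"
    by (rule filterlim_compose) (rule filterlim_real_sequentially)
  have fg: "integrable lborel (\<lambda>x. f x * ?g x)"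
    using square_integrable_inner[OF f square_integrable_gaussian[OF s]] by simp
  have "(\<lambda>n. LINT x|lborel. indicator (cball 0 (real n)) x * (f x * ?g x))
      \<longlonglongrightarrow> (LINT x|lborel. f x * ?g x)"
  proof (rule integral_dominated_convergence[where w="\<lambda>x. norm (f x * ?g x)"])
    show "AE x in lborel. (\<lambda>n. indicator (cball 0 (real n)) x * (f x * ?g x)) \<longlonglongrightarrow> f x * ?g x"
    proof (rule AE_I2, rule tendsto_eventually)
      fix x :: R3
      obtain N :: nat where "norm x \<le> real N" using real_arch_simple by blast
      then have "\<forall>n\<ge>N. x \<in> cball 0 (real n)" by auto
      then show "\<forall>\<^sub>F n in sequentially. indicator (cball 0 (real n)) x * (f x * ?g x) = f x * ?g x"
        unfolding eventually_sequentially by (intro exI[of _ N]) (auto simp: indicator_def)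
    qed
    show "AE x in lborel. norm (indicator (cball 0 (real n)) x * (f x * ?g x)) \<le> norm (f x * ?g x)" for n
      by (intro AE_I2) (simp add: indicator_def)
    show "integrable lborel (\<lambda>x. norm (f x * ?g x))"
      by (rule integrable_norm[OF fg])
    show "(\<lambda>x. f x * ?g x) \<in> borel_measurable lborel"
      using fg by (rule borel_measurable_integrable)
    show "(\<lambda>x. indicator (cball 0 (real n)) x * (f x * ?g x)) \<in> borel_measurable lborel" for n
      by (intro borel_measurable_times borel_measurable_indicator borel_measurable_integrable[OF fg]) simp
  qed
  then show ?thesis using 0 by (rule LIMSEQ_unique)
qed

lemma square_integrable_indicator_box:
  "square_integrable (indicator (box p q) :: R3 \<Rightarrow> real)"
proof -
  have "(\<lambda>x. (norm (indicator (box p q) x :: real))\<^sup>2) = (indicator (box p q) :: R3 \<Rightarrow> real)"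
    by (auto split: split_indicator)
  then show ?thesis
    unfolding square_integrable_def
    by (intro conjI borel_measurable_indicator) (auto intro!: integrable_real_indicator emeasure_lborel_box_finite)
qed

lemma square_integrable_translate:
  fixes f :: "R3 \<Rightarrow> 'b::euclidean_space"
  assumes f: "square_integrable f"
  shows "square_integrable (\<lambda>x. f (x + w))"
    and "norm (abs_l2 (\<lambda>x. f (x + w))) = norm (abs_l2 f)"
proof -
  have [measurable]: "f \<in> borel_measurable borel"
    using f by (auto simp: square_integrable_def)
  have "integrable lborel (\<lambda>x. (norm (f x))\<^sup>2)"
    using f by (auto simp: square_integrable_def)
  from lborel_integrable_affine[OF this, of 1 w]
  show *: "square_integrable (\<lambda>x. f (x + w))"
    by (simp add: square_integrable_def add.commute)
  have "(LINT x|lborel. (norm (f x))\<^sup>2) = (LINT x|lborel. (norm (f (x + w)))\<^sup>2)"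
    by (subst lborel_integral_affine[where c=1 and t=w]) (auto simp: add.commute)
  then show "norm (abs_l2 (\<lambda>x. f (x + w))) = norm (abs_l2 f)"
    using f * by (simp add: norm_abs_l2)
qed

lemma AE_eq_0_if_gaussian_means_0:
  assumes f: "square_integrable f"
    and g: "\<And>a s. s > 0 \<Longrightarrow> (LINT x|lborel. f x * exp (- (norm (x - a) / s)\<^sup>2 / 2)) = 0"
  shows "AE x in lborel. f x = 0"
proof (rule AE_eq_0_if_box_integrals_0)
  show m[measurable]: "f \<in> borel_measurable borel"
    using f by (auto simp: square_integrable_def)
  show "integrable lborel (\<lambda>x. indicator (box p q) x * f x)" for p q
    using square_integrable_inner[OF square_integrable_indicator_box f, of p q] by simp
  fix p q :: R3
  let ?B = "indicator (box p q) :: R3 \<Rightarrow> real"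
  let ?G = "\<lambda>z::R3. exp (- (norm z)\<^sup>2 / 2)"
  let ?C = "norm (abs_l2 ?B) * norm (abs_l2 f)"
  have [measurable]: "box p q \<in> sets borel" by simp
  have G: "integrable lborel ?G" "(LINT z|lborel. ?G z) > 0"
  proof -
    show i: "integrable lborel ?G"
      using integrable_norm[OF gaussian_fourier(1)[of 1 "0::R3"]] by (simp add: norm_mult)
    have "complex_of_real (LINT z|lborel. ?G z) = complex_of_real (sqrt (2 * pi) ^ 3)"
      using gaussian_fourier(2)[of 1 "0::R3"] by simp
    then have "(LINT z|lborel. ?G z) = sqrt (2 * pi) ^ 3"
      unfolding of_real_eq_iff .
    then show "(LINT z|lborel. ?G z) > 0" by simp
  qed
  have A: "(LINT z|lborel. ?G z * f (y + s *\<^sub>R z)) = 0" if s: "s > 0" for y s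
  proof -
    have "0 = (LINT x|lborel. f x * exp (- (norm (x - y) / s)\<^sup>2 / 2))"
      using g[OF s] by simp
    also have "\<dots> = \<bar>s\<bar> ^ DIM(R3) *\<^sub>R
        (LINT z|lborel. f (y + s *\<^sub>R z) * exp (- (norm ((y + s *\<^sub>R z) - y) / s)\<^sup>2 / 2))"
      using s by (intro lborel_integral_affine) auto
    also have "\<dots> = s ^ 3 * (LINT z|lborel. ?G z * f (y + s *\<^sub>R z))"
      using s by (simp add: mult.commute)
    finally show ?thesis using s by simp
  qed
  define F where "F w = (LINT y|lborel. ?B y * f (y + w))" for w
  have Bf: "integrable lborel (\<lambda>y. ?B y * f (y + w))" for w
    using square_integrable_inner[OF square_integrable_indicator_box square_integrable_translate(1)[OF f], of p q w]
    by simp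
  have Fabs: "(LINT y|lborel. norm (?B y * f (y + w))) \<le> ?C" for w
    using L2_Cauchy_Schwarz[OF square_integrable_indicator_box square_integrable_translate(1)[OF f], of p q w]
    by (simp only: norm_mult square_integrable_translate(2)[OF f])
  have F_le: "norm (F w) \<le> ?C" for w
    unfolding F_def using integral_norm_bound[of lborel "\<lambda>y. ?B y * f (y + w)"] Fabs[of w] by linarith
  have mF: "(\<lambda>w. LINT y|lborel. h (?B y * f (y + w))) \<in> borel_measurable borel"
    if "h \<in> borel_measurable borel" for h :: "real \<Rightarrow> real"
  proof (rule lborel.borel_measurable_lebesgue_integral)
    note that[measurable]
    have "(\<lambda>(w, y). h (?B y * f (y + w))) \<in> borel_measurable (borel \<Otimes>\<^sub>M borel)"
      by measurable
    then show "(\<lambda>(w, y). h (?B y * f (y + w))) \<in> borel_measurable (borel \<Otimes>\<^sub>M lborel)"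
      by (subst measurable_cong_sets[OF sets_pair_measure_cong[OF refl sets_lborel] refl])
  qed
  have [measurable]: "F \<in> borel_measurable borel"
    using mF[of "\<lambda>t. t"] unfolding F_def by simp
  have mN[measurable]: "(\<lambda>w. LINT y|lborel. norm (?B y * f (y + w))) \<in> borel_measurable borel"
    using mF[of norm] by simp
  have B: "(LINT z|lborel. ?G z * F (s *\<^sub>R z)) = 0" if s: "s > 0" for s
  proof -
    let ?H = "\<lambda>z y. ?G z * (?B y * f (y + s *\<^sub>R z))"
    have int: "integrable (lborel \<Otimes>\<^sub>M lborel) (\<lambda>(z, y). ?H z y)"
    proof (rule lborel_pair.Fubini_integrable)
      have "(\<lambda>(z, y). ?H z y) \<in> borel_measurable (borel \<Otimes>\<^sub>M borel)" by measurable
      then show "(\<lambda>(z, y). ?H z y) \<in> borel_measurable (lborel \<Otimes>\<^sub>M lborel)"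
        by (simp add: borel_prod lborel_prod)
      have e: "(LINT y|lborel. norm (?H z y)) = ?G z * (LINT y|lborel. norm (?B y * f (y + s *\<^sub>R z)))" for z
        by (subst integral_mult_right_zero[symmetric]) (simp add: abs_mult)
      have "integrable lborel (\<lambda>z. ?G z * (LINT y|lborel. norm (?B y * f (y + s *\<^sub>R z))))"
      proof (rule Bochner_Integration.integrable_bound)
        show "integrable lborel (\<lambda>z. ?G z * ?C)"
          using G(1) by (rule integrable_mult_left)
        show "AE z in lborel. norm (?G z * (LINT y|lborel. norm (?B y * f (y + s *\<^sub>R z)))) \<le> norm (?G z * ?C)"
        proof (rule AE_I2)
          fix z :: R3
          have "0 \<le> (LINT y|lborel. norm (?B y * f (y + s *\<^sub>R z)))"
            by (rule Bochner_Integration.integral_nonneg) simp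
          then show "norm (?G z * (LINT y|lborel. norm (?B y * f (y + s *\<^sub>R z)))) \<le> norm (?G z * ?C)"
            using Fabs[of "s *\<^sub>R z"] unfolding norm_mult by (intro mult_left_mono) auto
        qed
        have "(\<lambda>z. LINT y|lborel. norm (?B y * f (y + s *\<^sub>R z))) \<in> borel_measurable borel"
          by (rule measurable_compose[OF _ mN]) measurable
        then show "(\<lambda>z. ?G z * (LINT y|lborel. norm (?B y * f (y + s *\<^sub>R z)))) \<in> borel_measurable lborel"
          by (intro borel_measurable_times) auto
      qed
      then show "integrable lborel (\<lambda>z. LINT y|lborel. norm (case (z, y) of (z, y) \<Rightarrow> ?H z y))"
        unfolding prod.case e .
      show "AE z in lborel. integrable lborel (\<lambda>y. case (z, y) of (z, y) \<Rightarrow> ?H z y)"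
        unfolding prod.case by (intro AE_I2 integrable_mult_right Bf)
    qed
    have "(LINT z|lborel. ?G z * F (s *\<^sub>R z)) = (LINT z|lborel. (LINT y|lborel. ?H z y))"
      unfolding F_def integral_mult_right_zero ..
    also have "\<dots> = (LINT y|lborel. (LINT z|lborel. ?H z y))"
      by (rule lborel_pair.Fubini_integral[OF int, symmetric])
    also have "\<dots> = (LINT y|(lborel :: R3 measure). 0)"
    proof (intro Bochner_Integration.integral_cong refl)
      fix y :: R3
      have "(LINT z|lborel. ?H z y) = (LINT z|lborel. ?B y * (?G z * f (y + s *\<^sub>R z)))"
        by (simp only: mult_ac)
      also have "\<dots> = 0"
        unfolding integral_mult_right_zero A[OF s] by simp
      finally show "(LINT z|lborel. ?H z y) = 0" .
    qed
    finally show ?thesis by simp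
  qed
  have F_shift: "F w = (LINT x|lborel. ?B (x - w) * f x)" for w
    unfolding F_def
    by (subst lborel_integral_affine[where c=1 and t=w and f="\<lambda>x. ?B (x - w) * f x"])
      (auto simp: add.commute)
  have F_lim: "(\<lambda>n. F ((1 / Suc n) *\<^sub>R z)) \<longlonglongrightarrow> F 0" for z
  proof -
    obtain r where r: "box p q \<subseteq> cball 0 r" 
      using bounded_box[of p q] unfolding bounded_iff by (metis mem_cball_0 subsetI)
    let ?w = "\<lambda>x. indicator (cball 0 (r + norm z)) x * norm (f x)"
    have zn: "(\<lambda>n. (1 / Suc n) *\<^sub>R z) \<longlonglongrightarrow> 0"
      using tendsto_scaleR[OF LIMSEQ_inverse_real_of_nat tendsto_const, of z]
      by (simp add: inverse_eq_divide)
    show ?thesis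
      unfolding F_shift
    proof (rule integral_dominated_convergence[where w="?w"])
      show "integrable lborel ?w"
        using square_integrable_inner[OF square_integrable_indicator_cball square_integrable_of_norm[OF f]]
        by simp
      show "(\<lambda>x. ?B (x - 0) * f x) \<in> borel_measurable lborel" by simp
      show "(\<lambda>x. ?B (x - (1 / Suc n) *\<^sub>R z) * f x) \<in> borel_measurable lborel" for n
        by measurable
      have "cbox p q - box p q \<in> null_sets lborel"
        using negligible_frontier_interval[of p q] null_sets_completion_iff[of "cbox p q - box p q" lborel]
        by (simp add: negligible_iff_null_sets)
      then have "AE x in lborel. x \<notin> cbox p q - box p q" by (rule AE_not_in)
      then show "AE x in lborel. (\<lambda>n. ?B (x - (1 / Suc n) *\<^sub>R z) * f x) \<longlonglongrightarrow> ?B (x - 0) * f x"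
      proof eventually_elim
        case (elim x)
        have l: "(\<lambda>n. x - (1 / Suc n) *\<^sub>R z) \<longlonglongrightarrow> x"
          using tendsto_diff[OF tendsto_const zn, of x] by simp
        have "\<forall>\<^sub>F n in sequentially. ?B (x - (1 / Suc n) *\<^sub>R z) = ?B x"
        proof (cases "x \<in> box p q")
          case True
          show ?thesis
            using topological_tendstoD[OF l open_box True]
            by eventually_elim (simp only: indicator_simps True)
        next
          case False
          then have "x \<in> - cbox p q" using elim by auto
          from topological_tendstoD[OF l open_Compl[OF closed_cbox] this]
          have "\<forall>\<^sub>F n in sequentially. x - (1 / Suc n) *\<^sub>R z \<in> - cbox p q"
            .
          then show ?thesis
          proof eventually_elim
            case (elim n)
            then have "x - (1 / Suc n) *\<^sub>R z \<notin> box p q"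
              using box_subset_cbox[of p q] by auto
            then show ?case by (simp only: indicator_simps False not_False_eq_True)
          qed
        qed
        then show ?case
          by (intro tendsto_mult tendsto_const) (auto intro: tendsto_eventually)
      qed
      show "AE x in lborel. norm (?B (x - (1 / Suc n) *\<^sub>R z) * f x) \<le> ?w x" for n
      proof (rule AE_I2)
        fix x :: R3
        have "x \<in> cball 0 (r + norm z)" if "x - (1 / Suc n) *\<^sub>R z \<in> box p q"
        proof -
          have "norm x \<le> norm (x - (1 / Suc n) *\<^sub>R z) + norm ((1 / Suc n) *\<^sub>R z)"
            using norm_triangle_ineq[of "x - (1 / Suc n) *\<^sub>R z" "(1 / Suc n) *\<^sub>R z"] by simp
          also have "norm (x - (1 / Suc n) *\<^sub>R z) \<le> r"
            using that r by auto
          also have "norm ((1 / Suc n) *\<^sub>R z) \<le> norm z"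
            by (simp add: divide_le_eq mult_le_cancel_left1)
          finally show ?thesis by simp
        qed
        then show "norm (?B (x - (1 / Suc n) *\<^sub>R z) * f x) \<le> ?w x"
          by (simp add: indicator_def)
      qed
    qed
  qed
  have "(\<lambda>n. LINT z|lborel. ?G z * F ((1 / Suc n) *\<^sub>R z)) \<longlonglongrightarrow> (LINT z|lborel. ?G z * F 0)"
  proof (rule integral_dominated_convergence[where w="\<lambda>z. ?G z * ?C"])
    show "integrable lborel (\<lambda>z. ?G z * ?C)"
      using G(1) by (rule integrable_mult_left)
    show "AE z in lborel. (\<lambda>n. ?G z * F ((1 / Suc n) *\<^sub>R z)) \<longlonglongrightarrow> ?G z * F 0"
      by (intro AE_I2 tendsto_mult tendsto_const F_lim)
    show "AE z in lborel. norm (?G z * F ((1 / Suc n) *\<^sub>R z)) \<le> ?G z * ?C" for n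
      unfolding norm_mult using F_le by (intro AE_I2 mult_mono) auto
  qed measurable
  moreover have "(LINT z|lborel. ?G z * F ((1 / Suc n) *\<^sub>R z)) = 0" for n
    by (rule B) simp
  ultimately have "(LINT z|lborel. ?G z * F 0) = 0"
    by (simp add: LIMSEQ_const_iff)
  then have "F 0 = 0" using G(2) by simp
  then show "(LINT x|lborel. ?B x * f x) = 0" by (simp add: F_def)
qed

lemma has_fourier_0_imp:
  assumes "has_fourier u 0"
  shows "u = 0"
proof -
  have "AE x in lborel. rep_l2 u x = 0"
    using assms square_integrable_rep
    by (intro AE_eq_0_if_gaussian_means_0 fourier_trunc_gaussian) (auto simp: has_fourier_def)
  then have "abs_l2 (rep_l2 u) = abs_l2 (\<lambda>x. 0)"
    by (simp add: abs_l2_eq_iff square_integrable_rep square_integrable_0)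
  then show ?thesis by (simp add: abs_rep_l2 zero_l2_def)
qed

lemma integrable_fourier_trunc:
  assumes f: "square_integrable f"
  shows "integrable lborel (\<lambda>x. indicator (cball 0 R) x *\<^sub>R (cis (- (\<xi> \<bullet> x)) * complex_of_real (f x)))"
proof -
  have [measurable]: "f \<in> borel_measurable borel"
    using f by (auto simp: square_integrable_def)
  have [measurable]: "cball 0 R \<in> sets (borel :: R3 measure)" by simp
  have "integrable lborel (\<lambda>x. indicator (cball 0 R) x * f x)"
    using square_integrable_inner[OF square_integrable_indicator_cball f] by simp
  then show ?thesis
    by (rule Bochner_Integration.integrable_bound) (auto simp: norm_mult)
qed

lemma fourier_trunc_cong_AE:
  assumes f: "square_integrable f" and g: "square_integrable g"
    and eq: "AE x in lborel. f x = g x"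
  shows "fourier_trunc f R \<xi> = fourier_trunc g R \<xi>"
proof -
  have "(LINT x|lborel. indicator (cball 0 R) x *\<^sub>R (cis (- (\<xi> \<bullet> x)) * complex_of_real (f x))) =
      (LINT x|lborel. indicator (cball 0 R) x *\<^sub>R (cis (- (\<xi> \<bullet> x)) * complex_of_real (g x)))"
  proof (rule integral_cong_AE)
    show "AE x in lborel. indicator (cball 0 R) x *\<^sub>R (cis (- (\<xi> \<bullet> x)) * complex_of_real (f x)) =
        indicator (cball 0 R) x *\<^sub>R (cis (- (\<xi> \<bullet> x)) * complex_of_real (g x))"
      using eq by eventually_elim simp
  qed (intro borel_measurable_integrable integrable_fourier_trunc f g)+
  then show ?thesis by (simp add: fourier_trunc_def set_lebesgue_integral_def)
qed

lemma fourier_trunc_add: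
  assumes f: "square_integrable f" and g: "square_integrable g"
  shows "fourier_trunc (\<lambda>x. f x + g x) R \<xi> = fourier_trunc f R \<xi> + fourier_trunc g R \<xi>"
  unfolding fourier_trunc_def set_lebesgue_integral_def of_real_add distrib_left scaleR_add_right
  by (subst Bochner_Integration.integral_add[OF integrable_fourier_trunc[OF f] integrable_fourier_trunc[OF g]])
    (simp only: distrib_left)

lemma fourier_trunc_scaleR:
  "fourier_trunc (\<lambda>x. c *\<^sub>R f x) R \<xi> = c *\<^sub>R fourier_trunc f R \<xi>"
proof -
  have "indicator (cball 0 R) x *\<^sub>R (cis (- (\<xi> \<bullet> x)) * complex_of_real (c *\<^sub>R f x)) =
      c *\<^sub>R (indicator (cball 0 R) x *\<^sub>R (cis (- (\<xi> \<bullet> x)) * complex_of_real (f x)))" for x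
    by (simp add: scaleR_conv_of_real)
  then show ?thesis
    unfolding fourier_trunc_def set_lebesgue_integral_def
    by (simp only: integral_scaleR_right mult_scaleR_right)
qed

lemma has_fourier_add:
  assumes u: "has_fourier u v" and u': "has_fourier u' v'"
  shows "has_fourier (u + u') (v + v')"
proof -
  have t: "fourier_trunc (rep_l2 (u + u')) R =
      (\<lambda>\<xi>. fourier_trunc (rep_l2 u) R \<xi> + fourier_trunc (rep_l2 u') R \<xi>)" for R
    by (rule ext, subst fourier_trunc_cong_AE[OF _ _ rep_l2_add])
      (auto simp: fourier_trunc_add square_integrable_rep square_integrable_add)
  have q: "square_integrable (fourier_trunc (rep_l2 u) R)" "square_integrable (fourier_trunc (rep_l2 u') R)" for R
    using u u' by (auto simp: has_fourier_def)
  have "((\<lambda>R. abs_l2 (fourier_trunc (rep_l2 u) R) + abs_l2 (fourier_trunc (rep_l2 u') R)) \<longlongrightarrow> v + v') at_top"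
    using u u' by (intro tendsto_add) (auto simp: has_fourier_def)
  then show ?thesis
    unfolding has_fourier_def t using q by (simp add: abs_l2_add square_integrable_add)
qed

lemma has_fourier_scaleR:
  assumes u: "has_fourier u v"
  shows "has_fourier (c *\<^sub>R u) (c *\<^sub>R v)"
proof -
  have t: "fourier_trunc (rep_l2 (c *\<^sub>R u)) R = (\<lambda>\<xi>. c *\<^sub>R fourier_trunc (rep_l2 u) R \<xi>)" for R
    by (rule ext, subst fourier_trunc_cong_AE[OF _ _ rep_l2_scaleR])
      (auto simp: fourier_trunc_scaleR[simplified] square_integrable_rep
        intro: square_integrable_scaleR[OF square_integrable_rep, of c u, simplified])
  have q: "square_integrable (fourier_trunc (rep_l2 u) R)" for R
    using u by (auto simp: has_fourier_def)
  have "((\<lambda>R. c *\<^sub>R abs_l2 (fourier_trunc (rep_l2 u) R)) \<longlongrightarrow> c *\<^sub>R v) at_top"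
    using u by (intro tendsto_scaleR tendsto_const) (auto simp: has_fourier_def)
  then show ?thesis
    unfolding has_fourier_def t using q by (simp add: abs_l2_scaleR square_integrable_scaleR)
qed

lemma has_fourier_unique: "has_fourier u v \<Longrightarrow> has_fourier u v' \<Longrightarrow> v = v'"
  unfolding has_fourier_def by (blast intro: tendsto_unique[OF trivial_limit_at_top_linorder])

lemma fourier_eqI: "has_fourier u v \<Longrightarrow> fourier u = v"
  unfolding fourier_def by (blast intro: has_fourier_unique)

lemma has_fourier_inj:
  assumes "has_fourier u v" "has_fourier u' v"
  shows "u = u'"
proof -
  have "has_fourier (u + (-1) *\<^sub>R u') (v + (-1) *\<^sub>R v)"
    using assms by (intro has_fourier_add has_fourier_scaleR)
  then have "u + (-1) *\<^sub>R u' = 0" by (intro has_fourier_0_imp) simp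
  then show ?thesis by simp
qed

definition mult_domain :: "(R3 \<Rightarrow> real) \<Rightarrow> complex l2 set" where
  "mult_domain a = {v. square_integrable (\<lambda>\<xi>. a \<xi> *\<^sub>R rep_l2 v \<xi>)}"

definition mult_l2 :: "(R3 \<Rightarrow> real) \<Rightarrow> complex l2 \<Rightarrow> complex l2" where
  "mult_l2 a v = abs_l2 (\<lambda>\<xi>. a \<xi> *\<^sub>R rep_l2 v \<xi>)"

definition weight :: "real \<Rightarrow> R3 \<Rightarrow> real" where
  "weight s \<xi> = (1 + (norm \<xi>)\<^sup>2) powr (s / 2)"

definition sobolev :: "real \<Rightarrow> real l2 set" where
  "sobolev s = {u. \<exists>v. has_fourier u v \<and> v \<in> mult_domain (weight s)}"

definition sobolev_norm :: "real \<Rightarrow> real l2 \<Rightarrow> real" where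
  "sobolev_norm s u = norm (mult_l2 (weight s) (fourier u))"

(* A class is radial if one of its representatives depends on the norm of the argument only. *)

definition radial :: "real l2 \<Rightarrow> bool" where
  "radial u \<longleftrightarrow> (\<exists>f. square_integrable f \<and> u = abs_l2 f \<and> (\<forall>x y. norm x = norm y \<longrightarrow> f x = f y))"

definition radial_sobolev :: "real \<Rightarrow> real l2 set" where
  "radial_sobolev s = {u \<in> sobolev s. radial u}"

lemma weight_pos: "weight s \<xi> > 0"
  unfolding weight_def powr_gt_zero using zero_le_power2[of "norm \<xi>"] by linarith

lemma weight_measurable[measurable]: "weight s \<in> borel_measurable borel"
  unfolding weight_def[abs_def] by measurable

lemma mult_add:
  assumes a: "a \<in> borel_measurable borel" and v: "v \<in> mult_domain a" and w: "w \<in> mult_domain a"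
  shows "v + w \<in> mult_domain a" "mult_l2 a (v + w) = mult_l2 a v + mult_l2 a w"
proof -
  note a[measurable]
  have [measurable]: "rep_l2 u \<in> borel_measurable borel" for u :: "complex l2"
    using square_integrable_rep[of u] by (auto simp: square_integrable_def)
  have e: "AE \<xi> in lborel. a \<xi> *\<^sub>R rep_l2 v \<xi> + a \<xi> *\<^sub>R rep_l2 w \<xi> = a \<xi> *\<^sub>R rep_l2 (v + w) \<xi>"
    using rep_l2_add[of v w] by eventually_elim (simp add: scaleR_add_right)
  have q: "square_integrable (\<lambda>\<xi>. a \<xi> *\<^sub>R rep_l2 v \<xi> + a \<xi> *\<^sub>R rep_l2 w \<xi>)"
    using v w by (intro square_integrable_add) (auto simp: mult_domain_def)
  then show vw: "v + w \<in> mult_domain a"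
    unfolding mult_domain_def mem_Collect_eq by (rule square_integrable_cong_AE[OF _ _ e]) measurable
  show "mult_l2 a (v + w) = mult_l2 a v + mult_l2 a w"
    using v w vw q e by (simp add: mult_l2_def mult_domain_def abs_l2_add abs_l2_eq_iff AE_symmetric)
qed

lemma mult_scaleR:
  assumes a: "a \<in> borel_measurable borel" and v: "v \<in> mult_domain a"
  shows "c *\<^sub>R v \<in> mult_domain a" "mult_l2 a (c *\<^sub>R v) = c *\<^sub>R mult_l2 a v"
proof -
  note a[measurable]
  have [measurable]: "rep_l2 u \<in> borel_measurable borel" for u :: "complex l2"
    using square_integrable_rep[of u] by (auto simp: square_integrable_def)
  have e: "AE \<xi> in lborel. c *\<^sub>R a \<xi> *\<^sub>R rep_l2 v \<xi> = a \<xi> *\<^sub>R rep_l2 (c *\<^sub>R v) \<xi>"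
    using rep_l2_scaleR[of c v] by eventually_elim simp
  have q: "square_integrable (\<lambda>\<xi>. c *\<^sub>R a \<xi> *\<^sub>R rep_l2 v \<xi>)"
    using v by (intro square_integrable_scaleR) (auto simp: mult_domain_def)
  then show cv: "c *\<^sub>R v \<in> mult_domain a"
    unfolding mult_domain_def mem_Collect_eq by (rule square_integrable_cong_AE[OF _ _ e]) measurable
  show "mult_l2 a (c *\<^sub>R v) = c *\<^sub>R mult_l2 a v"
    unfolding mult_l2_def
    using v cv q e by (subst abs_l2_scaleR) (auto simp: mult_domain_def abs_l2_eq_iff simp del: scaleR_scaleR elim: AE_mp)
qed

lemma mult_l2_weight_eq_0:
  assumes "v \<in> mult_domain (weight s)" "mult_l2 (weight s) v = 0"
  shows "v = 0"
proof -
  have "abs_l2 (\<lambda>\<xi>. weight s \<xi> *\<^sub>R rep_l2 v \<xi>) = abs_l2 (\<lambda>\<xi>. 0)"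
    using assms by (simp add: mult_l2_def zero_l2_def)
  then have "AE \<xi> in lborel. weight s \<xi> *\<^sub>R rep_l2 v \<xi> = 0"
    using assms by (simp add: abs_l2_eq_iff square_integrable_0 mult_domain_def)
  then have "AE \<xi> in lborel. rep_l2 v \<xi> = 0"
    by eventually_elim (use weight_pos[of s] in \<open>auto simp: less_le\<close>)
  then have "abs_l2 (rep_l2 v) = abs_l2 (\<lambda>x. 0)"
    by (simp add: abs_l2_eq_iff square_integrable_rep square_integrable_0)
  then show ?thesis by (simp add: abs_rep_l2 zero_l2_def)
qed

lemma sobolev_fourier:
  assumes "u \<in> sobolev s"
  shows "has_fourier u (fourier u)" "fourier u \<in> mult_domain (weight s)"
  using assms fourier_eqI by (auto simp: sobolev_def)

lemma has_fourier_0: "has_fourier 0 0"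
proof -
  have "fourier_trunc (rep_l2 0) R \<xi> = fourier_trunc (\<lambda>x. 0) R \<xi>" for R \<xi>
    using rep_abs_l2[OF square_integrable_0]
    by (intro fourier_trunc_cong_AE square_integrable_rep square_integrable_0) (simp add: zero_l2_def)
  then have "fourier_trunc (rep_l2 0) R = (\<lambda>\<xi>. 0)" for R
    by (intro ext) (simp add: fourier_trunc_def)
  then show ?thesis
    by (simp add: has_fourier_def square_integrable_0 zero_l2_def)
qed

lemma radial_sobolev_0: "0 \<in> radial_sobolev s"
proof -
  have "AE \<xi> in lborel. 0 = weight s \<xi> *\<^sub>R rep_l2 (0 :: complex l2) \<xi>"
    using rep_abs_l2[OF square_integrable_0, where ?'a=complex]
    unfolding zero_l2_def by eventually_elim simp
  moreover have "rep_l2 (0 :: complex l2) \<in> borel_measurable borel"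
    using square_integrable_rep[of "0 :: complex l2"] by (auto simp: square_integrable_def)
  ultimately have "0 \<in> mult_domain (weight s)"
    unfolding mult_domain_def mem_Collect_eq
    by (intro square_integrable_cong_AE[OF square_integrable_0]) auto
  moreover have "radial 0"
    unfolding radial_def zero_l2_def by (intro exI[of _ "\<lambda>x. 0"]) (simp add: square_integrable_0)
  ultimately show ?thesis
    using has_fourier_0 by (auto simp: radial_sobolev_def sobolev_def)
qed

lemma radial_sobolev_add:
  assumes u: "u \<in> radial_sobolev s" and v: "v \<in> radial_sobolev s"
  shows "u + v \<in> radial_sobolev s"
proof -
  have "has_fourier (u + v) (fourier u + fourier v)"
    using u v by (intro has_fourier_add sobolev_fourier) (auto simp: radial_sobolev_def)
  moreover have "fourier u + fourier v \<in> mult_domain (weight s)"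
    using u v by (intro mult_add sobolev_fourier) (auto simp: radial_sobolev_def)
  moreover have "radial (u + v)"
  proof -
    obtain f where f: "square_integrable f" "u = abs_l2 f" "\<forall>x y. norm x = norm y \<longrightarrow> f x = f y"
      using u unfolding radial_sobolev_def radial_def by blast
    obtain g where g: "square_integrable g" "v = abs_l2 g" "\<forall>x y. norm x = norm y \<longrightarrow> g x = g y"
      using v unfolding radial_sobolev_def radial_def by blast
    have "u + v = abs_l2 (\<lambda>x. f x + g x)"
      unfolding f(2) g(2) by (rule abs_l2_add[OF f(1) g(1)])
    moreover have "\<forall>x y. norm x = norm y \<longrightarrow> f x + g x = f y + g y"
      using f(3) g(3) by (metis (no_types))
    ultimately show ?thesis
      unfolding radial_def using square_integrable_add[OF f(1) g(1)] by blast
  qed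
  ultimately show ?thesis by (auto simp: radial_sobolev_def sobolev_def)
qed

lemma radial_sobolev_scaleR:
  assumes u: "u \<in> radial_sobolev s"
  shows "c *\<^sub>R u \<in> radial_sobolev s"
proof -
  have "has_fourier (c *\<^sub>R u) (c *\<^sub>R fourier u)"
    using u by (intro has_fourier_scaleR sobolev_fourier) (auto simp: radial_sobolev_def)
  moreover have "c *\<^sub>R fourier u \<in> mult_domain (weight s)"
    using u by (intro mult_scaleR sobolev_fourier) (auto simp: radial_sobolev_def)
  moreover have "radial (c *\<^sub>R u)"
  proof -
    obtain f where f: "square_integrable f" "u = abs_l2 f" "\<forall>x y. norm x = norm y \<longrightarrow> f x = f y"
      using u unfolding radial_sobolev_def radial_def by blast
    have "c *\<^sub>R u = abs_l2 (\<lambda>x. c *\<^sub>R f x)"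
      unfolding f(2) by (rule abs_l2_scaleR[OF f(1)])
    moreover have "\<forall>x y. norm x = norm y \<longrightarrow> c *\<^sub>R f x = c *\<^sub>R f y"
      using f(3) by (metis (no_types))
    ultimately show ?thesis
      unfolding radial_def using square_integrable_scaleR[OF f(1)] by blast
  qed
  ultimately show ?thesis by (auto simp: radial_sobolev_def sobolev_def)
qed

lemma sobolev_norm_add:
  assumes u: "u \<in> radial_sobolev s" and v: "v \<in> radial_sobolev s"
  shows "sobolev_norm s (u + v) \<le> sobolev_norm s u + sobolev_norm s v"
proof -
  have "fourier (u + v) = fourier u + fourier v"
    using u v by (intro fourier_eqI has_fourier_add sobolev_fourier) (auto simp: radial_sobolev_def)
  moreover have "mult_l2 (weight s) (fourier u + fourier v) =
      mult_l2 (weight s) (fourier u) + mult_l2 (weight s) (fourier v)"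
    using u v by (intro mult_add sobolev_fourier) (auto simp: radial_sobolev_def)
  ultimately show ?thesis by (simp add: sobolev_norm_def norm_triangle_ineq)
qed

lemma sobolev_norm_scaleR:
  assumes u: "u \<in> radial_sobolev s"
  shows "sobolev_norm s (c *\<^sub>R u) = \<bar>c\<bar> * sobolev_norm s u"
proof -
  have "fourier (c *\<^sub>R u) = c *\<^sub>R fourier u"
    using u by (intro fourier_eqI has_fourier_scaleR sobolev_fourier) (auto simp: radial_sobolev_def)
  moreover have "mult_l2 (weight s) (c *\<^sub>R fourier u) = c *\<^sub>R mult_l2 (weight s) (fourier u)"
    using u by (intro mult_scaleR sobolev_fourier) (auto simp: radial_sobolev_def)
  ultimately show ?thesis by (simp add: sobolev_norm_def)
qed

lemma sobolev_norm_eq_0: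
  assumes u: "u \<in> radial_sobolev s"
  shows "sobolev_norm s u = 0 \<longleftrightarrow> u = 0"
proof
  assume 0: "sobolev_norm s u = 0"
  have us: "u \<in> sobolev s" using u by (simp add: radial_sobolev_def)
  have "mult_l2 (weight s) (fourier u) = 0"
    using 0 unfolding sobolev_norm_def norm_eq_zero .
  then have "fourier u = 0"
    by (rule mult_l2_weight_eq_0[OF sobolev_fourier(2)[OF us]])
  then have "has_fourier u 0"
    using sobolev_fourier(1)[OF us] by (rule subst)
  then show "u = 0" by (rule has_fourier_0_imp)
next
  assume "u = 0"
  then show "sobolev_norm s u = 0"
    using sobolev_norm_scaleR[OF radial_sobolev_0, of s 0] by simp
qed

(* The Banach space of radial H^2 functions; the elements are the classes of functions themselves
   and the norm is the H^2 norm.  The coercion h2r_of_l2 is meaningful on radial_sobolev 2 only. *)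

typedef h2r = "radial_sobolev 2"
  morphisms l2_of_h2r h2r_of_l2
  using radial_sobolev_0 by blast

setup_lifting type_definition_h2r

instantiation h2r :: real_vector
begin

lift_definition zero_h2r :: h2r is 0 by (rule radial_sobolev_0)
lift_definition plus_h2r :: "h2r \<Rightarrow> h2r \<Rightarrow> h2r" is "(+)" by (rule radial_sobolev_add)
lift_definition scaleR_h2r :: "real \<Rightarrow> h2r \<Rightarrow> h2r" is "scaleR" by (rule radial_sobolev_scaleR)
lift_definition uminus_h2r :: "h2r \<Rightarrow> h2r" is "uminus"
  using radial_sobolev_scaleR[of _ 2 "-1"] by simp
lift_definition minus_h2r :: "h2r \<Rightarrow> h2r \<Rightarrow> h2r" is "(-)"
  using radial_sobolev_add[OF _ radial_sobolev_scaleR[of _ 2 "-1"]] by fastforce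

instance
  by standard (transfer; simp add: algebra_simps)+

end

instantiation h2r :: real_normed_vector
begin

lift_definition norm_h2r :: "h2r \<Rightarrow> real" is "sobolev_norm 2" .
definition dist_h2r :: "h2r \<Rightarrow> h2r \<Rightarrow> real" where "dist_h2r u v = norm (u - v)"
definition sgn_h2r :: "h2r \<Rightarrow> h2r" where "sgn_h2r u = u /\<^sub>R norm u"
definition uniformity_h2r :: "(h2r \<times> h2r) filter" where
  "uniformity_h2r = (INF e\<in>{0 <..}. principal {(x, y). dist x y < e})"
definition open_h2r :: "h2r set \<Rightarrow> bool" where
  "open_h2r U \<longleftrightarrow> (\<forall>x\<in>U. eventually (\<lambda>(x', y). x' = x \<longrightarrow> y \<in> U) uniformity)"

instance
proof
  fix u v :: h2r and r :: real and U :: "h2r set"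
  show "dist u v = norm (u - v)" by (rule dist_h2r_def)
  show "sgn u = u /\<^sub>R norm u" by (rule sgn_h2r_def)
  show "(uniformity :: (h2r \<times> h2r) filter) = (INF e\<in>{0 <..}. principal {(x, y). dist x y < e})"
    by (rule uniformity_h2r_def)
  show "open U \<longleftrightarrow> (\<forall>x\<in>U. eventually (\<lambda>(x', y). x' = x \<longrightarrow> y \<in> U) uniformity)"
    by (rule open_h2r_def)
  show "norm u = 0 \<longleftrightarrow> u = 0" by transfer (rule sobolev_norm_eq_0)
  show "norm (u + v) \<le> norm u + norm v" by transfer (rule sobolev_norm_add)
  show "norm (r *\<^sub>R u) = \<bar>r\<bar> * norm u" by transfer (rule sobolev_norm_scaleR)
qed

end

(* The function a(D) u.  The quantity is meaningful if fourier u is in mult_domain a and a(D) u is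
   real-valued, as is the case for even a. *)

definition fourier_multiplier :: "(R3 \<Rightarrow> real) \<Rightarrow> real l2 \<Rightarrow> real l2" where
  "fourier_multiplier a u = (THE g. has_fourier g (mult_l2 a (fourier u)))"

definition P_rel :: "real \<Rightarrow> real \<Rightarrow> R3 \<Rightarrow> real" where
  "P_rel m c \<xi> = sqrt (c\<^sup>2 * (norm \<xi>)\<^sup>2 + m\<^sup>2 * c ^ 4) - m * c\<^sup>2"

definition P_inf :: "real \<Rightarrow> R3 \<Rightarrow> real" where
  "P_inf m \<xi> = (norm \<xi>)\<^sup>2 / (2 * m)"

(* beta = 1/c, where beta = 0 stands for c = infinity *)

definition P_symbol :: "real \<Rightarrow> real \<Rightarrow> R3 \<Rightarrow> real" where
  "P_symbol m \<beta> = (if \<beta> = 0 then P_inf m else P_rel m (1 / \<beta>))"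

(* resolvent a w f is the solution g, in the domain of a(D), of a(D) g + w g = f *)

definition resolvent :: "(R3 \<Rightarrow> real) \<Rightarrow> real \<Rightarrow> real l2 \<Rightarrow> real l2" where
  "resolvent a \<omega> f = (THE g. fourier g \<in> mult_domain a \<and> fourier_multiplier a g + \<omega> *\<^sub>R g = f)"

abbreviation R_op :: "real \<Rightarrow> real \<Rightarrow> real \<Rightarrow> real l2 \<Rightarrow> real l2" where
  "R_op m \<beta> \<omega> \<equiv> resolvent (P_symbol m \<beta>) \<omega>"

definition coulomb :: "(R3 \<Rightarrow> real) \<Rightarrow> R3 \<Rightarrow> real" where
  "coulomb f x = (LINT y|lborel. f y / norm (x - y))"

definition hartree :: "real l2 \<Rightarrow> real l2" where
  "hartree u = abs_l2 (\<lambda>x. coulomb (\<lambda>y. (rep_l2 u y)\<^sup>2) x * rep_l2 u x)"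

definition hartree_deriv :: "real l2 \<Rightarrow> real l2 \<Rightarrow> real l2" where
  "hartree_deriv u \<phi> = abs_l2 (\<lambda>x. coulomb (\<lambda>y. (rep_l2 u y)\<^sup>2) x * rep_l2 \<phi> x
     + 2 * coulomb (\<lambda>y. rep_l2 u y * rep_l2 \<phi> y) x * rep_l2 u x)"

(* The quadratic form of P_inf(D) is written on the Fourier side; it is finite on H^1. *)

definition energy :: "real \<Rightarrow> real l2 \<Rightarrow> real" where
  "energy m u = (LINT \<xi>|lborel. P_inf m \<xi> * (norm (rep_l2 (fourier u) \<xi>))\<^sup>2)
     - 1 / 2 * (LINT x|lborel. coulomb (\<lambda>y. (rep_l2 u y)\<^sup>2) x * (rep_l2 u x)\<^sup>2)"

definition energy_minimizer :: "real \<Rightarrow> real l2 \<Rightarrow> bool" where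
  "energy_minimizer m u \<longleftrightarrow> u \<in> sobolev 1 \<and> norm u = 1 \<and>
     (\<forall>v \<in> sobolev 1. norm v = 1 \<longrightarrow> energy m u \<le> energy m v)"

definition positive_l2 :: "real l2 \<Rightarrow> bool" where
  "positive_l2 u \<longleftrightarrow> (AE x in lborel. 0 < rep_l2 u x)"

definition symmetric_decreasing :: "real l2 \<Rightarrow> bool" where
  "symmetric_decreasing u \<longleftrightarrow>
     (\<exists>f. square_integrable f \<and> u = abs_l2 f \<and> (\<forall>x y. norm x \<le> norm y \<longrightarrow> f y \<le> f x))"

definition linearized :: "real \<Rightarrow> real \<Rightarrow> real l2 \<Rightarrow> real l2 \<Rightarrow> real l2" where
  "linearized m \<omega> u \<phi> = fourier_multiplier (P_inf m) \<phi> + \<omega> *\<^sub>R \<phi> - hartree_deriv u \<phi>"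

definition sobolev_invertible :: "real \<Rightarrow> real \<Rightarrow> (real l2 \<Rightarrow> real l2) \<Rightarrow> bool" where
  "sobolev_invertible s t T \<longleftrightarrow> bij_betw T (radial_sobolev s) (radial_sobolev t) \<and>
     (\<exists>C. \<forall>\<phi> \<in> radial_sobolev s. sobolev_norm s \<phi> \<le> C * sobolev_norm t (T \<phi>))"

definition F_map :: "real \<Rightarrow> real \<Rightarrow> real set \<Rightarrow> real \<times> h2r \<times> real \<Rightarrow> h2r \<times> real" where
  "F_map m \<beta>\<^sub>0 I = (\<lambda>(\<beta>, u, \<omega>) \<in> {0..<\<beta>\<^sub>0} \<times> UNIV \<times> I.
     (u - h2r_of_l2 (R_op m \<beta> \<omega> (hartree (l2_of_h2r u))), (norm (l2_of_h2r u))\<^sup>2 - 1))"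

end

theory Submission
  imports Defs
begin

text \<open>By the second formula, the derivative is (R (L phi + tau u), 2 <u, phi>) with R the resolvent of
  P(D) = - Laplace / 2m at w. Since R is an isomorphism from radial L2 to radial H2 and L is invertible,
  the derivative is invertible as soon as <u, eta> is nonzero, where L eta = u. Formally
  eta = - (2 u + x . grad u) / (2 w), whence <u, eta> = - 1 / (4 w); this is obtained from the
  difference quotients of the family c^2 u(c x), which solves the equation with multiplier c^2 w.

  The resolvent is convolution with the Laplace transform in t of the heat kernels, an integrable and
  square-integrable radial function; so it maps radial functions to radial functions and its range
  H2 consists of bounded functions, which makes the Hartree term a bounded trilinear map on H2.
  All this rests on Plancherel's theorem, proved by inserting a Gaussian factor.\<close>

subsection \<open>Convergence and completeness in L2\<close>

text \<open>A single scalar decides because the derivative is a bordered operator: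
  \<open>L \<phi> + \<tau> u\<close> is prescribed, which leaves in \<phi> only the freedom of a
  summand -\<tau> \<eta>, and the component 2 <u, \<phi>> then fixes \<tau> if <u, \<eta>> is
  nonzero. The value -1/(4w) stems from <u, x . grad u> = -3/2 for normalised u, by partial
  integration in dimension three. Two obstacles shape the rest. \<open>fourier_multiplier\<close>
  and \<open>resolvent\<close> are definite descriptions over real functions, so a product on the
  Fourier side acquires a meaning only when it is shown to be the transform of a real function;
  convolutions with real kernels supply this. A square-integrable kernel exists because the heat
  kernels have L2 norm of order t^(-3/4), which is integrable at 0, as happens below dimension four.
  The bounded inverse is derived from an explicit lower bound in place of the open mapping theorem,
  and the derivative from an exact formula for the remainder.\<close>

lemma l2_measurable:
  "square_integrable f \<Longrightarrow> f \<in> borel_measurable borel"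
  by (simp add: square_integrable_def)

lemma rep_l2_measurable[measurable]: "rep_l2 u \<in> borel_measurable borel"
  by (rule l2_measurable[OF square_integrable_rep])

lemma square_integrableI:
  assumes "f \<in> borel_measurable borel" "integrable lborel (\<lambda>x. (norm (f x))^2)"
  shows "square_integrable f"
  using assms by (simp add: square_integrable_def)

lemma square_integrable_bound:
  assumes g: "square_integrable g" and f: "f \<in> borel_measurable borel"
    and le: "AE x in lborel. norm (f x) \<le> norm (g x)"
  shows "square_integrable f"
proof (rule square_integrableI[OF f])
  note f[measurable]
  show "integrable lborel (\<lambda>x. (norm (f x))^2)"
  proof (rule Bochner_Integration.integrable_bound)
    show "integrable lborel (\<lambda>x. (norm (g x))^2)" using g by (simp add: square_integrable_def)
    show "AE x in lborel. norm ((norm (f x))^2) \<le> norm ((norm (g x))^2)"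
      using le by eventually_elim (simp add: power_mono)
  qed simp
qed

lemma power2_norm_abs_l2:
  assumes "square_integrable f"
  shows "(norm (abs_l2 f))^2 = (LINT x|lborel. (norm (f x))^2)"
  using norm_abs_l2[OF assms] by simp

lemma inner_abs_l2:
  assumes "square_integrable f" "square_integrable g"
  shows "abs_l2 f \<bullet> abs_l2 g = (LINT x|lborel. f x \<bullet> g x)"
  using assms by (intro inner_l2.abs_eq) auto

lemma abs_l2_diff:
  assumes "square_integrable f" "square_integrable g"
  shows "abs_l2 f - abs_l2 g = abs_l2 (\<lambda>x. f x - g x)"
  using assms by (intro minus_l2.abs_eq) auto

lemma abs_l2_cong:
  assumes "square_integrable f" "g \<in> borel_measurable borel" "AE x in lborel. f x = g x"
  shows "abs_l2 f = abs_l2 g"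
  using square_integrable_cong_AE[of f g] assms abs_l2_eq_iff[of f g] by auto

lemma abs_l2_mono_norm:
  assumes g: "square_integrable g" and f: "f \<in> borel_measurable borel"
    and le: "AE x in lborel. norm (f x) \<le> norm (g x)"
  shows "norm (abs_l2 f) \<le> norm (abs_l2 g)"
proof -
  have fq: "square_integrable f" by (rule square_integrable_bound[OF g f le])
  show ?thesis
    unfolding norm_abs_l2[OF g] norm_abs_l2[OF fq]
  proof (intro real_sqrt_le_mono integral_mono_AE)
    show "AE x in lborel. (norm (f x))^2 \<le> (norm (g x))^2"
      using le by eventually_elim (simp add: power_mono)
  qed (use fq g in \<open>auto simp: square_integrable_def\<close>)
qed

lemma norm_l2_bounded_ae:
  assumes g: "square_integrable g" and f: "f \<in> borel_measurable borel" and C: "0 \<le> C"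
    and le: "AE x in lborel. norm (f x) \<le> C * norm (g x)"
  shows "square_integrable f" "norm (abs_l2 f) \<le> C * norm (abs_l2 g)"
proof -
  have le': "AE x in lborel. norm (f x) \<le> norm (C *\<^sub>R g x)" using le C by simp
  show "square_integrable f"
    by (rule square_integrable_bound[OF square_integrable_scaleR[OF g, of C] f le'])
  have "norm (abs_l2 f) \<le> norm (C *\<^sub>R abs_l2 g)"
    unfolding abs_l2_scaleR[OF g]
    by (rule abs_l2_mono_norm[OF square_integrable_scaleR[OF g, of C] f le'])
  then show "norm (abs_l2 f) \<le> C * norm (abs_l2 g)" using C by simp
qed

lemma l2_dominated_convergence:
  fixes f :: "nat \<Rightarrow> R3 \<Rightarrow> 'b::euclidean_space" and w :: "R3 \<Rightarrow> real"
  assumes m: "\<And>n. f n \<in> borel_measurable borel" "g \<in> borel_measurable borel"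
    and w: "square_integrable w"
    and le: "\<And>n. AE x in lborel. norm (f n x) \<le> w x"
    and lim: "AE x in lborel. (\<lambda>n. f n x) \<longlonglongrightarrow> g x"
  shows "square_integrable g" "\<And>n. square_integrable (f n)" "(\<lambda>n. abs_l2 (f n)) \<longlonglongrightarrow> abs_l2 g"
proof -
  note m[measurable]
  have all: "AE x in lborel. \<forall>n. norm (f n x) \<le> w x"
    using le by (simp add: AE_all_countable)
  have gle: "AE x in lborel. norm (g x) \<le> w x"
    using all lim
  proof eventually_elim
    case (elim x)
    show ?case by (rule tendsto_upperbound[OF tendsto_norm[OF elim(2)]]) (use elim in auto)
  qed
  have wm[measurable]: "w \<in> borel_measurable borel" by (rule l2_measurable[OF w])
  show gq: "square_integrable g"
    by (rule square_integrable_bound[OF w m(2)]) (use gle in \<open>auto elim: eventually_mono\<close>)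
  show fq: "square_integrable (f n)" for n
    by (rule square_integrable_bound[OF w m(1)], rule eventually_mono[OF le[of n]])
      (metis abs_ge_self order_trans real_norm_def)
  have wi: "integrable lborel (\<lambda>x. 4 * (w x)^2)" using w by (simp add: square_integrable_def)
  have "(\<lambda>n. LINT x|lborel. (norm (f n x - g x))^2) \<longlonglongrightarrow> (LINT x|(lborel::R3 measure). 0)"
  proof (rule integral_dominated_convergence[where w="\<lambda>x. 4 * (w x)^2", OF _ _ wi])
    show "AE x in lborel. (\<lambda>n. (norm (f n x - g x))^2) \<longlonglongrightarrow> 0"
      using lim
    proof eventually_elim
      case (elim x)
      have "(\<lambda>n. norm (f n x - g x)) \<longlonglongrightarrow> 0"
        using elim by (simp add: LIM_zero tendsto_norm_zero)
      from tendsto_power[OF this, of 2] show ?case by simp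
    qed
    show "AE x in lborel. norm ((norm (f n x - g x))^2) \<le> 4 * (w x)^2" for n
      using all gle
    proof eventually_elim
      case (elim x)
      have "norm (f n x - g x) \<le> 2 * w x"
        using norm_triangle_ineq4[of "f n x" "g x"] elim(1)[rule_format, of n] elim(2) by linarith
      then have "(norm (f n x - g x))^2 \<le> (2 * w x)^2" by (intro power_mono) auto
      then show ?case by (simp add: power_mult_distrib)
    qed
  qed measurable
  then have "(\<lambda>n. (norm (abs_l2 (f n) - abs_l2 g))^2) \<longlonglongrightarrow> 0"
    by (simp add: abs_l2_diff fq gq power2_norm_abs_l2 square_integrable_diff)
  then have "(\<lambda>n. sqrt ((norm (abs_l2 (f n) - abs_l2 g))^2)) \<longlonglongrightarrow> sqrt 0" by (rule tendsto_real_sqrt)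
  then have "(\<lambda>n. norm (abs_l2 (f n) - abs_l2 g)) \<longlonglongrightarrow> 0" by simp
  then show "(\<lambda>n. abs_l2 (f n)) \<longlonglongrightarrow> abs_l2 g"
    by (simp add: LIM_zero_iff tendsto_norm_zero_iff)
qed

text \<open>The squared distances tend to 0 in L1, and convergence in L1 yields a subsequence that
  converges almost everywhere.\<close>

lemma l2_tendsto_AE_subseq:
  fixes X :: "nat \<Rightarrow> 'b::euclidean_space l2"
  assumes "X \<longlonglongrightarrow> u"
  obtains r :: "nat \<Rightarrow> nat" where "strict_mono r"
    "AE x in lborel. (\<lambda>n. rep_l2 (X (r n)) x) \<longlonglongrightarrow> rep_l2 u x"
proof -
  let ?d = "\<lambda>n x. (norm (rep_l2 (X n) x - rep_l2 u x))^2"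
  have q: "square_integrable (\<lambda>x. rep_l2 (X n) x - rep_l2 u x)" for n
    by (intro square_integrable_diff square_integrable_rep)
  have e: "(norm (X n - u))^2 = (LINT x|lborel. ?d n x)" for n
    using power2_norm_abs_l2[OF q[of n]] abs_l2_diff[OF square_integrable_rep square_integrable_rep, of "X n" u]
    by (simp add: abs_rep_l2)
  have "(\<lambda>n. (norm (X n - u))^2) \<longlonglongrightarrow> 0"
    using tendsto_power[OF tendsto_norm_zero[OF LIM_zero[OF assms]], of 2] by simp
  then have "(\<lambda>n. LINT x|lborel. norm (?d n x)) \<longlonglongrightarrow> 0" unfolding e by simp
  from tendsto_L1_AE_subseq[OF _ this] q obtain r :: "nat \<Rightarrow> nat" where r: "strict_mono r"
    "AE x in lborel. (\<lambda>n. ?d (r n) x) \<longlonglongrightarrow> 0"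
    by (auto simp: square_integrable_def)
  have "AE x in lborel. (\<lambda>n. rep_l2 (X (r n)) x) \<longlonglongrightarrow> rep_l2 u x"
    using r(2)
  proof eventually_elim
    case (elim x)
    then have "(\<lambda>n. sqrt (?d (r n) x)) \<longlonglongrightarrow> sqrt 0" by (rule tendsto_real_sqrt)
    then show ?case by (simp add: LIM_zero_iff tendsto_norm_zero_iff)
  qed
  with r(1) show ?thesis by (rule that)
qed

text \<open>Identifies a limit known only through completeness with one computed pointwise: both are
  almost everywhere limits of a common subsequence.\<close>

lemma l2_limit_eq_AE_limit:
  fixes f :: "nat \<Rightarrow> R3 \<Rightarrow> 'b::euclidean_space"
  assumes f: "\<And>n. square_integrable (f n)" and l: "(\<lambda>n. abs_l2 (f n)) \<longlonglongrightarrow> u"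
    and g: "g \<in> borel_measurable borel" and ae: "AE x in lborel. (\<lambda>n. f n x) \<longlonglongrightarrow> g x"
  shows "square_integrable g" "abs_l2 g = u"
proof -
  obtain r where r: "strict_mono r"
    "AE x in lborel. (\<lambda>n. rep_l2 (abs_l2 (f (r n))) x) \<longlonglongrightarrow> rep_l2 u x"
    by (rule l2_tendsto_AE_subseq[OF l])
  have "AE x in lborel. \<forall>n. rep_l2 (abs_l2 (f n)) x = f n x"
    using rep_abs_l2[OF f] by (simp add: AE_all_countable)
  then have e: "AE x in lborel. rep_l2 u x = g x"
    using r(2) ae
  proof eventually_elim
    case (elim x)
    have "(\<lambda>n. f (r n) x) \<longlonglongrightarrow> g x"
      using LIMSEQ_subseq_LIMSEQ[OF elim(3) r(1)] by (simp add: o_def)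
    moreover have "(\<lambda>n. f (r n) x) \<longlonglongrightarrow> rep_l2 u x" using elim(1,2) by simp
    ultimately show ?case by (rule LIMSEQ_unique[symmetric])
  qed
  show "square_integrable g" by (rule square_integrable_cong_AE[OF square_integrable_rep _ e]) (use g in simp)
  show "abs_l2 g = u" using abs_l2_cong[OF square_integrable_rep g e] by (simp add: abs_rep_l2)
qed

section \<open>Riesz-Fischer: completeness of L2\<close>

lemma Cauchy_fast_subseq:
  fixes X :: "nat \<Rightarrow> 'a::metric_space"
  assumes "Cauchy X"
  obtains r :: "nat \<Rightarrow> nat" where "strict_mono r" "\<And>n. dist (X (r n)) (X (r (Suc n))) < (1/2) ^ n"
proof -
  have "\<forall>n. \<exists>N. \<forall>p\<ge>N. \<forall>q\<ge>N. dist (X p) (X q) < (1/2::real) ^ n"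
    using assms unfolding Cauchy_def by simp
  then obtain N where N: "\<And>n p q. p \<ge> N n \<Longrightarrow> q \<ge> N n \<Longrightarrow> dist (X p) (X q) < (1/2::real) ^ n"
    by metis
  \<comment> \<open>\<open>Suc (r n)\<close> makes the sequence increase, and
    \<open>N (Suc n)\<close> puts the next index into its Cauchy tail.\<close>
  define r where "r = rec_nat (N 0) (\<lambda>n k. max (Suc k) (N (Suc n)))"
  have r0: "r 0 = N 0" and rS: "r (Suc n) = max (Suc (r n)) (N (Suc n))" for n
    by (simp_all add: r_def)
  have sm: "strict_mono r" by (auto simp: strict_mono_Suc_iff rS less_max_iff_disj)
  have ge: "r n \<ge> N n" for n by (cases n) (simp_all add: r0 rS)
  have "dist (X (r n)) (X (r (Suc n))) < (1/2) ^ n" for n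
    by (rule N) (use ge[of n] in \<open>simp_all add: rS\<close>)
  with sm show ?thesis by (rule that)
qed

text \<open>Along a subsequence with distances below 2^(-n) the increments have summable L2 norms.
  Monotone convergence makes the sum of their pointwise norms square integrable, so the subsequence
  converges absolutely almost everywhere, under a square-integrable bound.\<close>

instance l2 :: (euclidean_space) complete_space
proof
  fix X :: "nat \<Rightarrow> 'a l2"
  assume C: "Cauchy X"
  obtain r :: "nat \<Rightarrow> nat" where r: "strict_mono r" "\<And>n. dist (X (r n)) (X (r (Suc n))) < (1/2) ^ n"
    by (rule Cauchy_fast_subseq[OF C]) blast
  define Y where "Y n = rep_l2 (X (r n))" for n
  have Yq: "square_integrable (Y n)" for n by (simp add: Y_def square_integrable_rep)
  have [measurable]: "Y n \<in> borel_measurable borel" for n by (simp add: Y_def)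
  define D where "D n x = norm (Y (Suc n) x - Y n x)" for n x
  have [measurable]: "D n \<in> borel_measurable borel" for n unfolding D_def by measurable
  have Dq: "square_integrable (D n)" for n
    unfolding D_def by (intro square_integrable_of_norm square_integrable_diff Yq)
  have Dn: "norm (abs_l2 (D n)) \<le> (1/2) ^ n" for n
  proof -
    have "norm (abs_l2 (D n)) = norm (X (r (Suc n)) - X (r n))"
      unfolding D_def Y_def
      by (simp add: norm_abs_l2 square_integrable_of_norm square_integrable_diff square_integrable_rep
          abs_l2_diff[OF square_integrable_rep square_integrable_rep, of "X (r (Suc n))" "X (r n)", unfolded abs_rep_l2])
    then show ?thesis using r(2)[of n] by (simp add: dist_norm norm_minus_commute)
  qed
  define S where "S n x = (\<Sum>i<n. D i x)" for n x
  have [measurable]: "S n \<in> borel_measurable borel" for n unfolding S_def by measurable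
  have Sq: "square_integrable (S n) \<and> norm (abs_l2 (S n)) \<le> (\<Sum>i<n. (1/2) ^ i)" for n
  proof (induction n)
    case 0
    have "abs_l2 (\<lambda>x. 0) = (0 :: real l2)" by (simp add: zero_l2_def)
    then show ?case by (simp add: S_def square_integrable_0)
  next
    case (Suc n)
    have e: "S (Suc n) = (\<lambda>x. S n x + D n x)" by (simp add: S_def fun_eq_iff)
    have "norm (abs_l2 (S (Suc n))) \<le> norm (abs_l2 (S n)) + norm (abs_l2 (D n))"
      unfolding e using Suc Dq by (subst abs_l2_add[symmetric]) (auto intro: norm_triangle_ineq)
    then show ?case using Suc Dn[of n] Dq[of n] by (auto simp: e square_integrable_add)
  qed
  have geo: "(\<Sum>i<n. (1/2::real) ^ i) \<le> 2" for n
    using sum_le_suminf[OF summable_geometric[of "1/2::real"], of "{..<n}"] by (simp add: suminf_geometric)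
  \<comment> \<open>4 is the square of the bound 2 for the geometric series.\<close>
  have S2: "(\<integral>\<^sup>+ x. ennreal ((S n x)^2) \<partial>lborel) \<le> 4" for n
  proof -
    have "(norm (abs_l2 (S n)))^2 \<le> 2^2"
      using Sq[of n] geo[of n] by (intro power_mono) auto
    then have "(LINT x|lborel. (S n x)^2) \<le> 4"
      using Sq[of n] power2_norm_abs_l2[of "S n"] by simp
    moreover have "integrable lborel (\<lambda>x. (S n x)^2)" using Sq[of n] by (simp add: square_integrable_def)
    ultimately show ?thesis
      by (subst nn_integral_eq_integral) (auto simp: ennreal_le_iff2 simp flip: ennreal_numeral)
  qed
  have S0: "0 \<le> S n x" for n x by (simp add: S_def D_def sum_nonneg)
  have Smono: "S n x \<le> S (Suc n) x" for n x by (simp add: S_def D_def)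
  \<comment> \<open>Taken in \<open>ennreal\<close>, the supremum exists at every point; its
    finiteness is proved almost everywhere.\<close>
  define T where "T x = (SUP n. ennreal ((S n x)^2))" for x
  have [measurable]: "T \<in> borel_measurable borel" unfolding T_def by measurable
  have "(\<integral>\<^sup>+ x. T x \<partial>lborel) = (SUP n. \<integral>\<^sup>+ x. ennreal ((S n x)^2) \<partial>lborel)"
    unfolding T_def
  proof (rule nn_integral_monotone_convergence_SUP)
    show "incseq (\<lambda>n x. ennreal ((S n x)^2))"
      by (rule incseq_SucI) (auto simp: le_fun_def intro!: ennreal_leI power_mono Smono S0)
  qed measurable
  also have "\<dots> \<le> 4" by (rule SUP_least) (rule S2)
  finally have Tfin: "(\<integral>\<^sup>+ x. T x \<partial>lborel) \<le> 4" .
  have "(\<integral>\<^sup>+ x. T x \<partial>lborel) \<noteq> \<infinity>" using Tfin by (auto simp: top_unique)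
  then have Tae: "AE x in lborel. T x \<noteq> \<infinity>" by (intro nn_integral_PInf_AE) auto
  have bS: "S n x \<le> sqrt (enn2real (T x))" if "T x \<noteq> \<infinity>" for n x
  proof (rule real_le_rsqrt)
    have "ennreal ((S n x)^2) \<le> T x" unfolding T_def by (rule SUP_upper) simp
    then show "(S n x)^2 \<le> enn2real (T x)"
      using that by (metis enn2real_ennreal enn2real_mono infinity_ennreal_def top.not_eq_extremum zero_le_power2)
  qed
  have Ysum: "Y n x = Y 0 x + (\<Sum>i<n. Y (Suc i) x - Y i x)" for n x
    by (induction n) auto
  \<comment> \<open>The value 0 on the null set where T is infinite is arbitrary.\<close>
  define g where "g x = (if T x = \<infinity> then 0 else lim (\<lambda>n. Y n x))" for x
  have conv: "convergent (\<lambda>n. Y n x)" if "T x \<noteq> \<infinity>" for x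
  proof -
    have "summable (\<lambda>i. D i x)"
      using bS[OF that] by (intro summableI_nonneg_bounded[of _ "sqrt (enn2real (T x))"]) (auto simp: D_def S_def)
    then have "summable (\<lambda>i. Y (Suc i) x - Y i x)"
      unfolding D_def by (rule summable_norm_cancel)
    then have "(\<lambda>n. Y 0 x + (\<Sum>i<n. Y (Suc i) x - Y i x)) \<longlonglongrightarrow> Y 0 x + (\<Sum>i. Y (Suc i) x - Y i x)"
      by (intro tendsto_add tendsto_const summable_LIMSEQ)
    then show ?thesis unfolding Ysum[symmetric] by (rule convergentI)
  qed
  have gm: "g \<in> borel_measurable borel"
    unfolding g_def by (intro measurable_If borel_measurable_const borel_measurable_lim_metric) measurable
  have glim: "AE x in lborel. (\<lambda>n. Y n x) \<longlonglongrightarrow> g x"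
    using Tae by eventually_elim (auto simp: g_def intro: conv[unfolded convergent_LIMSEQ_iff])
  define w where "w x = norm (Y 0 x) + sqrt (enn2real (T x))" for x
  have Tq: "square_integrable (\<lambda>x. sqrt (enn2real (T x)))"
  proof (rule square_integrableI)
    have "integrable lborel (\<lambda>x. enn2real (T x))"
    proof (rule integrableI_nonneg)
      have "(\<integral>\<^sup>+ x. ennreal (enn2real (T x)) \<partial>lborel) = (\<integral>\<^sup>+ x. T x \<partial>lborel)"
        using Tae by (intro nn_integral_cong_AE) (auto simp: less_top elim!: eventually_mono)
      also have "\<dots> < \<infinity>" using Tfin by (simp add: le_less_trans)
      finally show "(\<integral>\<^sup>+ x. ennreal (enn2real (T x)) \<partial>lborel) < \<infinity>" .
    qed auto
    then show "integrable lborel (\<lambda>x. (norm (sqrt (enn2real (T x))))^2)" by simp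
  qed measurable
  have wq: "square_integrable w"
    unfolding w_def by (intro square_integrable_add Tq square_integrable_of_norm Yq)
  have le: "AE x in lborel. norm (Y n x) \<le> w x" for n
    using Tae
  proof eventually_elim
    case (elim x)
    have "norm (Y n x) \<le> norm (Y 0 x) + norm (\<Sum>i<n. Y (Suc i) x - Y i x)"
      by (subst Ysum[of n]) (rule norm_triangle_ineq)
    also have "norm (\<Sum>i<n. Y (Suc i) x - Y i x) \<le> S n x"
      unfolding S_def D_def by (rule norm_sum)
    also have "S n x \<le> sqrt (enn2real (T x))" by (rule bS[OF elim])
    finally show ?case by (simp add: w_def)
  qed
  have "(\<lambda>n. abs_l2 (Y n)) \<longlonglongrightarrow> abs_l2 g"
    by (rule l2_dominated_convergence[OF _ gm wq le glim]) measurable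
  then have "(X \<circ> r) \<longlonglongrightarrow> abs_l2 g" by (simp add: Y_def abs_rep_l2 o_def)
  then have "X \<longlonglongrightarrow> abs_l2 g" by (rule Cauchy_converges_subseq[OF C r(1)])
  then show "convergent X" by (rule convergentI)
qed

subsection \<open>Density of compactly supported continuous functions\<close>

text \<open>Truncation in space and in height gives a bounded function on a ball. A Lebesgue
  measurable function is an almost everywhere limit of continuous ones, and these are cut off again
  so that dominated convergence applies.\<close>

lemma continuous_compact_support_dense:
  fixes f :: "R3 \<Rightarrow> real"
  assumes f: "square_integrable f" and e: "e > 0"
  obtains h r M where "continuous_on UNIV h" "\<And>x. \<bar>h x\<bar> \<le> M" "\<And>x. norm x > r \<Longrightarrow> h x = 0"
    "square_integrable h" "norm (abs_l2 f - abs_l2 h) < e" "r > 0" "M > 0"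
proof -
  have [measurable]: "f \<in> borel_measurable borel" by (rule l2_measurable[OF f])
  define F where "F n x = indicator (cball 0 (real n)) x * max (- real n) (min (real n) (f x))" for n x
  have [measurable]: "cball 0 r \<in> sets (borel :: R3 measure)" for r by simp
  have [measurable]: "F n \<in> borel_measurable borel" for n unfolding F_def by measurable
  have "(\<lambda>n. abs_l2 (F n)) \<longlonglongrightarrow> abs_l2 f"
  proof (rule l2_dominated_convergence[OF _ _ square_integrable_of_norm[OF f]])
    show "AE x in lborel. norm (F n x) \<le> norm (f x)" for n
      by (intro AE_I2) (auto simp: F_def split: split_indicator)
    show "AE x in lborel. (\<lambda>n. F n x) \<longlonglongrightarrow> f x"
    proof (rule AE_I2, rule tendsto_eventually)
      fix x
      obtain N :: nat where "max (norm x) \<bar>f x\<bar> \<le> real N" using real_arch_simple by blast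
      then show "\<forall>\<^sub>F n in sequentially. F n x = f x"
        unfolding eventually_sequentially by (intro exI[of _ N]) (auto simp: F_def)
    qed
  qed measurable
  then have "(\<lambda>n. norm (abs_l2 f - abs_l2 (F n))) \<longlonglongrightarrow> norm (abs_l2 f - abs_l2 f)"
    by (intro tendsto_norm tendsto_diff tendsto_const)
  then have "\<forall>\<^sub>F n in sequentially. norm (abs_l2 f - abs_l2 (F n)) < e / 2"
    by (rule order_tendstoD(2)) (use e in simp)
  \<comment> \<open>n > 0 ensures that the bound M = n is positive.\<close>
  from eventually_conj[OF this eventually_gt_at_top[of 0]]
  obtain n where n: "norm (abs_l2 f - abs_l2 (F n)) < e / 2" "n > 0"
    by (auto simp: eventually_sequentially)
  have "F n \<in> borel_measurable lebesgue"
    by (rule measurable_completion) simp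
  then have "F n measurable_on UNIV"
    by (rule lebesgue_measurable_imp_measurable_on) simp
  then obtain N0 g where g: "negligible N0" "\<And>k. continuous_on UNIV (g k)"
     "\<And>x. x \<notin> N0 \<Longrightarrow> (\<lambda>k. g k x) \<longlonglongrightarrow> F n x"
    unfolding measurable_on_def by auto
  have "AE x in lebesgue. x \<notin> N0"
    using g(1) by (intro AE_not_in) (simp add: negligible_iff_null_sets)
  then have N0: "AE x in lborel. x \<notin> N0" by (simp add: AE_completion_iff)
  \<comment> \<open>The approximants \<open>g k\<close> may be unbounded and without compact
    support. The clamp and the tent restore both bounds and do not disturb the limit:
    \<open>F n\<close> has values in [-n, n] and vanishes outside the ball of radius n, on which the
    tent equals 1.\<close>
  define H where "H k x = max 0 (min 1 (real n + 1 - norm x)) * max (- real n) (min (real n) (g k x))" for k and x :: R3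
  have Hc: "continuous_on UNIV (H k)" for k
    unfolding H_def by (intro continuous_intros g)
  have Hm: "H k \<in> borel_measurable borel" for k
    by (rule borel_measurable_continuous_onI[OF Hc])
  have Hb: "\<bar>H k x\<bar> \<le> real n" for k x
  proof -
    have "\<bar>H k x\<bar> \<le> 1 * real n" unfolding H_def abs_mult by (intro mult_mono) auto
    then show ?thesis by simp
  qed
  have "(\<lambda>k. abs_l2 (H k)) \<longlonglongrightarrow> abs_l2 (F n)"
   and Hq: "\<And>k. square_integrable (H k)"
  proof -
    have w: "square_integrable (\<lambda>x. real n *\<^sub>R indicator (cball 0 (real n + 1)) x :: real)"
      by (rule square_integrable_scaleR[OF square_integrable_indicator_cball])
    have le: "AE x in lborel. norm (H k x) \<le> real n *\<^sub>R indicator (cball 0 (real n + 1)) x" for k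
    proof (rule AE_I2)
      fix x
      have "\<bar>H k x\<bar> \<le> real n" by (rule Hb)
      moreover have "H k x = 0" if "norm x > real n + 1" using that by (simp add: H_def)
      ultimately show "norm (H k x) \<le> real n *\<^sub>R indicator (cball 0 (real n + 1)) x"
        by (auto simp: indicator_def)
    qed
    have l: "AE x in lborel. (\<lambda>k. H k x) \<longlonglongrightarrow> F n x"
      using N0
    proof eventually_elim
      case (elim x)
      have "(\<lambda>k. H k x) \<longlonglongrightarrow> max 0 (min 1 (real n + 1 - norm x)) * max (- real n) (min (real n) (F n x))"
        unfolding H_def by (intro tendsto_intros g(3) elim)
      moreover have "max 0 (min 1 (real n + 1 - norm x)) * max (- real n) (min (real n) (F n x)) = F n x"
        by (auto simp: F_def indicator_def)
      ultimately show ?case by simp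
    qed
    show "(\<lambda>k. abs_l2 (H k)) \<longlonglongrightarrow> abs_l2 (F n)"
      by (rule l2_dominated_convergence(3)[OF Hm _ w le l]) measurable
    show "square_integrable (H k)" for k
      by (rule l2_dominated_convergence(2)[OF Hm _ w le l]) measurable
  qed
  then have "(\<lambda>k. norm (abs_l2 (F n) - abs_l2 (H k))) \<longlonglongrightarrow> norm (abs_l2 (F n) - abs_l2 (F n))"
    by (intro tendsto_norm tendsto_diff tendsto_const)
  then have "\<forall>\<^sub>F k in sequentially. norm (abs_l2 (F n) - abs_l2 (H k)) < e / 2"
    by (rule order_tendstoD(2)) (use e in simp)
  then obtain k where k: "norm (abs_l2 (F n) - abs_l2 (H k)) < e / 2"
    by (auto simp: eventually_sequentially)
  show ?thesis
  proof (rule that[OF Hc _ _ Hq])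
    show "\<bar>H k x\<bar> \<le> real n" for x by (rule Hb)
    show "H k x = 0" if "norm x > real n + 1" for x using that by (simp add: H_def)
    show "norm (abs_l2 f - abs_l2 (H k)) < e"
      using norm_triangle_ineq[of "abs_l2 f - abs_l2 (F n)" "abs_l2 (F n) - abs_l2 (H k)"] n k by simp
  qed (use n in auto)
qed

section \<open>Continuity of affine changes of variable in L2\<close>

lemma square_integrable_affine:
  fixes f :: "R3 \<Rightarrow> 'b::euclidean_space"
  assumes f: "square_integrable f" and c: "c \<noteq> 0"
  shows "square_integrable (\<lambda>x. f (t + c *\<^sub>R x))"
    and "(norm (abs_l2 f))^2 = \<bar>c\<bar> ^ 3 * (norm (abs_l2 (\<lambda>x. f (t + c *\<^sub>R x))))^2"
proof -
  have [measurable]: "f \<in> borel_measurable borel" by (rule l2_measurable[OF f])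
  have "integrable lborel (\<lambda>x. (norm (f x))^2)" using f by (simp add: square_integrable_def)
  from lborel_integrable_affine[OF this c, of t]
  show q: "square_integrable (\<lambda>x. f (t + c *\<^sub>R x))"
    by (simp add: square_integrable_def)
  show "(norm (abs_l2 f))^2 = \<bar>c\<bar> ^ 3 * (norm (abs_l2 (\<lambda>x. f (t + c *\<^sub>R x))))^2"
    unfolding power2_norm_abs_l2[OF f] power2_norm_abs_l2[OF q]
    by (subst lborel_integral_affine[OF _ c, of _ t]) (simp_all add: DIM_R3)
qed

text \<open>The exact factor is c^(-3/2), at most sqrt 8 for c >= 1/2, rounded up to 3.\<close>

lemma norm_l2_affine_le:
  fixes f :: "R3 \<Rightarrow> 'b::euclidean_space"
  assumes f: "square_integrable f" and c: "c \<ge> 1 / 2"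
  shows "norm (abs_l2 (\<lambda>x. f (t + c *\<^sub>R x))) \<le> 3 * norm (abs_l2 f)"
proof -
  have c0: "c \<noteq> 0" using c by auto
  have "(1/2::real) ^ 3 \<le> c ^ 3" using c by (intro power_mono) auto
  then have "(1/2) ^ 3 * (norm (abs_l2 (\<lambda>x. f (t + c *\<^sub>R x))))^2 \<le> \<bar>c\<bar> ^ 3 * (norm (abs_l2 (\<lambda>x. f (t + c *\<^sub>R x))))^2"
    using c by (intro mult_right_mono) auto
  also have "\<dots> = (norm (abs_l2 f))^2" by (rule square_integrable_affine(2)[OF f c0, symmetric])
  finally have "(norm (abs_l2 (\<lambda>x. f (t + c *\<^sub>R x))))^2 \<le> 8 * (norm (abs_l2 f))^2"
    by (simp add: power_divide)
  also have "\<dots> \<le> (3 * norm (abs_l2 f))^2" by (simp add: power_mult_distrib)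
  finally show ?thesis by (rule power2_le_imp_le) simp
qed

text \<open>Serves two purposes: c = 1 is the continuity of translations used for Plancherel, a = 0
  that of the dilations of the ground state. Continuous functions of compact support are handled by
  dominated convergence, all others by density, as c >= 1/2 bounds the operators uniformly.\<close>

lemma tendsto_l2_affine:
  fixes f :: "R3 \<Rightarrow> real"
  assumes f: "square_integrable f" and a: "a \<longlonglongrightarrow> 0" and c: "c \<longlonglongrightarrow> 1" and c2: "\<And>n. c n \<ge> 1 / 2"
  shows "(\<lambda>n. abs_l2 (\<lambda>x. f (a n + c n *\<^sub>R x))) \<longlonglongrightarrow> abs_l2 f"
proof (rule LIMSEQ_I)
  fix e :: real assume e: "e > 0"
  \<comment> \<open>Three errors occur below: e/8 enlarged by the factor 3, and twice e/8; their sum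
    is less than e.\<close>
  obtain h r M where h: "continuous_on UNIV h" "\<And>x. \<bar>h x\<bar> \<le> M" "\<And>x. norm x > r \<Longrightarrow> h x = 0"
    "square_integrable h" "norm (abs_l2 f - abs_l2 h) < e / 8" "r > 0" "M > 0"
    by (rule continuous_compact_support_dense[OF f, of "e / 8"]) (use e in auto)
  have c0: "c n \<noteq> 0" for n using c2[of n] by auto
  have hm: "h \<in> borel_measurable borel" by (rule l2_measurable[OF h(4)])
  obtain A where A: "A > 0" "\<And>n. norm (a n) \<le> A"
    using convergent_imp_Bseq[OF convergentI[OF a]] by (auto elim: BseqE)
  have "(\<lambda>n. abs_l2 (\<lambda>x. h (a n + c n *\<^sub>R x))) \<longlonglongrightarrow> abs_l2 h"
  proof (rule l2_dominated_convergence[OF _ hm square_integrable_scaleR[OF square_integrable_indicator_cball[of 0 "2 * (r + A)"], of M]])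
    show "(\<lambda>x. h (a n + c n *\<^sub>R x)) \<in> borel_measurable borel" for n
      by (rule l2_measurable[OF square_integrable_affine(1)[OF h(4) c0]])
    show "AE x in lborel. norm (h (a n + c n *\<^sub>R x)) \<le> M *\<^sub>R indicator (cball 0 (2 * (r + A))) x" for n
    proof (rule AE_I2)
      fix x :: R3
      \<comment> \<open>c >= 1/2 gives |c x| > r + A, and the shift by a, of norm at most A, cannot
        bring the point back to the ball of radius r. Hence one ball contains all supports.\<close>
      have "h (a n + c n *\<^sub>R x) = 0" if x: "norm x > 2 * (r + A)"
      proof (rule h(3))
        have "norm (c n *\<^sub>R x) \<le> norm (a n + c n *\<^sub>R x) + norm (a n)"
          using norm_triangle_ineq4[of "a n + c n *\<^sub>R x" "a n"] by simp
        moreover have "r + A < norm (c n *\<^sub>R x)"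
        proof -
          have "r + A < 1 / 2 * norm x" using x by simp
          also have "\<dots> \<le> c n * norm x" using c2[of n] by (intro mult_right_mono) auto
          finally show ?thesis using c2[of n] by simp
        qed
        ultimately show "norm (a n + c n *\<^sub>R x) > r" using A(2)[of n] by linarith
      qed
      then show "norm (h (a n + c n *\<^sub>R x)) \<le> M *\<^sub>R indicator (cball 0 (2 * (r + A))) x"
        using h(2)[of "a n + c n *\<^sub>R x"] by (cases "norm x > 2 * (r + A)") (auto simp: indicator_def)
    qed
    show "AE x in lborel. (\<lambda>n. h (a n + c n *\<^sub>R x)) \<longlonglongrightarrow> h x"
    proof (rule AE_I2)
      fix x :: R3
      have "(\<lambda>n. a n + c n *\<^sub>R x) \<longlonglongrightarrow> 0 + 1 *\<^sub>R x" by (intro tendsto_intros a c)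
      then have "(\<lambda>n. a n + c n *\<^sub>R x) \<longlonglongrightarrow> x" by simp
      then show "(\<lambda>n. h (a n + c n *\<^sub>R x)) \<longlonglongrightarrow> h x"
        using h(1) by (auto simp: continuous_on_eq_continuous_at intro: isCont_tendsto_compose)
    qed
  qed
  then obtain N where N: "\<And>n. n \<ge> N \<Longrightarrow> norm (abs_l2 (\<lambda>x. h (a n + c n *\<^sub>R x)) - abs_l2 h) < e / 8"
    using LIMSEQ_D[of _ _ "e / 8"] e by fastforce
  show "\<exists>N. \<forall>n\<ge>N. norm (abs_l2 (\<lambda>x. f (a n + c n *\<^sub>R x)) - abs_l2 f) < e"
  proof (intro exI allI impI)
    fix n assume n: "n \<ge> N"
    let ?T = "\<lambda>g. abs_l2 (\<lambda>x. g (a n + c n *\<^sub>R x))"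
    have "?T f - ?T h = ?T (\<lambda>x. f x - h x)"
      by (intro abs_l2_diff square_integrable_affine(1) f h(4) c0)
    moreover have "norm (?T (\<lambda>x. f x - h x)) \<le> 3 * norm (abs_l2 (\<lambda>x. f x - h x))"
      by (intro norm_l2_affine_le square_integrable_diff f h(4) c2)
    moreover have "abs_l2 (\<lambda>x. f x - h x) = abs_l2 f - abs_l2 h"
      by (rule abs_l2_diff[OF f h(4), symmetric])
    ultimately have 1: "norm (?T f - ?T h) \<le> 3 * (e / 8)" using h(5) by simp
    have "norm (?T f - abs_l2 f) \<le> norm (?T f - ?T h) + norm (?T h - abs_l2 h) + norm (abs_l2 f - abs_l2 h)"
      using norm_triangle_ineq[of "?T f - ?T h" "?T h - abs_l2 f"]
        norm_triangle_ineq4[of "?T h - abs_l2 h" "abs_l2 f - abs_l2 h"] by simp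
    then show "norm (?T f - abs_l2 f) < e" using 1 N[OF n] h(5) e by linarith
  qed
qed

subsection \<open>Plancherel's theorem\<close>

lemma borel_pair_measurable_lborel:
  "f \<in> borel_measurable (borel \<Otimes>\<^sub>M borel) \<Longrightarrow> f \<in> borel_measurable (lborel \<Otimes>\<^sub>M lborel)"
  by (subst measurable_cong_sets[OF sets_pair_measure_cong[OF sets_lborel sets_lborel] refl])

lemma borel_measurable_lborel_integral:
  fixes f :: "'a::topological_space \<Rightarrow> 'c::euclidean_space \<Rightarrow> 'b::{banach, second_countable_topology}"
  assumes "(\<lambda>(x, y). f x y) \<in> borel_measurable (borel \<Otimes>\<^sub>M borel)"
  shows "(\<lambda>x. LINT y|lborel. f x y) \<in> borel_measurable borel"
proof (rule lborel.borel_measurable_lebesgue_integral)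
  show "(\<lambda>(x, y). f x y) \<in> borel_measurable (borel \<Otimes>\<^sub>M lborel)"
    using assms by (subst measurable_cong_sets[OF sets_pair_measure_cong[OF refl sets_lborel] refl])
qed

text \<open>The multiplication formula of the Fourier transform, by Fubini. \<sigma> = -1 and
  \<sigma> = 1 give the transform and, for real f, its conjugate.\<close>

lemma fourier_pairing:
  fixes f g :: "R3 \<Rightarrow> complex"
  assumes f: "integrable lborel f" and g: "integrable lborel g"
  shows "(LINT p|lborel. (LINT x|lborel. cis (\<sigma> * (p \<bullet> x)) * f x) * g p) =
    (LINT x|lborel. f x * (LINT p|lborel. cis (\<sigma> * (p \<bullet> x)) * g p))"
proof -
  have [measurable]: "f \<in> borel_measurable borel" "g \<in> borel_measurable borel" using f g by auto
  let ?F = "\<lambda>p x. (cis (\<sigma> * (p \<bullet> x)) * f x) * g p"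
  have int: "integrable (lborel \<Otimes>\<^sub>M lborel) (\<lambda>(p, x). ?F p x)"
  proof (rule lborel_pair.Fubini_integrable)
    show "(\<lambda>(p, x). ?F p x) \<in> borel_measurable (lborel \<Otimes>\<^sub>M lborel)"
      by (rule borel_pair_measurable_lborel) measurable
    have "(LINT x|lborel. norm (?F p x)) = (LINT x|lborel. norm (f x)) * norm (g p)" for p
      by (simp add: norm_mult)
    then show "integrable lborel (\<lambda>p. LINT x|lborel. norm (case (p, x) of (p, x) \<Rightarrow> ?F p x))"
      using g by simp
    have "integrable lborel (\<lambda>x. ?F p x)" for p
    proof (rule integrable_mult_left, rule Bochner_Integration.integrable_bound[OF f])
      show "AE x in lborel. norm (cis (\<sigma> * (p \<bullet> x)) * f x) \<le> norm (f x)"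
        by (simp add: norm_mult)
    qed measurable
    then show "AE p in lborel. integrable lborel (\<lambda>x. case (p, x) of (p, x) \<Rightarrow> ?F p x)" by simp
  qed
  have "(LINT p|lborel. (LINT x|lborel. cis (\<sigma> * (p \<bullet> x)) * f x) * g p) = (LINT p|lborel. LINT x|lborel. ?F p x)"
    by (simp only: integral_mult_left_zero)
  also have "\<dots> = (LINT x|lborel. LINT p|lborel. ?F p x)"
    by (rule lborel_pair.Fubini_integral[OF int, symmetric])
  also have "\<dots> = (LINT x|lborel. f x * (LINT p|lborel. cis (\<sigma> * (p \<bullet> x)) * g p))"
  proof (intro Bochner_Integration.integral_cong refl)
    fix x :: R3
    have "?F p x = f x * (cis (\<sigma> * (p \<bullet> x)) * g p)" for p by (simp only: mult_ac)
    then show "(LINT p|lborel. ?F p x) = f x * (LINT p|lborel. cis (\<sigma> * (p \<bullet> x)) * g p)"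
      by (simp only: integral_mult_right_zero)
  qed
  finally show ?thesis .
qed

text \<open>The transform as an absolutely convergent integral, to be applied to integrable f. Each
  \<open>fourier_trunc\<close> is its value at a cutoff, and cutoffs of L2 functions are both
  integrable and square integrable.\<close>

definition fourier_int :: "(R3 \<Rightarrow> real) \<Rightarrow> R3 \<Rightarrow> complex" where
  "fourier_int f p = complex_of_real ((2 * pi) powr (- 3 / 2)) *
     (LINT x|lborel. cis (- (p \<bullet> x)) * of_real (f x))"

abbreviation cutoff :: "real \<Rightarrow> (R3 \<Rightarrow> real) \<Rightarrow> R3 \<Rightarrow> real" where
  "cutoff R f \<equiv> \<lambda>x. indicator (cball 0 R) x * f x"

lemma fourier_trunc_eq_fourier_int:
  "fourier_trunc f R = fourier_int (cutoff R f)"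
  unfolding fourier_trunc_def fourier_int_def set_lebesgue_integral_def
  by (intro ext arg_cong2[where f="(*)"] refl Bochner_Integration.integral_cong) (auto split: split_indicator)

lemma fourier_int_measurable[measurable]:
  assumes [measurable]: "f \<in> borel_measurable borel"
  shows "fourier_int f \<in> borel_measurable borel"
  unfolding fourier_int_def
  by (intro borel_measurable_times borel_measurable_const borel_measurable_lborel_integral) measurable

lemma integrable_cis_mult:
  fixes g :: "R3 \<Rightarrow> complex"
  assumes g: "integrable lborel g" and h: "h \<in> borel_measurable borel"
  shows "integrable lborel (\<lambda>x. cis (h x) * g x)"
proof (rule Bochner_Integration.integrable_bound[OF g])
  note h[measurable]
  have [measurable]: "g \<in> borel_measurable borel" using g by auto
  show "AE x in lborel. norm (cis (h x) * g x) \<le> norm (g x)" by (simp add: norm_mult)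
  show "(\<lambda>x. cis (h x) * g x) \<in> borel_measurable lborel" by measurable
qed

lemma norm_fourier_int_le:
  assumes f: "integrable lborel f"
  shows "norm (fourier_int f p) \<le> (2 * pi) powr (- 3 / 2) * (LINT x|lborel. \<bar>f x\<bar>)"
proof -
  have "norm (LINT x|lborel. cis (- (p \<bullet> x)) * of_real (f x)) \<le>
     (LINT x|lborel. norm (cis (- (p \<bullet> x)) * of_real (f x)))"
    by (rule integral_norm_bound)
  also have "\<dots> = (LINT x|lborel. \<bar>f x\<bar>)" by (simp add: norm_mult)
  finally have "norm (LINT x|lborel. cis (- (p \<bullet> x)) * of_real (f x)) \<le> (LINT x|lborel. \<bar>f x\<bar>)" .
  then show ?thesis
    unfolding fourier_int_def norm_mult by (simp add: mult_left_mono)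
qed

lemma fourier_int_diff:
  assumes f: "integrable lborel f" and g: "integrable lborel g"
  shows "fourier_int (\<lambda>x. f x - g x) p = fourier_int f p - fourier_int g p"
proof -
  have "integrable lborel (\<lambda>x. cis (- (p \<bullet> x)) * of_real (f x))"
    "integrable lborel (\<lambda>x. cis (- (p \<bullet> x)) * of_real (g x))"
    using f g by (auto intro!: integrable_cis_mult)
  then show ?thesis
    by (simp add: fourier_int_def right_diff_distrib of_real_diff)
qed

lemma gaussian_L1:
  assumes "s > 0"
  shows "integrable lborel (\<lambda>p::R3. exp (- (s * norm p)\<^sup>2 / 2))"
  using integrable_norm[OF gaussian_fourier(1)[OF assms, of "0::R3"]] by (simp add: norm_mult)

text \<open>The square modulus is written as a product of two transforms, so that the pairing formula can
  be applied twice, the Gaussian factor making both applications legitimate.\<close>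

lemma fourier_int_gaussian_norm:
  assumes f: "integrable lborel f" and s: "s > 0"
  shows "(LINT p|lborel. (norm (fourier_int f p))^2 * exp (- (s * norm p)\<^sup>2 / 2)) =
    (2 * pi) powr (- 3 / 2) / s ^ 3 * (LINT x|lborel. f x * (LINT y|lborel. f y * exp (- (norm (y - x) / s)\<^sup>2 / 2)))"
proof -
  let ?k = "complex_of_real ((2 * pi) powr (- 3 / 2))"
  let ?h = "\<lambda>p::R3. complex_of_real (exp (- (s * norm p)\<^sup>2 / 2))"
  let ?f = "\<lambda>x. complex_of_real (f x)"
  let ?G = "\<lambda>x. LINT y|lborel. f y * exp (- (norm (y - x) / s)\<^sup>2 / 2)"
  let ?c = "complex_of_real ((sqrt (2 * pi) / s) ^ 3)"
  have [measurable]: "f \<in> borel_measurable borel" using f by auto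
  have fc: "integrable lborel ?f" using f by simp
  have hi: "integrable lborel ?h" using gaussian_L1[OF s] by simp
  let ?A = "\<lambda>p. LINT x|lborel. cis (-1 * (p \<bullet> x)) * ?f x"
  let ?B = "\<lambda>p. LINT x|lborel. cis (1 * (p \<bullet> x)) * ?f x"
  have cnjA: "cnj (?A p) = ?B p" for p
    unfolding Bochner_Integration.integral_cnj[symmetric] by (simp add: cis_cnj)
  have A: "fourier_int f p = ?k * ?A p" for p by (simp add: fourier_int_def)
  have Bm: "?B \<in> borel_measurable borel"
    by (rule borel_measurable_lborel_integral) measurable
  have Bb: "norm (?B p) \<le> (LINT x|lborel. \<bar>f x\<bar>)" for p
    using integral_norm_bound[of lborel "\<lambda>x. cis (1 * (p \<bullet> x)) * ?f x"] by (simp add: norm_mult)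
  have Bh: "integrable lborel (\<lambda>p. ?B p * ?h p)"
  proof (rule Bochner_Integration.integrable_bound[OF integrable_mult_right[OF hi, of "complex_of_real (LINT x|lborel. \<bar>f x\<bar>)"]])
    note Bm[measurable]
    show "(\<lambda>p. ?B p * ?h p) \<in> borel_measurable lborel" by measurable
    show "AE p in lborel. norm (?B p * ?h p) \<le> norm (complex_of_real (LINT x|lborel. \<bar>f x\<bar>) * ?h p)"
      unfolding norm_mult using Bb by (intro AE_I2 mult_right_mono) (auto intro: order_trans)
  qed
  \<comment> \<open>The factor \<open>?B p\<close> is itself a transform, so the formula also
    applies inside. The two phases combine to y - x, and the integral over p becomes a Gaussian in y
    - x.\<close>
  have in1: "(LINT p|lborel. cis (-1 * (p \<bullet> x)) * (?B p * ?h p)) =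
      ?c * complex_of_real (?G x)" for x
  proof -
    have "(LINT p|lborel. cis (-1 * (p \<bullet> x)) * (?B p * ?h p)) = (LINT p|lborel. ?B p * (cis (-1 * (p \<bullet> x)) * ?h p))"
      by (simp only: mult_ac)
    also have "\<dots> = (LINT y|lborel. ?f y * (LINT p|lborel. cis (1 * (p \<bullet> y)) * (cis (-1 * (p \<bullet> x)) * ?h p)))"
      by (rule fourier_pairing[OF fc integrable_cis_mult[OF hi]]) measurable
    also have "\<dots> = (LINT y|lborel. ?c * complex_of_real (f y * exp (- (norm (y - x) / s)\<^sup>2 / 2)))"
    proof (intro Bochner_Integration.integral_cong refl)
      fix y
      have "cis (1 * (p \<bullet> y)) * (cis (-1 * (p \<bullet> x)) * ?h p) = cis ((y - x) \<bullet> p) * ?h p" for p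
      proof -
        have "cis ((y - x) \<bullet> p) = cis (1 * (p \<bullet> y)) * cis (-1 * (p \<bullet> x))"
          by (simp add: cis_mult inner_diff_right inner_commute)
        then show ?thesis by (simp only: mult.assoc)
      qed
      then show "?f y * (LINT p|lborel. cis (1 * (p \<bullet> y)) * (cis (-1 * (p \<bullet> x)) * ?h p)) =
          ?c * complex_of_real (f y * exp (- (norm (y - x) / s)\<^sup>2 / 2))"
        by (simp only: gaussian_fourier(2)[OF s] DIM_R3 of_real_mult mult_ac)
    qed
    also have "\<dots> = ?c * complex_of_real (?G x)"
      by (simp only: integral_mult_right_zero integral_complex_of_real)
    finally show ?thesis .
  qed
  have "complex_of_real (LINT p|lborel. (norm (fourier_int f p))^2 * exp (- (s * norm p)\<^sup>2 / 2)) =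
     (LINT p|lborel. ?k * ?k * (?A p * (?B p * ?h p)))"
    unfolding integral_complex_of_real[symmetric]
  proof (intro Bochner_Integration.integral_cong refl)
    fix p :: R3
    show "complex_of_real ((norm (fourier_int f p))^2 * exp (- (s * norm p)\<^sup>2 / 2)) = ?k * ?k * (?A p * (?B p * ?h p))"
      unfolding of_real_mult complex_norm_square A cnjA[symmetric] by simp
  qed
  also have "\<dots> = ?k * ?k * (LINT p|lborel. ?A p * (?B p * ?h p))"
    by (simp only: integral_mult_right_zero)
  also have "(LINT p|lborel. ?A p * (?B p * ?h p)) =
      (LINT x|lborel. ?f x * (LINT p|lborel. cis (-1 * (p \<bullet> x)) * (?B p * ?h p)))"
    by (rule fourier_pairing[OF fc Bh])
  also have "\<dots> = (LINT x|lborel. ?c * complex_of_real (f x * ?G x))"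
    unfolding in1 by (simp only: of_real_mult mult_ac)
  also have "\<dots> = ?c * complex_of_real (LINT x|lborel. f x * ?G x)"
    by (simp only: integral_mult_right_zero integral_complex_of_real)
  finally have "complex_of_real (LINT p|lborel. (norm (fourier_int f p))^2 * exp (- (s * norm p)\<^sup>2 / 2)) =
     complex_of_real ((2 * pi) powr (- 3 / 2) * (2 * pi) powr (- 3 / 2) * (sqrt (2 * pi) / s) ^ 3 *
       (LINT x|lborel. f x * ?G x))"
    by (simp only: of_real_mult mult.assoc)
  moreover have "(2 * pi) powr (- 3 / 2) * (2 * pi) powr (- 3 / 2) * (sqrt (2 * pi) / s) ^ 3 = (2 * pi) powr (- 3 / 2) / s ^ 3"
  proof -
    have "sqrt (2 * pi) ^ 3 = (2 * pi) powr (3 / 2)"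
      by (simp add: powr_half_sqrt[symmetric] powr_powr flip: powr_realpow)
    then have "(2 * pi) powr (- 3 / 2) * sqrt (2 * pi) ^ 3 = 1"
      by (simp flip: powr_add)
    then show ?thesis by (simp add: power_divide)
  qed
  ultimately show ?thesis unfolding of_real_eq_iff by simp
qed


text \<open>The substitution y = x + s z absorbs s^(-3) and leaves the autocorrelation of f at s z,
  averaged against a fixed Gaussian. In this form s can tend to 0.\<close>

lemma fourier_int_gaussian_correlation:
  assumes f: "integrable lborel f" "square_integrable f" and s: "s > 0"
  shows "(LINT p|lborel. (norm (fourier_int f p))^2 * exp (- (s * norm p)\<^sup>2 / 2)) =
    (2 * pi) powr (- 3 / 2) * (LINT z|lborel. exp (- (norm z)\<^sup>2 / 2) * (LINT x|lborel. f x * f (x + s *\<^sub>R z)))"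
proof -
  have [measurable]: "f \<in> borel_measurable borel" using f by auto
  let ?e = "\<lambda>z::R3. exp (- (norm z)\<^sup>2 / 2)"
  let ?H = "\<lambda>z x. ?e z * (f x * f (x + s *\<^sub>R z))"
  have e: "integrable lborel ?e" using gaussian_L1[of 1] by simp
  have fi: "integrable lborel (\<lambda>x. f x * f (x + w))" for w
    using square_integrable_inner[OF f(2) square_integrable_translate(1)[OF f(2), of w]] by simp
  have int: "integrable (lborel \<Otimes>\<^sub>M lborel) (\<lambda>(z, x). ?H z x)"
  proof (rule lborel_pair.Fubini_integrable)
    show "(\<lambda>(z, x). ?H z x) \<in> borel_measurable (lborel \<Otimes>\<^sub>M lborel)"
      by (rule borel_pair_measurable_lborel) measurable
    have N: "(LINT x|lborel. norm (?H z x)) = ?e z * (LINT x|lborel. norm (f x) * norm (f (x + s *\<^sub>R z)))" for z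
      by (simp add: abs_mult)
    show "integrable lborel (\<lambda>z. LINT x|lborel. norm (case (z, x) of (z, x) \<Rightarrow> ?H z x))"
      unfolding prod.case N
    proof (rule Bochner_Integration.integrable_bound[OF integrable_mult_left[OF e, of "(norm (abs_l2 f))^2"]])
      have "(\<lambda>z. LINT x|lborel. norm (f x) * norm (f (x + s *\<^sub>R z))) \<in> borel_measurable borel"
        by (rule borel_measurable_lborel_integral) measurable
      then show "(\<lambda>z. ?e z * (LINT x|lborel. norm (f x) * norm (f (x + s *\<^sub>R z)))) \<in> borel_measurable lborel"
        by (intro borel_measurable_times) auto
      show "AE z in lborel. norm (?e z * (LINT x|lborel. norm (f x) * norm (f (x + s *\<^sub>R z)))) \<le> norm (?e z * (norm (abs_l2 f))^2)"
      proof (rule AE_I2)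
        fix z :: R3
        have "(LINT x|lborel. norm (f x) * norm (f (x + s *\<^sub>R z))) \<le> (norm (abs_l2 f))^2"
          using L2_Cauchy_Schwarz[OF f(2) square_integrable_translate(1)[OF f(2), of "s *\<^sub>R z"]]
          unfolding square_integrable_translate(2)[OF f(2)] by (simp add: power2_eq_square)
        moreover have "0 \<le> (LINT x|lborel. norm (f x) * norm (f (x + s *\<^sub>R z)))" by simp
        ultimately show "norm (?e z * (LINT x|lborel. norm (f x) * norm (f (x + s *\<^sub>R z)))) \<le> norm (?e z * (norm (abs_l2 f))^2)"
          unfolding norm_mult by (intro mult_left_mono) auto
      qed
    qed
    show "AE z in lborel. integrable lborel (\<lambda>x. case (z, x) of (z, x) \<Rightarrow> ?H z x)"
      using fi by simp
  qed
  have "(LINT x|lborel. f x * (LINT y|lborel. f y * exp (- (norm (y - x) / s)\<^sup>2 / 2))) =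
      (LINT x|lborel. s ^ 3 * (LINT z|lborel. ?H z x))"
  proof (intro Bochner_Integration.integral_cong refl)
    fix x :: R3
    have "(LINT y|lborel. f y * exp (- (norm (y - x) / s)\<^sup>2 / 2)) =
        \<bar>s\<bar> ^ DIM(R3) *\<^sub>R (LINT z|lborel. f (x + s *\<^sub>R z) * exp (- (norm ((x + s *\<^sub>R z) - x) / s)\<^sup>2 / 2))"
      using s by (intro lborel_integral_affine) auto
    also have "\<dots> = s ^ 3 * (LINT z|lborel. f (x + s *\<^sub>R z) * ?e z)"
      using s by simp
    finally have 1: "(LINT y|lborel. f y * exp (- (norm (y - x) / s)\<^sup>2 / 2)) = s ^ 3 * (LINT z|lborel. f (x + s *\<^sub>R z) * ?e z)" .
    have 2: "?H z x = f x * (f (x + s *\<^sub>R z) * ?e z)" for z by simp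
    show "f x * (LINT y|lborel. f y * exp (- (norm (y - x) / s)\<^sup>2 / 2)) = s ^ 3 * (LINT z|lborel. ?H z x)"
      unfolding 1 2 integral_mult_right_zero by simp
  qed
  also have "\<dots> = s ^ 3 * (LINT x|lborel. LINT z|lborel. ?H z x)" by simp
  also have "(LINT x|lborel. LINT z|lborel. ?H z x) = (LINT z|lborel. LINT x|lborel. ?H z x)"
    by (rule lborel_pair.Fubini_integral[OF int])
  also have "\<dots> = (LINT z|lborel. ?e z * (LINT x|lborel. f x * f (x + s *\<^sub>R z)))"
    by (simp only: integral_mult_right_zero)
  finally show ?thesis
    unfolding fourier_int_gaussian_norm[OF f(1) s] using s by simp
qed

text \<open>As s decreases to 0, the left side of the correlation formula increases to the integral
  of the squared modulus of the transform, which monotone convergence proves finite. On the right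
  the autocorrelation tends to its value at 0, the squared norm of f, by continuity of translations,
  and the Gaussian mass (2 pi)^(3/2) cancels the constant.\<close>

lemma plancherel_L1_L2:
  assumes f: "integrable lborel f" "square_integrable f"
  shows "square_integrable (fourier_int f)" "norm (abs_l2 (fourier_int f)) = norm (abs_l2 f)"
proof -
  have fm[measurable]: "f \<in> borel_measurable borel" using f by auto
  let ?e = "\<lambda>z::R3. exp (- (norm z)\<^sup>2 / 2)"
  define s where "s n = 1 / real (Suc n)" for n
  let ?E = "\<lambda>n p. exp (- (s n * norm p)\<^sup>2 / 2)" and ?F = "\<lambda>p. (norm (fourier_int f p))^2"
  let ?N = "(norm (abs_l2 f))^2"
  have s: "s n > 0" for n by (simp add: s_def)
  have s0: "s \<longlonglongrightarrow> 0" unfolding s_def by (rule lim_1_over_n[THEN LIMSEQ_Suc, unfolded o_def])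
  have e: "integrable lborel ?e" using gaussian_L1[of 1] by simp
  have ei: "(2 * pi) powr (- 3 / 2) * (LINT z|lborel. ?e z) = 1"
  proof -
    have "complex_of_real (LINT z|lborel. ?e z) = complex_of_real (sqrt (2 * pi) ^ 3)"
      using gaussian_fourier(2)[of 1 "0::R3"] by simp
    then have "(LINT z|lborel. ?e z) = sqrt (2 * pi) ^ 3" unfolding of_real_eq_iff .
    also have "\<dots> = (2 * pi) powr (3 / 2)"
      by (simp add: powr_half_sqrt[symmetric] powr_powr flip: powr_realpow)
    finally show ?thesis by (simp flip: powr_add)
  qed
  let ?c = "\<lambda>n z. LINT x|lborel. f x * f (x + s n *\<^sub>R z)"
  have "(\<lambda>n. LINT z|lborel. ?e z * ?c n z) \<longlonglongrightarrow> (LINT z|lborel. ?e z * ?N)"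
  proof (rule integral_dominated_convergence[OF _ _ integrable_mult_left[OF e, of "?N"]])
    show "(\<lambda>z. ?e z * ?c n z) \<in> borel_measurable lborel" for n
    proof -
      have "?c n \<in> borel_measurable borel"
        by (rule borel_measurable_lborel_integral) measurable
      then show ?thesis by (intro borel_measurable_times) auto
    qed
    show "AE z in lborel. norm (?e z * ?c n z) \<le> ?e z * ?N" for n
    proof (rule AE_I2)
      fix z :: R3
      have "norm (?c n z) \<le> (LINT x|lborel. norm (f x) * norm (f (x + s n *\<^sub>R z)))"
        using integral_norm_bound[of lborel "\<lambda>x. f x * f (x + s n *\<^sub>R z)"] by (simp add: abs_mult)
      also have "\<dots> \<le> ?N"
        using L2_Cauchy_Schwarz[OF f(2) square_integrable_translate(1)[OF f(2), of "s n *\<^sub>R z"]]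
        unfolding square_integrable_translate(2)[OF f(2)] by (simp add: power2_eq_square)
      finally show "norm (?e z * ?c n z) \<le> ?e z * ?N"
        unfolding norm_mult by (intro mult_mono) auto
    qed
    show "AE z in lborel. (\<lambda>n. ?e z * ?c n z) \<longlonglongrightarrow> ?e z * ?N"
    proof (rule AE_I2, intro tendsto_mult tendsto_const)
      fix z :: R3
      have "(\<lambda>n. s n *\<^sub>R z) \<longlonglongrightarrow> 0 *\<^sub>R z" by (intro tendsto_intros s0)
      then have "(\<lambda>n. abs_l2 (\<lambda>x. f (s n *\<^sub>R z + 1 *\<^sub>R x))) \<longlonglongrightarrow> abs_l2 f"
        by (intro tendsto_l2_affine f) auto
      then have "(\<lambda>n. abs_l2 f \<bullet> abs_l2 (\<lambda>x. f (s n *\<^sub>R z + 1 *\<^sub>R x))) \<longlonglongrightarrow> abs_l2 f \<bullet> abs_l2 f"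
        by (intro tendsto_inner tendsto_const)
      moreover have "abs_l2 f \<bullet> abs_l2 (\<lambda>x. f (s n *\<^sub>R z + 1 *\<^sub>R x)) = ?c n z" for n
        by (subst inner_abs_l2) (use f square_integrable_translate(1)[OF f(2), of "s n *\<^sub>R z"] in \<open>simp_all add: add.commute\<close>)
      ultimately show "(\<lambda>n. ?c n z) \<longlonglongrightarrow> ?N" by (simp add: power2_norm_eq_inner)
    qed
  qed simp
  then have "(\<lambda>n. (2 * pi) powr (- 3 / 2) * (LINT z|lborel. ?e z * ?c n z)) \<longlonglongrightarrow>
      (2 * pi) powr (- 3 / 2) * (LINT z|lborel. ?e z * ?N)"
    by (intro tendsto_mult tendsto_const)
  also have "(2 * pi) powr (- 3 / 2) * (LINT z|lborel. ?e z * ?N) = ?N"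
    unfolding integral_mult_left_zero using ei by (simp only: mult.assoc[symmetric] mult_1)
  finally have lim: "(\<lambda>n. LINT p|lborel. ?F p * ?E n p) \<longlonglongrightarrow> ?N"
    unfolding fourier_int_gaussian_correlation[OF f s] .
  let ?C = "((2 * pi) powr (- 3 / 2) * (LINT x|lborel. \<bar>f x\<bar>))^2"
  have hb: "has_bochner_integral lborel (\<lambda>p. ?F p) (?N)"
  proof (rule has_bochner_integral_monotone_convergence[OF _ _ _ lim])
    show "integrable lborel (\<lambda>p. ?F p * ?E n p)" for n
    proof (rule Bochner_Integration.integrable_bound[OF integrable_mult_right[OF gaussian_L1[OF s[of n]], of ?C]])
      show "AE p in lborel. norm (?F p * ?E n p) \<le> norm (?C * ?E n p)"
        unfolding norm_mult using norm_fourier_int_le[OF f(1)]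
        by (intro AE_I2 mult_right_mono) (auto intro!: power_mono simp flip: power_mult_distrib)
    qed measurable
    show "AE p in lborel. mono (\<lambda>n. ?F p * ?E n p)"
    proof (rule AE_I2, rule monoI)
      fix p :: R3 and n k :: nat assume "n \<le> k"
      then have "s k \<le> s n" by (simp add: s_def frac_le)
      then have "(s k * norm p)^2 \<le> (s n * norm p)^2"
        using s[of k] s[of n] by (intro power_mono mult_right_mono) auto
      then show "?F p * ?E n p \<le> ?F p * exp (- (s k * norm p)\<^sup>2 / 2)"
        by (intro mult_left_mono) auto
    qed
    show "AE p in lborel. (\<lambda>n. ?F p * ?E n p) \<longlonglongrightarrow> ?F p"
    proof (rule AE_I2)
      fix p :: R3
      have "(\<lambda>n. ?F p * ?E n p) \<longlonglongrightarrow>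
         ?F p * exp (- (0 * norm p)\<^sup>2 / 2)"
        by (intro tendsto_intros s0) simp
      then show "(\<lambda>n. ?F p * ?E n p) \<longlonglongrightarrow> ?F p"
        by simp
    qed
  qed measurable
  show q: "square_integrable (fourier_int f)"
    by (rule square_integrableI) (use hb in \<open>auto simp: has_bochner_integral_iff\<close>)
  have "(norm (abs_l2 (fourier_int f)))^2 = ?N"
    using hb by (simp add: power2_norm_abs_l2[OF q] has_bochner_integral_iff)
  then show "norm (abs_l2 (fourier_int f)) = norm (abs_l2 f)" by (simp add: power2_eq_iff_nonneg)
qed

section \<open>Extension of the transform to all of L2\<close>

lemma fourier_int_isometry:
  assumes "integrable lborel f" "square_integrable f" "integrable lborel g" "square_integrable g"
  shows "norm (abs_l2 (fourier_int f) - abs_l2 (fourier_int g)) = norm (abs_l2 f - abs_l2 g)"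
proof -
  have e: "(\<lambda>p. fourier_int f p - fourier_int g p) = fourier_int (\<lambda>x. f x - g x)"
    using assms by (intro ext) (simp add: fourier_int_diff)
  have "abs_l2 (fourier_int f) - abs_l2 (fourier_int g) = abs_l2 (fourier_int (\<lambda>x. f x - g x))"
    using assms by (simp add: abs_l2_diff plancherel_L1_L2 e)
  also have "norm \<dots> = norm (abs_l2 f - abs_l2 g)"
    using assms by (simp add: plancherel_L1_L2 square_integrable_diff abs_l2_diff)
  finally show ?thesis .
qed

lemma truncation_L1_L2:
  fixes f :: "R3 \<Rightarrow> real"
  assumes f: "square_integrable f"
  shows "integrable lborel (cutoff R f)"
    "square_integrable (cutoff R f)"
proof -
  have [measurable]: "cball 0 R \<in> sets (borel :: R3 measure)" by simp
  note l2_measurable[OF f, measurable]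
  show "integrable lborel (cutoff R f)"
    using square_integrable_inner[OF square_integrable_indicator_cball f] by simp
  show "square_integrable (cutoff R f)"
    by (rule square_integrable_bound[OF f]) (auto split: split_indicator)
qed

lemma truncation_tendsto:
  fixes f :: "R3 \<Rightarrow> real"
  assumes f: "square_integrable f"
  shows "((\<lambda>R. abs_l2 (cutoff R f)) \<longlongrightarrow> abs_l2 f) at_top"
proof (rule tendsto_at_topI_sequentially)
  fix X :: "nat \<Rightarrow> real" assume X: "filterlim X at_top sequentially"
  have [measurable]: "cball 0 R \<in> sets (borel :: R3 measure)" for R by simp
  note l2_measurable[OF f, measurable]
  show "(\<lambda>n. abs_l2 (cutoff (X n) f)) \<longlonglongrightarrow> abs_l2 f"
  proof (rule l2_dominated_convergence[OF _ _ square_integrable_of_norm[OF f]])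
    show "AE x in lborel. norm (indicator (cball 0 (X n)) x * f x) \<le> norm (f x)" for n
      by (intro AE_I2) (auto split: split_indicator)
    show "AE x in lborel. (\<lambda>n. indicator (cball 0 (X n)) x * f x) \<longlonglongrightarrow> f x"
    proof (rule AE_I2, rule tendsto_eventually)
      fix x :: R3
      have "\<forall>\<^sub>F n in sequentially. norm x \<le> X n" using X by (simp add: filterlim_at_top)
      then show "\<forall>\<^sub>F n in sequentially. indicator (cball 0 (X n)) x * f x = f x"
        by eventually_elim simp
    qed
  qed measurable
qed

lemma fourier_trunc_isometry:
  assumes f: "square_integrable f"
  shows "square_integrable (fourier_trunc f R)"
    "norm (abs_l2 (fourier_trunc f R)) = norm (abs_l2 (cutoff R f))"
    "norm (abs_l2 (fourier_trunc f R) - abs_l2 (fourier_trunc f S)) =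
      norm (abs_l2 (cutoff R f) - abs_l2 (cutoff S f))"
  unfolding fourier_trunc_eq_fourier_int
  by (intro plancherel_L1_L2 fourier_int_isometry truncation_L1_L2 f)+

lemma Cauchy_isometry:
  fixes X :: "nat \<Rightarrow> 'a::real_normed_vector" and Y :: "nat \<Rightarrow> 'b::real_normed_vector"
  assumes "Cauchy X" and "\<And>i j. norm (Y i - Y j) = norm (X i - X j)"
  shows "Cauchy Y"
  using assms unfolding Cauchy_def dist_norm by simp

text \<open>On truncations the transform is an isometry, so convergence of the truncations makes the
  transforms Cauchy, and completeness of L2 provides the limit.\<close>

theorem has_fourier_fourier: "has_fourier u (fourier u)"
  and norm_fourier: "norm (fourier u) = norm u"
proof -
  let ?f = "rep_l2 u"
  let ?X = "\<lambda>R. abs_l2 (cutoff R ?f)"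
  let ?Y = "\<lambda>R. abs_l2 (fourier_trunc ?f R)"
  have q: "square_integrable ?f" by (rule square_integrable_rep)
  note iso = fourier_trunc_isometry[OF q]
  have X: "(?X \<longlongrightarrow> u) at_top" using truncation_tendsto[OF q] by (simp add: abs_rep_l2)
  have Xn: "(\<lambda>n. ?X (real n)) \<longlonglongrightarrow> u" by (rule filterlim_compose[OF X filterlim_real_sequentially])
  have "Cauchy (\<lambda>n. ?Y (real n))"
    by (rule Cauchy_isometry[OF LIMSEQ_imp_Cauchy[OF Xn]]) (rule iso(3))
  then obtain v where v: "(\<lambda>n. ?Y (real n)) \<longlonglongrightarrow> v"
    unfolding Cauchy_convergent_iff convergent_def by blast
  \<comment> \<open>Comparison with integer radii carries the convergence over to all real R: both
    distances are limits of the same sequence.\<close>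
  have d: "norm (?Y R - v) = norm (?X R - u)" for R
  proof (rule LIMSEQ_unique)
    show "(\<lambda>n. norm (?Y R - ?Y (real n))) \<longlonglongrightarrow> norm (?Y R - v)" by (intro tendsto_intros v)
    show "(\<lambda>n. norm (?Y R - ?Y (real n))) \<longlonglongrightarrow> norm (?X R - u)"
      unfolding iso(3) by (intro tendsto_intros Xn)
  qed
  have "((\<lambda>R. norm (?X R - u)) \<longlongrightarrow> 0) at_top"
    using X by (simp add: LIM_zero tendsto_norm_zero)
  then have "((\<lambda>R. norm (?Y R - v)) \<longlongrightarrow> 0) at_top" unfolding d .
  then have "(?Y \<longlongrightarrow> v) at_top" by (simp add: LIM_zero_iff tendsto_norm_zero_iff)
  then have h: "has_fourier u v" by (simp add: has_fourier_def iso(1))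
  have "norm v = norm u"
    by (rule LIMSEQ_unique[OF tendsto_norm[OF v]]) (use tendsto_norm[OF Xn] in \<open>simp add: iso(2)\<close>)
  then show "has_fourier u (fourier u)" "norm (fourier u) = norm u"
    using h fourier_eqI[OF h] by auto
qed

lemma fourier_add: "fourier (u + v) = fourier u + fourier v"
  by (intro fourier_eqI has_fourier_add has_fourier_fourier)

lemma fourier_scaleR: "fourier (c *\<^sub>R u) = c *\<^sub>R fourier u"
  by (intro fourier_eqI has_fourier_scaleR has_fourier_fourier)

lemma bounded_linear_fourier: "bounded_linear fourier"
  by (rule bounded_linear_intro[of _ 1]) (simp_all add: fourier_add fourier_scaleR norm_fourier)

lemma fourier_diff: "fourier (u - v) = fourier u - fourier v"
  by (rule linear_diff[OF bounded_linear.linear[OF bounded_linear_fourier]])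

lemma fourier_inject: "fourier u = fourier v \<longleftrightarrow> u = v"
  using norm_fourier[of "u - v"] by (auto simp: fourier_diff)

lemma has_fourier_iff: "has_fourier u v \<longleftrightarrow> fourier u = v"
  using fourier_eqI has_fourier_fourier by auto

text \<open>An isometry of a complete space has closed range. This is the means of showing that an
  element of the complex L2 space is the transform of a real function.\<close>

lemma fourier_range_closed:
  assumes "(\<lambda>n. fourier (X n)) \<longlonglongrightarrow> v"
  obtains u where "X \<longlonglongrightarrow> u" "fourier u = v"
proof -
  have "Cauchy X"
    by (rule Cauchy_isometry[OF LIMSEQ_imp_Cauchy[OF assms]])
      (simp add: norm_fourier flip: fourier_diff)
  then obtain u where u: "X \<longlonglongrightarrow> u" unfolding Cauchy_convergent_iff convergent_def by blast
  have "(\<lambda>n. fourier (X n)) \<longlonglongrightarrow> fourier u"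
    by (rule bounded_linear.tendsto[OF bounded_linear_fourier u])
  then have "fourier u = v" by (rule LIMSEQ_unique[OF _ assms])
  with u show ?thesis by (rule that)
qed

text \<open>The cutoffs tend to f in L2, and \<open>fourier_int\<close> is isometric on functions
  that are integrable and square integrable.\<close>

lemma fourier_abs_l2:
  assumes f: "integrable lborel f" "square_integrable f"
  shows "fourier (abs_l2 f) = abs_l2 (fourier_int f)"
proof (rule fourier_eqI, unfold has_fourier_def, intro conjI allI)
  have e: "fourier_trunc (rep_l2 (abs_l2 f)) R = fourier_trunc f R" for R
    by (intro ext fourier_trunc_cong_AE square_integrable_rep f rep_abs_l2)
  show "square_integrable (fourier_trunc (rep_l2 (abs_l2 f)) R)" for R
    unfolding e by (rule fourier_trunc_isometry[OF f(2)])
  have "norm (abs_l2 (fourier_trunc f R) - abs_l2 (fourier_int f)) =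
      norm (abs_l2 (cutoff R f) - abs_l2 f)" for R
    unfolding fourier_trunc_eq_fourier_int by (intro fourier_int_isometry truncation_L1_L2 f)
  moreover have "((\<lambda>R. norm (abs_l2 (cutoff R f) - abs_l2 f)) \<longlongrightarrow> 0) at_top"
    using truncation_tendsto[OF f(2)] by (simp add: LIM_zero tendsto_norm_zero)
  ultimately have "((\<lambda>R. norm (abs_l2 (fourier_trunc f R) - abs_l2 (fourier_int f))) \<longlongrightarrow> 0) at_top" by simp
  then show "((\<lambda>R. abs_l2 (fourier_trunc (rep_l2 (abs_l2 f)) R)) \<longlongrightarrow> abs_l2 (fourier_int f)) at_top"
    unfolding e by (simp add: LIM_zero_iff tendsto_norm_zero_iff)
qed

subsection \<open>Fourier multipliers on L2\<close>

lemma rep_mult_l2: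
  "v \<in> mult_domain a \<Longrightarrow> AE p in lborel. rep_l2 (mult_l2 a v) p = a p *\<^sub>R rep_l2 v p"
  unfolding mult_l2_def mult_domain_def by (intro rep_abs_l2) simp

lemma mult_l2_bounded:
  assumes [measurable]: "a \<in> borel_measurable borel" and b: "\<And>p. \<bar>a p\<bar> \<le> C * \<bar>b p\<bar>" and C: "0 \<le> C"
    and v: "v \<in> mult_domain b"
  shows "v \<in> mult_domain a" "norm (mult_l2 a v) \<le> C * norm (mult_l2 b v)"
proof -
  have q: "square_integrable (\<lambda>p. b p *\<^sub>R rep_l2 v p)" using v by (simp add: mult_domain_def)
  have m: "(\<lambda>p. a p *\<^sub>R rep_l2 v p) \<in> borel_measurable borel" by measurable
  have le: "AE p in lborel. norm (a p *\<^sub>R rep_l2 v p) \<le> C * norm (b p *\<^sub>R rep_l2 v p)"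
    using b by (intro AE_I2) (simp add: mult_right_mono flip: mult.assoc)
  show "v \<in> mult_domain a" "norm (mult_l2 a v) \<le> C * norm (mult_l2 b v)"
    using norm_l2_bounded_ae[OF q m C le] by (simp_all add: mult_domain_def mult_l2_def)
qed

lemma mult_l2_one: "v \<in> mult_domain (\<lambda>p. 1)" "mult_l2 (\<lambda>p. 1) v = v"
  by (simp_all add: mult_domain_def mult_l2_def square_integrable_rep abs_rep_l2)

lemma mult_l2_bounded_symbol:
  assumes a: "a \<in> borel_measurable borel" and b: "\<And>p. \<bar>a p\<bar> \<le> C"
  shows "v \<in> mult_domain a" "norm (mult_l2 a v) \<le> C * norm v"
proof -
  have "0 \<le> C" using b[of 0] by linarith
  then show "v \<in> mult_domain a" "norm (mult_l2 a v) \<le> C * norm v"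
    using mult_l2_bounded[OF a, where b="\<lambda>p. 1" and C=C and v=v] b by (simp_all add: mult_l2_one)
qed

lemma bounded_linear_mult_l2:
  assumes a: "a \<in> borel_measurable borel" and b: "\<And>p. \<bar>a p\<bar> \<le> C"
  shows "bounded_linear (mult_l2 a)"
  by (rule bounded_linear_intro[of _ C])
    (simp_all add: mult_add mult_scaleR mult_l2_bounded_symbol[OF assms] a mult.commute)

lemma mult_l2_cong_AE:
  assumes [measurable]: "a \<in> borel_measurable borel" "b \<in> borel_measurable borel"
    and v: "v \<in> mult_domain a" and e: "AE p in lborel. a p *\<^sub>R rep_l2 v p = b p *\<^sub>R rep_l2 w p"
  shows "w \<in> mult_domain b" "mult_l2 b w = mult_l2 a v"
proof -
  have q: "square_integrable (\<lambda>p. a p *\<^sub>R rep_l2 v p)" using v by (simp add: mult_domain_def)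
  show "w \<in> mult_domain b"
    unfolding mult_domain_def mem_Collect_eq by (rule square_integrable_cong_AE[OF q _ e]) measurable
  show "mult_l2 b w = mult_l2 a v"
    unfolding mult_l2_def by (rule abs_l2_cong[OF q _ e, symmetric]) measurable
qed

lemma mult_l2_mult:
  assumes a: "a \<in> borel_measurable borel" and b: "b \<in> borel_measurable borel"
    and v: "v \<in> mult_domain b" and ab: "v \<in> mult_domain (\<lambda>p. a p * b p)"
  shows "mult_l2 b v \<in> mult_domain a" "mult_l2 a (mult_l2 b v) = mult_l2 (\<lambda>p. a p * b p) v"
proof -
  have e: "AE p in lborel. (a p * b p) *\<^sub>R rep_l2 v p = a p *\<^sub>R rep_l2 (mult_l2 b v) p"
    using rep_mult_l2[OF v] by eventually_elim simp
  note * = mult_l2_cong_AE[OF borel_measurable_times[OF a b] a ab e]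
  show "mult_l2 b v \<in> mult_domain a" "mult_l2 a (mult_l2 b v) = mult_l2 (\<lambda>p. a p * b p) v"
    by (rule *(1), rule *(2))
qed

lemma mult_l2_add_symbol:
  assumes v: "v \<in> mult_domain a" "v \<in> mult_domain b"
  shows "v \<in> mult_domain (\<lambda>p. a p + b p)" "mult_l2 (\<lambda>p. a p + b p) v = mult_l2 a v + mult_l2 b v"
  using assms square_integrable_add[of "\<lambda>p. a p *\<^sub>R rep_l2 v p" "\<lambda>p. b p *\<^sub>R rep_l2 v p"]
  by (simp_all add: mult_domain_def mult_l2_def scaleR_add_left abs_l2_add)

lemma mult_l2_scale_symbol:
  assumes v: "v \<in> mult_domain a"
  shows "v \<in> mult_domain (\<lambda>p. c * a p)" "mult_l2 (\<lambda>p. c * a p) v = c *\<^sub>R mult_l2 a v"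
  using assms square_integrable_scaleR[of "\<lambda>p. a p *\<^sub>R rep_l2 v p" c]
  by (simp_all add: mult_domain_def mult_l2_def abs_l2_scaleR)

lemma mult_l2_const: "v \<in> mult_domain (\<lambda>p. c)" "mult_l2 (\<lambda>p. c) v = c *\<^sub>R v"
  using mult_l2_scale_symbol[OF mult_l2_one(1), where c=c and v=v] by (simp_all add: mult_l2_one)

lemma mult_l2_abs:
  assumes h: "square_integrable h" and a[measurable]: "a \<in> borel_measurable borel"
    and b: "\<And>p. \<bar>a p\<bar> \<le> C"
  shows "mult_l2 a (abs_l2 h) = abs_l2 (\<lambda>p. a p *\<^sub>R h p)"
  unfolding mult_l2_def
proof (rule abs_l2_cong)
  show "square_integrable (\<lambda>p. a p *\<^sub>R rep_l2 (abs_l2 h) p)"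
    using mult_l2_bounded_symbol(1)[OF a b, of "abs_l2 h"] by (simp add: mult_domain_def)
  note l2_measurable[OF h, measurable]
  show "(\<lambda>p. a p *\<^sub>R h p) \<in> borel_measurable borel" by measurable
  show "AE p in lborel. a p *\<^sub>R rep_l2 (abs_l2 h) p = a p *\<^sub>R h p"
    using rep_abs_l2[OF h] by eventually_elim simp
qed

subsection \<open>Convolution with an integrable and square-integrable kernel\<close>

definition convolve :: "(R3 \<Rightarrow> real) \<Rightarrow> (R3 \<Rightarrow> real) \<Rightarrow> R3 \<Rightarrow> real" where
  "convolve K f x = (LINT y|lborel. K (x - y) * f y)"

lemma reflect_L2:
  fixes K :: "R3 \<Rightarrow> real"
  assumes K: "square_integrable K"
  shows "square_integrable (\<lambda>y. K (x - y))" "norm (abs_l2 (\<lambda>y. K (x - y))) = norm (abs_l2 K)"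
proof -
  show "square_integrable (\<lambda>y. K (x - y))"
    using square_integrable_affine(1)[OF K, of "-1" x] by simp
  have "(norm (abs_l2 K))^2 = (norm (abs_l2 (\<lambda>y. K (x - y))))^2"
    using square_integrable_affine(2)[OF K, of "-1" x] by simp
  then show "norm (abs_l2 (\<lambda>y. K (x - y))) = norm (abs_l2 K)" by (simp add: power2_eq_iff_nonneg)
qed

text \<open>Cauchy-Schwarz at each point. A kernel in L2 thus makes the convolution bounded
  everywhere, the origin of the supremum bound on H2.\<close>

lemma convolve_L2:
  assumes K: "square_integrable K" and f: "square_integrable f"
  shows "integrable lborel (\<lambda>y. K (x - y) * f y)" "\<bar>convolve K f x\<bar> \<le> norm (abs_l2 K) * norm (abs_l2 f)"
proof -
  show "integrable lborel (\<lambda>y. K (x - y) * f y)"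
    using square_integrable_inner[OF reflect_L2(1)[OF K, of x] f] by simp
  have "\<bar>convolve K f x\<bar> \<le> (LINT y|lborel. norm (K (x - y)) * norm (f y))"
    unfolding convolve_def using integral_norm_bound[of lborel "\<lambda>y. K (x - y) * f y"] by (simp add: abs_mult)
  also have "\<dots> \<le> norm (abs_l2 K) * norm (abs_l2 f)"
    using L2_Cauchy_Schwarz[OF reflect_L2(1)[OF K, of x] f] by (simp add: reflect_L2(2)[OF K])
  finally show "\<bar>convolve K f x\<bar> \<le> norm (abs_l2 K) * norm (abs_l2 f)" .
qed

lemma convolve_measurable[measurable]:
  assumes [measurable]: "K \<in> borel_measurable borel" "f \<in> borel_measurable borel"
  shows "convolve K f \<in> borel_measurable borel"
  unfolding convolve_def by (rule borel_measurable_lborel_integral) measurable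

lemma convolve_L1:
  assumes K: "integrable lborel K" and f: "integrable lborel f"
  shows "integrable lborel (convolve K f)"
    and "(\<And>p. (LINT x|lborel. cis (- (p \<bullet> x)) * of_real (K x)) = complex_of_real (a p)) \<Longrightarrow>
      fourier_int (convolve K f) p = a p *\<^sub>R fourier_int f p"
proof -
  have [measurable]: "K \<in> borel_measurable borel" "f \<in> borel_measurable borel" using assms by auto
  let ?H = "\<lambda>p y x. (cis (- (p \<bullet> x)) * of_real (K (x - y))) * complex_of_real (f y)"
  have Ki: "integrable lborel (\<lambda>x. K (x - y))" for y
    using lborel_integrable_affine[OF K, of 1 "-y"] by simp
  have KI: "(LINT x|lborel. h (x - y)) = (LINT x|lborel. h x)" if "h \<in> borel_measurable borel" for h :: "R3 \<Rightarrow> real" and y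
    using lborel_integral_affine[OF that, of 1 "-y"] by simp
  have int: "integrable (lborel \<Otimes>\<^sub>M lborel) (\<lambda>(y, x). ?H p y x)" for p
  proof (rule lborel_pair.Fubini_integrable)
    show "(\<lambda>(y, x). ?H p y x) \<in> borel_measurable (lborel \<Otimes>\<^sub>M lborel)"
      by (rule borel_pair_measurable_lborel) measurable
    have "(LINT x|lborel. norm (?H p y x)) = (LINT x|lborel. norm (K x)) * norm (f y)" for y
      using KI[of "\<lambda>x. norm (K x)" y] by (simp add: norm_mult)
    then show "integrable lborel (\<lambda>y. LINT x|lborel. norm (case (y, x) of (y, x) \<Rightarrow> ?H p y x))"
      using f by simp
    have "integrable lborel (\<lambda>x. ?H p y x)" for y
      using Ki[of y] by (intro integrable_mult_left integrable_cis_mult) auto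
    then show "AE y in lborel. integrable lborel (\<lambda>x. case (y, x) of (y, x) \<Rightarrow> ?H p y x)" by simp
  qed
  have H: "(LINT y|lborel. ?H p y x) = cis (- (p \<bullet> x)) * of_real (convolve K f x)" for p x
  proof -
    have "?H p y x = cis (- (p \<bullet> x)) * of_real (K (x - y) * f y)" for y by simp
    then show ?thesis
      by (simp only: integral_mult_right_zero integral_complex_of_real convolve_def)
  qed
  \<comment> \<open>At p = 0 the phase is 1, so the Fubini argument also yields integrability of the
    convolution.\<close>
  have "integrable lborel (\<lambda>x. LINT y|lborel. ?H 0 y x)"
    using lborel_pair.integrable_fst'[OF lborel_pair.integrable_product_swap[OF int[of 0]]] by simp
  then have "integrable lborel (\<lambda>x. complex_of_real (convolve K f x))" unfolding H by simp
  then show "integrable lborel (convolve K f)" by (simp add: complex_of_real_integrable_eq)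
  assume a: "\<And>p. (LINT x|lborel. cis (- (p \<bullet> x)) * of_real (K x)) = complex_of_real (a p)"
  have "(LINT x|lborel. cis (- (p \<bullet> x)) * of_real (convolve K f x)) = (LINT x|lborel. LINT y|lborel. ?H p y x)"
    unfolding H ..
  also have "\<dots> = (LINT y|lborel. LINT x|lborel. ?H p y x)"
    by (rule lborel_pair.Fubini_integral[OF int])
  also have "\<dots> = (LINT y|lborel. complex_of_real (a p) * (cis (- (p \<bullet> y)) * complex_of_real (f y)))"
  proof (intro Bochner_Integration.integral_cong refl)
    fix y
    have "(LINT x|lborel. cis (- (p \<bullet> x)) * of_real (K (x - y))) =
      (LINT x|lborel. cis (- (p \<bullet> (y + x))) * complex_of_real (K x))"
      by (subst lborel_integral_affine[of _ 1 y]) simp_all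
    also have "\<dots> = (LINT x|lborel. cis (- (p \<bullet> y)) * (cis (- (p \<bullet> x)) * of_real (K x)))"
      by (simp add: inner_add_right cis_mult flip: mult.assoc)
    also have "\<dots> = cis (- (p \<bullet> y)) * complex_of_real (a p)"
      by (simp only: integral_mult_right_zero a)
    finally show "(LINT x|lborel. ?H p y x) = complex_of_real (a p) * (cis (- (p \<bullet> y)) * complex_of_real (f y))"
      unfolding integral_mult_left_zero by simp
  qed
  also have "\<dots> = complex_of_real (a p) * (LINT y|lborel. cis (- (p \<bullet> y)) * complex_of_real (f y))"
    by (simp only: integral_mult_right_zero)
  finally show "fourier_int (convolve K f) p = a p *\<^sub>R fourier_int f p"
    by (simp add: fourier_int_def scaleR_conv_of_real)
qed

text \<open>f is approximated by its cutoffs, to which the integral transform applies. Integrability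
  of K bounds the symbol, hence gives convergence on the Fourier side and a limit u; square
  integrability of K gives convergence at every point, which identifies u with the
  convolution.\<close>

theorem fourier_convolve:
  assumes K: "integrable lborel K" "square_integrable K" and f: "square_integrable f"
    and am: "a \<in> borel_measurable borel"
    and a: "\<And>p. (LINT x|lborel. cis (- (p \<bullet> x)) * of_real (K x)) = complex_of_real (a p)"
  shows "square_integrable (convolve K f)" "fourier (abs_l2 (convolve K f)) = mult_l2 a (fourier (abs_l2 f))"
proof -
  have [measurable]: "K \<in> borel_measurable borel" "f \<in> borel_measurable borel"
    using K f by (auto intro: l2_measurable)
  have ab: "\<bar>a p\<bar> \<le> (LINT x|lborel. \<bar>K x\<bar>)" for p
  proof -
    have "\<bar>a p\<bar> = norm (LINT x|lborel. cis (- (p \<bullet> x)) * of_real (K x))" unfolding a by simp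
    also have "\<dots> \<le> (LINT x|lborel. norm (cis (- (p \<bullet> x)) * of_real (K x)))"
      by (rule integral_norm_bound)
    finally show ?thesis by (simp add: norm_mult)
  qed
  define F where "F n x = indicator (cball 0 (real n)) x * f x" for n x
  have F: "integrable lborel (F n)" "square_integrable (F n)" for n
    unfolding F_def by (intro truncation_L1_L2 f)+
  have Fl: "(\<lambda>n. abs_l2 (F n)) \<longlonglongrightarrow> abs_l2 f"
    unfolding F_def by (rule filterlim_compose[OF truncation_tendsto[OF f] filterlim_real_sequentially])
  define G where "G n = convolve K (F n)" for n
  have Gi: "integrable lborel (G n)" for n unfolding G_def by (intro convolve_L1 K F)
  \<comment> \<open>Bounded and integrable, hence square integrable: |G|^2 is at most B |G|.\<close>
  have Gq: "square_integrable (G n)" for n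
  proof (rule square_integrableI)
    let ?B = "norm (abs_l2 K) * norm (abs_l2 (F n))"
    show [measurable]: "G n \<in> borel_measurable borel" using Gi[of n] by auto
    show "integrable lborel (\<lambda>x. (norm (G n x))^2)"
    proof (rule Bochner_Integration.integrable_bound[OF integrable_mult_right[OF Gi[of n], of ?B]])
      show "AE x in lborel. norm ((norm (G n x))^2) \<le> norm (?B * G n x)"
      proof (rule AE_I2)
        fix x
        have "\<bar>G n x\<bar> \<le> ?B" unfolding G_def by (rule convolve_L2(2)[OF K(2) F(2)])
        then have "\<bar>G n x\<bar> * \<bar>G n x\<bar> \<le> ?B * \<bar>G n x\<bar>" by (rule mult_right_mono) simp
        then show "norm ((norm (G n x))^2) \<le> norm (?B * G n x)" by (simp add: power2_eq_square abs_mult)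
      qed
    qed measurable
  qed
  have "fourier (abs_l2 (G n)) = mult_l2 a (fourier (abs_l2 (F n)))" for n
  proof -
    have "fourier (abs_l2 (G n)) = abs_l2 (\<lambda>p. a p *\<^sub>R fourier_int (F n) p)"
      unfolding fourier_abs_l2[OF Gi Gq]
      by (rule arg_cong[where f=abs_l2], rule ext) (simp add: G_def convolve_L1(2)[OF K(1) F(1) a])
    also have "\<dots> = mult_l2 a (abs_l2 (fourier_int (F n)))"
      by (rule mult_l2_abs[OF _ am ab, symmetric]) (rule plancherel_L1_L2[OF F])
    finally show ?thesis by (simp add: fourier_abs_l2[OF F])
  qed
  then have "(\<lambda>n. fourier (abs_l2 (G n))) \<longlonglongrightarrow> mult_l2 a (fourier (abs_l2 f))"
    by (simp add: bounded_linear.tendsto[OF bounded_linear_mult_l2[OF am ab]] bounded_linear.tendsto[OF bounded_linear_fourier Fl])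
  then obtain u where u: "(\<lambda>n. abs_l2 (G n)) \<longlonglongrightarrow> u" "fourier u = mult_l2 a (fourier (abs_l2 f))"
    by (rule fourier_range_closed)
  have "(\<lambda>n. G n x) \<longlonglongrightarrow> convolve K f x" for x
  proof (rule LIM_zero_cancel, rule Lim_null_comparison)
    have "(\<lambda>n. norm (abs_l2 K) * norm (abs_l2 (F n) - abs_l2 f)) \<longlonglongrightarrow> norm (abs_l2 K) * norm (abs_l2 f - abs_l2 f)"
      by (intro tendsto_intros Fl)
    then show "(\<lambda>n. norm (abs_l2 K) * norm (abs_l2 (F n) - abs_l2 f)) \<longlonglongrightarrow> 0" by simp
    show "\<forall>\<^sub>F n in sequentially. norm (G n x - convolve K f x) \<le> norm (abs_l2 K) * norm (abs_l2 (F n) - abs_l2 f)"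
    proof (intro always_eventually allI)
      fix n
      have "G n x - convolve K f x = convolve K (\<lambda>y. F n y - f y) x"
        unfolding G_def convolve_def right_diff_distrib
        by (rule Bochner_Integration.integral_diff[symmetric]) (intro convolve_L2 K F f)+
      then show "norm (G n x - convolve K f x) \<le> norm (abs_l2 K) * norm (abs_l2 (F n) - abs_l2 f)"
        using convolve_L2(2)[OF K(2) square_integrable_diff[OF F(2) f], of n x] by (simp add: abs_l2_diff F f)
    qed
  qed
  then have "AE x in lborel. (\<lambda>n. G n x) \<longlonglongrightarrow> convolve K f x" by simp
  from l2_limit_eq_AE_limit[OF Gq u(1) _ this] u(2)
  show "square_integrable (convolve K f)" "fourier (abs_l2 (convolve K f)) = mult_l2 a (fourier (abs_l2 f))"
    by auto
qed

subsection \<open>The resolvent kernel as a Laplace transform of heat kernels\<close>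

text \<open>The kernel of exp(t Laplace / 2m): the centred Gaussian density with variance t/m in
  each coordinate, arranged in the form of \<open>gaussian_fourier\<close>.\<close>

definition heat_kernel :: "real \<Rightarrow> real \<Rightarrow> R3 \<Rightarrow> real" where
  "heat_kernel m t x = (sqrt (m / t) / sqrt (2 * pi)) ^ 3 * exp (- (sqrt (m / t) * norm x)\<^sup>2 / 2)"

text \<open>For positive m and w this is the Yukawa potential m exp(- sqrt(2 m w) |x|) / (2 pi |x|).
  The Laplace transform reduces its properties to those of Gaussians.\<close>

definition res_kernel :: "real \<Rightarrow> real \<Rightarrow> R3 \<Rightarrow> real" where
  "res_kernel m w x = (LINT t|lborel. indicator {0<..} t * exp (- w * t) * heat_kernel m t x)"

lemma heat_kernel_measurable[measurable]:
  assumes [measurable]: "f \<in> borel_measurable M" "g \<in> borel_measurable M"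
  shows "(\<lambda>z. heat_kernel m (f z) (g z)) \<in> borel_measurable M"
  unfolding heat_kernel_def by measurable

lemma heat_kernel_nonneg: "m > 0 \<Longrightarrow> t > 0 \<Longrightarrow> 0 \<le> heat_kernel m t x"
  by (simp add: heat_kernel_def)

lemma heat_kernel_fourier:
  assumes m: "m > 0" and t: "t > 0"
  shows "integrable lborel (heat_kernel m t)"
    and "(LINT x|lborel. cis (y \<bullet> x) * complex_of_real (heat_kernel m t x)) =
      complex_of_real (exp (- t * ((norm y)^2 / (2 * m))))"
proof -
  let ?s = "sqrt (m / t)"
  have s: "?s > 0" using m t by simp
  show "integrable lborel (heat_kernel m t)"
    unfolding heat_kernel_def[abs_def] by (intro integrable_mult_right gaussian_L1[OF s])
  have "(LINT x|lborel. cis (y \<bullet> x) * complex_of_real (heat_kernel m t x)) =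
     (LINT x|lborel. complex_of_real ((?s / sqrt (2 * pi)) ^ 3) * (cis (y \<bullet> x) * complex_of_real (exp (- (?s * norm x)\<^sup>2 / 2))))"
    unfolding heat_kernel_def by (simp only: of_real_mult mult_ac)
  also have "\<dots> = complex_of_real ((?s / sqrt (2 * pi)) ^ 3) *
      complex_of_real ((sqrt (2 * pi) / ?s) ^ 3 * exp (- (norm y / ?s)\<^sup>2 / 2))"
    by (simp only: integral_mult_right_zero gaussian_fourier(2)[OF s] DIM_R3)
  also have "\<dots> = complex_of_real (((?s / sqrt (2 * pi)) * (sqrt (2 * pi) / ?s)) ^ 3 * exp (- (norm y / ?s)\<^sup>2 / 2))"
    by (simp only: of_real_mult[symmetric] power_mult_distrib mult_ac)
  also have "(?s / sqrt (2 * pi)) * (sqrt (2 * pi) / ?s) = 1" using m t by simp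
  also have "- (norm y / ?s)\<^sup>2 / 2 = - t * ((norm y)^2 / (2 * m))"
    using m t by (simp add: power_divide mult.commute)
  finally show "(LINT x|lborel. cis (y \<bullet> x) * complex_of_real (heat_kernel m t x)) =
      complex_of_real (exp (- t * ((norm y)^2 / (2 * m))))" by simp
qed

lemma heat_kernel_mass:
  assumes "m > 0" "t > 0"
  shows "(LINT x|lborel. heat_kernel m t x) = 1"
  using heat_kernel_fourier(2)[OF assms, of 0] by (simp add: integral_complex_of_real)

lemma exp_integral:
  fixes c :: real
  assumes c: "c > 0"
  shows "has_bochner_integral lborel (\<lambda>t. indicator {0<..} t * exp (- c * t)) (1 / c)"
proof (rule has_bochner_integral_nn_integral)
  have "((\<lambda>t. exp (- c * t)) has_integral 1 / c) {0..}"
    using has_integral_exp_minus_to_infinity[OF c, of 0] by simp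
  then have "((\<lambda>t. if t \<in> {0..} then exp (- c * t) else 0) has_integral 1 / c) UNIV"
    by (simp only: has_integral_restrict_UNIV)
  then have "((\<lambda>t. indicator {0<..} t * exp (- c * t)) has_integral 1 / c) UNIV"
    by (rule has_integral_spike[of "{0}", rotated 2]) (auto simp: indicator_def)
  then show "(\<integral>\<^sup>+ t. ennreal (indicator {0<..} t * exp (- c * t)) \<partial>lborel) = ennreal (1 / c)"
    by (rule nn_integral_has_integral_lborel[rotated 2]) auto
qed (use c in auto)

text \<open>The value is Gamma(1/4) / c^(1/4): the complex Gamma integral converges absolutely, and
  its modulus is this integrand.\<close>

lemma gamma_integral_finite:
  fixes c :: real
  assumes c: "c > 0"
  shows "(\<integral>\<^sup>+ t. ennreal (indicator {0<..} t * (exp (- c * t) * t powr (- 3 / 4))) \<partial>lborel) < \<infinity>"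
proof -
  have "(\<lambda>t. complex_of_real t powr (1 / 4 - 1) / of_real (exp (c * t))) absolutely_integrable_on {0<..}"
    by (rule absolutely_integrable_Gamma_integral) (use c in auto)
  then have "(\<lambda>t. norm (complex_of_real t powr (1 / 4 - 1) / of_real (exp (c * t)))) absolutely_integrable_on {0<..}"
    by (rule absolutely_integrable_norm[unfolded o_def])
  then have "integrable lebesgue (\<lambda>t. indicator {0<..} t *\<^sub>R norm (complex_of_real t powr (1 / 4 - 1) / of_real (exp (c * t))))"
    by (simp add: set_integrable_def)
  also have "(\<lambda>t. indicator {0<..} t *\<^sub>R norm (complex_of_real t powr (1 / 4 - 1) / of_real (exp (c * t)))) =
      (\<lambda>t. indicator {0<..} t * (exp (- c * t) * t powr (- 3 / 4)))"
    by (auto simp: fun_eq_iff indicator_def norm_divide norm_powr_real_powr exp_minus field_simps)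
  finally have "integrable lborel (\<lambda>t. indicator {0<..} t * (exp (- c * t) * t powr (- 3 / 4)))"
    by (subst (asm) integrable_completion) measurable
  then show ?thesis
    by (subst nn_integral_eq_integral) auto
qed

text \<open>Heat kernels have mass one, so the double integral of the modulus is that of exp(- w t).
  Exchanging the integrals leaves the Laplace transform of exp(- t P), which is 1 / (P + w).\<close>

lemma res_kernel_L1:
  assumes m: "m > 0" and w: "w > 0"
  shows "integrable lborel (res_kernel m w)"
    and "(LINT x|lborel. cis (- (p \<bullet> x)) * of_real (res_kernel m w x)) =
      complex_of_real (1 / (P_inf m p + w))"
proof -
  let ?e = "\<lambda>t. indicator {0<..} t * exp (- w * t) :: real"
  let ?H = "\<lambda>p t x. complex_of_real (?e t) * (cis (- (p \<bullet> x)) * of_real (heat_kernel m t x))"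
  have int: "integrable (lborel \<Otimes>\<^sub>M lborel) (\<lambda>(t, x). ?H p t x)" for p
  proof (rule lborel_pair.Fubini_integrable)
    show "(\<lambda>(t, x). ?H p t x) \<in> borel_measurable (lborel \<Otimes>\<^sub>M lborel)"
      by (rule borel_pair_measurable_lborel) measurable
    have "(LINT x|lborel. norm (?H p t x)) = ?e t" for t
    proof (cases "t > 0")
      case True
      then have "(LINT x|lborel. norm (?H p t x)) = (LINT x|lborel. ?e t * heat_kernel m t x)"
        using heat_kernel_nonneg[OF m True] by (simp add: norm_mult)
      then show ?thesis using heat_kernel_mass[OF m True] by simp
    qed simp
    then show "integrable lborel (\<lambda>t. LINT x|lborel. norm (case (t, x) of (t, x) \<Rightarrow> ?H p t x))"
      using exp_integral[OF w] by (simp add: has_bochner_integral_iff)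
    have "integrable lborel (\<lambda>x. ?H p t x)" for t
    proof (cases "t > 0")
      case True
      then show ?thesis
        using heat_kernel_fourier(1)[OF m True] by (intro integrable_mult_right integrable_cis_mult) auto
    qed simp
    then show "AE t in lborel. integrable lborel (\<lambda>x. case (t, x) of (t, x) \<Rightarrow> ?H p t x)" by simp
  qed
  have H: "(LINT t|lborel. ?H p t x) = cis (- (p \<bullet> x)) * of_real (res_kernel m w x)" for p x
  proof -
    have "?H p t x = cis (- (p \<bullet> x)) * of_real (?e t * heat_kernel m t x)" for t by simp
    then show ?thesis
      by (simp only: integral_mult_right_zero integral_complex_of_real res_kernel_def)
  qed
  have "integrable lborel (\<lambda>x. LINT t|lborel. ?H 0 t x)"
    using lborel_pair.integrable_fst'[OF lborel_pair.integrable_product_swap[OF int[of 0]]] by simp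
  then have "integrable lborel (\<lambda>x. complex_of_real (res_kernel m w x))" unfolding H by simp
  then show "integrable lborel (res_kernel m w)" by (simp add: complex_of_real_integrable_eq)
  have "(LINT x|lborel. cis (- (p \<bullet> x)) * of_real (res_kernel m w x)) = (LINT x|lborel. LINT t|lborel. ?H p t x)"
    unfolding H ..
  also have "\<dots> = (LINT t|lborel. LINT x|lborel. ?H p t x)"
    by (rule lborel_pair.Fubini_integral[OF int])
  also have "\<dots> = (LINT t|lborel. complex_of_real (indicator {0<..} t * exp (- (P_inf m p + w) * t)))"
  proof (intro Bochner_Integration.integral_cong refl)
    fix t :: real
    show "(LINT x|lborel. ?H p t x) = complex_of_real (indicator {0<..} t * exp (- (P_inf m p + w) * t))"
    proof (cases "t > 0")
      case True
      have "(LINT x|lborel. ?H p t x) = complex_of_real (?e t) * complex_of_real (exp (- t * ((norm (- p))^2 / (2 * m))))"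
        unfolding integral_mult_right_zero by (subst heat_kernel_fourier(2)[OF m True, symmetric]) simp
      also have "\<dots> = complex_of_real (indicator {0<..} t * exp (- (P_inf m p + w) * t))"
        using True by (simp add: P_inf_def algebra_simps flip: of_real_mult exp_add)
      finally show ?thesis .
    qed simp
  qed
  also have "\<dots> = complex_of_real (1 / (P_inf m p + w))"
  proof -
    have "P_inf m p + w > 0" using m w by (simp add: P_inf_def add_nonneg_pos)
    from exp_integral[OF this] show ?thesis
      unfolding integral_complex_of_real has_bochner_integral_iff by simp
  qed
  finally show "(LINT x|lborel. cis (- (p \<bullet> x)) * of_real (res_kernel m w x)) =
      complex_of_real (1 / (P_inf m p + w))" .
qed

text \<open>The square of a Gaussian is a Gaussian narrower by sqrt 2. The power t^(-3/2) reflects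
  the dimension and decides that the resolvent kernel lies in L2.\<close>

lemma heat_kernel_sq:
  assumes m: "m > 0" and t: "t > 0"
  shows "(\<integral>\<^sup>+ x. ennreal ((heat_kernel m t x)^2) \<partial>lborel) = ennreal (m powr (3 / 2) / (sqrt (2 * pi) * sqrt 2) ^ 3 * t powr (- 3 / 2))"
proof -
  let ?s = "sqrt (m / t)"
  have s: "?s > 0" "sqrt 2 * ?s > 0" using m t by auto
  have e: "(heat_kernel m t x)^2 = (?s / sqrt (2 * pi)) ^ 6 * exp (- (sqrt 2 * ?s * norm x)\<^sup>2 / 2)" for x
    by (simp add: heat_kernel_def power_mult_distrib exp_double[symmetric] flip: power_mult)
  have "complex_of_real (LINT x|(lborel::R3 measure). exp (- (sqrt 2 * ?s * norm x)\<^sup>2 / 2)) = complex_of_real ((sqrt (2 * pi) / (sqrt 2 * ?s)) ^ 3)"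
    using gaussian_fourier(2)[OF s(2), of "0::R3"] by simp
  then have g: "(LINT x|(lborel::R3 measure). exp (- (sqrt 2 * ?s * norm x)\<^sup>2 / 2)) = (sqrt (2 * pi) / (sqrt 2 * ?s)) ^ 3"
    unfolding of_real_eq_iff .
  have "(\<integral>\<^sup>+ x. ennreal ((heat_kernel m t x)^2) \<partial>lborel) = ennreal ((?s / sqrt (2 * pi)) ^ 6 * (sqrt (2 * pi) / (sqrt 2 * ?s)) ^ 3)"
    unfolding e using gaussian_L1[OF s(2)]
    by (subst nn_integral_eq_integral) (simp_all only: integrable_mult_right integral_mult_right_zero g, simp)
  also have "(?s / sqrt (2 * pi)) ^ 6 * (sqrt (2 * pi) / (sqrt 2 * ?s)) ^ 3 = ?s ^ 3 / (sqrt (2 * pi) * sqrt 2) ^ 3"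
  proof -
    have *: "(a / b) ^ 6 * (b / (d * a)) ^ 3 = a ^ 3 / (b * d) ^ 3" if "a > 0" "b > 0" "d > 0" for a b d :: real
      using that by (simp add: field_simps power_mult_distrib eval_nat_numeral)
    show ?thesis by (rule *) (use s in auto)
  qed
  also have "?s ^ 3 = m powr (3 / 2) * t powr (- 3 / 2)"
  proof -
    have "?s ^ 3 = (m / t) powr (3 / 2)"
      using m t by (simp add: powr_half_sqrt[symmetric] powr_powr flip: powr_realpow)
    then show ?thesis using m t by (simp add: powr_divide powr_minus_divide)
  qed
  finally show ?thesis by simp
qed

text \<open>Cauchy-Schwarz in t, with exp(- w t) split into exp(- w t / 2) t^(-3/8) and exp(- w t /
  2) t^(3/8). The exponent 3/8 is chosen so that the square of the first factor and, after
  integration of the squared heat kernel in x, that of the second both carry the weight exp(- w t)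
  t^(-3/4). One Gamma integral \<open>?A\<close> then controls both.\<close>

lemma res_kernel_L2:
  assumes m: "m > 0" and w: "w > 0"
  shows "square_integrable (res_kernel m w)"
proof (rule square_integrableI)
  show [measurable]: "res_kernel m w \<in> borel_measurable borel"
    using res_kernel_L1(1)[OF m w] by auto
  let ?D = "m powr (3 / 2) / (sqrt (2 * pi) * sqrt 2) ^ 3"
  let ?a = "\<lambda>t. exp (- w * t) * t powr (- 3 / 4)" and ?b = "\<lambda>t. exp (- w * t / 2) * t powr (3 / 8)"
  let ?k = "\<lambda>t x. indicator {0<..} t * exp (- w * t) * heat_kernel m t x :: real"
  let ?f = "\<lambda>t. indicator {0<..} t * (exp (- w * t / 2) * t powr (- 3 / 8)) :: real"
  let ?g = "\<lambda>t x. indicator {0<..} t * ?b t * heat_kernel m t x :: real"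
  let ?A = "\<integral>\<^sup>+ t. ennreal (indicator {0<..} t * ?a t) \<partial>lborel"
  let ?G = "\<lambda>x. \<integral>\<^sup>+ t. (ennreal (?g t x))^2 \<partial>lborel"
  have A: "?A < \<infinity>" by (rule gamma_integral_finite[OF w])
  have D: "?D \<ge> 0" by simp
  have fA: "(\<integral>\<^sup>+ t. (ennreal (?f t))^2 \<partial>lborel) = ?A"
  proof (intro nn_integral_cong)
    fix t :: real
    have "(exp (- w * t / 2))^2 = exp (- w * t)" by (simp flip: exp_double)
    moreover have "(t powr (- 3 / 8))^2 = t powr (- 3 / 4)" if "t > 0"
      using that by (simp add: power2_eq_square flip: powr_add)
    ultimately show "(ennreal (?f t))^2 = ennreal (indicator {0<..} t * ?a t)"
      by (cases "t > 0") (simp_all add: ennreal_power power_mult_distrib)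
  qed
  have K: "(ennreal (norm (res_kernel m w x)))^2 \<le> ?A * ?G x" for x
  proof -
    \<comment> \<open>If the integrand is not integrable in t, the integral is 0 by convention and
      the bound is trivial.\<close>
    have "ennreal (norm (res_kernel m w x)) \<le> (\<integral>\<^sup>+ t. norm (?k t x) \<partial>lborel)"
    proof (cases "integrable lborel (\<lambda>t. ?k t x)")
      case True
      then show ?thesis unfolding res_kernel_def by (rule integral_norm_bound_ennreal)
    next
      case False
      then show ?thesis by (simp add: res_kernel_def not_integrable_integral_eq)
    qed
    also have "\<dots> = (\<integral>\<^sup>+ t. ennreal (?f t) * ennreal (?g t x) \<partial>lborel)"
    proof (intro nn_integral_cong)
      fix t :: real
      show "ennreal (norm (?k t x)) = ennreal (?f t) * ennreal (?g t x)"
      proof (cases "t > 0")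
        case True
        have "exp (- w * t) = exp (- w * t / 2) * exp (- w * t / 2)" by (simp flip: exp_add)
        moreover have "t powr (- 3 / 8) * t powr (3 / 8) = 1" using True by (simp flip: powr_add)
        ultimately have "norm (?k t x) = ?f t * ?g t x"
          using True heat_kernel_nonneg[OF m True, of x] by (simp add: abs_mult mult_ac)
        then show ?thesis using True by (simp add: ennreal_mult')
      qed simp
    qed
    finally have "(ennreal (norm (res_kernel m w x)))^2 \<le> (\<integral>\<^sup>+ t. ennreal (?f t) * ennreal (?g t x) \<partial>lborel)^2"
      by (intro power_mono) auto
    also have "\<dots> \<le> (\<integral>\<^sup>+ t. (ennreal (?f t))^2 \<partial>lborel) * ?G x"
      by (rule Cauchy_Schwarz_nn_integral) measurable
    finally show ?thesis unfolding fA .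
  qed
  have inner: "(\<integral>\<^sup>+ x. (ennreal (?g t x))^2 \<partial>lborel) = ennreal ?D * ennreal (indicator {0<..} t * ?a t)" for t
  proof (cases "t > 0")
    case True
    have "(\<integral>\<^sup>+ x. (ennreal (?g t x))^2 \<partial>lborel) = (\<integral>\<^sup>+ x. ennreal ((?b t)^2) * ennreal ((heat_kernel m t x)^2) \<partial>lborel)"
      using True heat_kernel_nonneg[OF m True]
      by (intro nn_integral_cong) (simp add: ennreal_power power_mult_distrib ennreal_mult)
    also have "\<dots> = ennreal ((?b t)^2) * ennreal (?D * t powr (- 3 / 2))"
      by (subst nn_integral_cmult) (simp_all add: heat_kernel_sq[OF m True])
    also have "\<dots> = ennreal (?D * ?a t)"
    proof -
      have "(exp (- w * t / 2))^2 = exp (- w * t)" by (simp flip: exp_double)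
      moreover have "(t powr (3 / 8))^2 * t powr (- 3 / 2) = t powr (- 3 / 4)"
        using True by (simp add: power2_eq_square flip: powr_add)
      ultimately have "(?b t)^2 * (?D * t powr (- 3 / 2)) = ?D * ?a t"
        by (simp add: power_mult_distrib)
      then show ?thesis by (simp flip: ennreal_mult)
    qed
    also have "\<dots> = ennreal ?D * ennreal (?a t)"
      by (rule ennreal_mult'[OF D])
    finally show ?thesis using True by simp
  qed simp
  have "(\<integral>\<^sup>+ x. ennreal ((norm (res_kernel m w x))^2) \<partial>lborel) \<le> (\<integral>\<^sup>+ x. ?A * ?G x \<partial>lborel)"
    using K by (intro nn_integral_mono) (simp add: ennreal_power)
  also have "\<dots> = ?A * (\<integral>\<^sup>+ x. ?G x \<partial>lborel)"
    by (rule nn_integral_cmult) measurable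
  also have "(\<integral>\<^sup>+ x. ?G x \<partial>lborel) = (\<integral>\<^sup>+ t. (\<integral>\<^sup>+ x. (ennreal (?g t x))^2 \<partial>lborel) \<partial>lborel)"
  proof (rule lborel_pair.Fubini')
    show "(\<lambda>(t, x). (ennreal (?g t x))^2) \<in> borel_measurable (lborel \<Otimes>\<^sub>M lborel)"
      by (subst measurable_cong_sets[OF sets_pair_measure_cong[OF sets_lborel sets_lborel] refl]) measurable
  qed
  also have "\<dots> = ennreal ?D * ?A"
    unfolding inner by (rule nn_integral_cmult) measurable
  also have "?A * (ennreal ?D * ?A) < \<infinity>"
    using A unfolding infinity_ennreal_def by (intro ennreal_mult_less_top[THEN iffD2] conjI disjI2) auto
  finally show "integrable lborel (\<lambda>x. (norm (res_kernel m w x))^2)"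
    by (intro integrableI_nonneg) auto
qed

subsection \<open>The resolvent of the Laplacian\<close>

abbreviation "P_op m \<equiv> fourier_multiplier (P_inf m)"
abbreviation "H2 \<equiv> sobolev 2"
abbreviation "H2r \<equiv> radial_sobolev 2"
abbreviation "norm_H2 \<equiv> sobolev_norm 2"

lemma P_inf_measurable[measurable]: "P_inf m \<in> borel_measurable borel"
  unfolding P_inf_def[abs_def] by measurable

lemma P_inf_nonneg: "m > 0 \<Longrightarrow> 0 \<le> P_inf m p"
  by (simp add: P_inf_def)

lemma sobolev_iff: "u \<in> sobolev s \<longleftrightarrow> fourier u \<in> mult_domain (weight s)"
  by (simp add: sobolev_def has_fourier_iff)

lemma weight_0: "weight 0 = (\<lambda>p. 1)"
  by (auto simp: weight_def fun_eq_iff add_nonneg_eq_0_iff)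

lemma weight_2: "weight 2 p = 1 + (norm p)^2"
  by (simp add: weight_def add_nonneg_nonneg)

lemma sobolev_0: "u \<in> sobolev 0" "sobolev_norm 0 u = norm u"
  by (simp_all add: sobolev_iff sobolev_norm_def weight_0 mult_l2_one norm_fourier)

text \<open>The symbol is at most the weight divided by |2m|, pointwise; for m = 0 both sides
  vanish, since division by zero gives zero.\<close>

lemma sobolev_2_imp:
  assumes "u \<in> H2"
  shows "fourier u \<in> mult_domain (P_inf m)" "norm (mult_l2 (P_inf m) (fourier u)) \<le> 1 / \<bar>2 * m\<bar> * norm_H2 u"
    and "norm u \<le> norm_H2 u"
proof -
  have u: "fourier u \<in> mult_domain (weight 2)" using assms by (simp add: sobolev_iff)
  have b: "\<bar>P_inf m p\<bar> \<le> 1 / \<bar>2 * m\<bar> * \<bar>weight 2 p\<bar>" for p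
    by (simp add: P_inf_def weight_2 abs_mult abs_divide divide_right_mono)
  show "fourier u \<in> mult_domain (P_inf m)" "norm (mult_l2 (P_inf m) (fourier u)) \<le> 1 / \<bar>2 * m\<bar> * norm_H2 u"
    unfolding sobolev_norm_def by (intro mult_l2_bounded[OF _ b _ u] P_inf_measurable; simp)+
  have "norm (mult_l2 (\<lambda>p. 1) (fourier u)) \<le> 1 * norm (mult_l2 (weight 2) (fourier u))"
    by (rule mult_l2_bounded[OF _ _ _ u]) (simp_all add: weight_2)
  then show "norm u \<le> norm_H2 u" by (simp add: mult_l2_one sobolev_norm_def norm_fourier)
qed

text \<open>A concrete form of the resolvent: real by construction, radial by rotation invariance,
  with bounded values by Cauchy-Schwarz. \<open>resolvent_eq_res\<close> identifies it with the
  operator of the statement.\<close>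

definition res :: "real \<Rightarrow> real \<Rightarrow> real l2 \<Rightarrow> real l2" where
  "res m w u = abs_l2 (convolve (res_kernel m w) (rep_l2 u))"

context
  fixes m :: real
  assumes m: "m > 0"
begin

lemma symbol_pos: "w > 0 \<Longrightarrow> P_inf m p + w > 0"
  using P_inf_nonneg[OF m, of p] by linarith

lemma square_integrable_res:
  assumes w: "w > 0"
  shows "square_integrable (convolve (res_kernel m w) (rep_l2 u))"
  using fourier_convolve(1)[OF res_kernel_L1(1)[OF m w] res_kernel_L2[OF m w] square_integrable_rep _ res_kernel_L1(2)[OF m w], of u]
  by measurable

lemma fourier_res:
  assumes w: "w > 0"
  shows "fourier (res m w u) = mult_l2 (\<lambda>p. 1 / (P_inf m p + w)) (fourier u)"
proof -
  have "(\<lambda>p. 1 / (P_inf m p + w)) \<in> borel_measurable borel" by measurable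
  from fourier_convolve(2)[OF res_kernel_L1(1)[OF m w] res_kernel_L2[OF m w] square_integrable_rep this res_kernel_L1(2)[OF m w], of u]
  show ?thesis by (simp add: res_def abs_rep_l2)
qed

text \<open>The bounds involve w only through a lower bound w0, because the derivative in w needs
  them uniformly near the given multiplier. The last one writes the weight as 1 + 2 m P.\<close>

lemma symbol_bounds:
  assumes w0: "w0 > 0" and w: "w0 \<le> w"
  shows "\<bar>1 / (P_inf m p + w)\<bar> \<le> 1 / w0" "\<bar>P_inf m p / (P_inf m p + w)\<bar> \<le> 1"
    "\<bar>weight 2 p / (P_inf m p + w)\<bar> \<le> 2 * m + 1 / w0"
proof -
  have P: "0 \<le> P_inf m p" by (rule P_inf_nonneg[OF m])
  have p: "P_inf m p + w > 0" using P w0 w by linarith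
  show "\<bar>1 / (P_inf m p + w)\<bar> \<le> 1 / w0" using P p w0 w by (simp add: frac_le)
  show "\<bar>P_inf m p / (P_inf m p + w)\<bar> \<le> 1" using P p w0 w by simp
  have "weight 2 p = 1 + 2 * m * P_inf m p" using m by (simp add: weight_2 P_inf_def)
  also have "\<dots> \<le> (P_inf m p + w) / w0 + 2 * m * (P_inf m p + w)"
    using P w0 w m by (intro add_mono mult_left_mono) (auto simp: le_divide_eq)
  also have "\<dots> = (2 * m + 1 / w0) * (P_inf m p + w)" by (simp add: algebra_simps add_divide_distrib)
  finally have "weight 2 p \<le> (2 * m + 1 / w0) * (P_inf m p + w)" .
  then show "\<bar>weight 2 p / (P_inf m p + w)\<bar> \<le> 2 * m + 1 / w0"
    using p weight_pos[of 2 p] by (simp add: divide_le_eq)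
qed

lemma norm_res_le:
  assumes w: "w > 0"
  shows "norm (res m w u) \<le> norm u / w"
  using mult_l2_bounded_symbol(2)[of "\<lambda>p. 1 / (P_inf m p + w)" "1 / w" "fourier u"]
    symbol_bounds(1)[OF w order_refl]
  by (simp add: fourier_res[OF w, symmetric] norm_fourier)

lemma res_sobolev:
  assumes w0: "w0 > 0" and w: "w0 \<le> w"
  shows "res m w u \<in> H2" "norm_H2 (res m w u) \<le> (2 * m + 1 / w0) * norm u"
proof -
  have w': "w > 0" using w0 w by simp
  have b: "\<bar>weight 2 p * (1 / (P_inf m p + w))\<bar> \<le> 2 * m + 1 / w0" for p
    using symbol_bounds(3)[OF w0 w] by simp
  have mm: "(\<lambda>p. weight 2 p * (1 / (P_inf m p + w))) \<in> borel_measurable borel" by measurable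
  note * = mult_l2_mult[OF weight_measurable _ mult_l2_bounded_symbol(1)[OF _ symbol_bounds(1)[OF w0 w]] mult_l2_bounded_symbol(1)[OF mm b], of "fourier u"]
  show "res m w u \<in> H2" unfolding sobolev_iff fourier_res[OF w'] by (rule *(1)) measurable
  have "mult_l2 (weight 2) (fourier (res m w u)) = mult_l2 (\<lambda>p. weight 2 p * (1 / (P_inf m p + w))) (fourier u)"
    unfolding fourier_res[OF w'] by (rule *(2)) measurable
  then show "norm_H2 (res m w u) \<le> (2 * m + 1 / w0) * norm u"
    using mult_l2_bounded_symbol(2)[OF mm b, of "fourier u"] by (simp add: sobolev_norm_def norm_fourier)
qed

text \<open>P / (P + w) = 1 - w / (P + w). Stated on the Fourier side, as it is what shows the left
  side to be the transform of a real function, which \<open>P_op\<close> presupposes.\<close>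

lemma res_right_inverse:
  assumes w: "w > 0"
  shows "mult_l2 (P_inf m) (fourier (res m w u)) = fourier (u - w *\<^sub>R res m w u)"
proof -
  let ?a = "\<lambda>p. 1 / (P_inf m p + w)"
  have am: "?a \<in> borel_measurable borel" by measurable
  have d: "fourier u \<in> mult_domain ?a" by (rule mult_l2_bounded_symbol(1)[OF am symbol_bounds(1)[OF w order_refl]])
  have p: "P_inf m p * ?a p = 1 + (- w) * ?a p" for p
    using symbol_pos[OF w, of p] by (simp add: field_simps)
  have s: "fourier u \<in> mult_domain (\<lambda>p. 1 + (- w) * ?a p)"
    by (rule mult_l2_add_symbol[OF mult_l2_one(1) mult_l2_scale_symbol(1)[OF d]])
  have "mult_l2 (P_inf m) (mult_l2 ?a (fourier u)) = mult_l2 (\<lambda>p. P_inf m p * ?a p) (fourier u)"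
    by (rule mult_l2_mult[OF P_inf_measurable am d]) (unfold p, rule s)
  also have "\<dots> = fourier u + (- w) *\<^sub>R mult_l2 ?a (fourier u)"
    unfolding p by (simp only: mult_l2_add_symbol(2)[OF mult_l2_one(1) mult_l2_scale_symbol(1)[OF d]] mult_l2_one mult_l2_scale_symbol(2)[OF d])
  finally show ?thesis by (simp add: fourier_res[OF w] fourier_diff fourier_scaleR)
qed

text \<open>The image of the real functions under the Fourier transform is closed, so P(D) g is obtained as
  the limit of its Yosida approximations.\<close>

lemma fourier_multiplier_P_inf:
  assumes g: "fourier g \<in> mult_domain (P_inf m)"
  shows "fourier (P_op m g) = mult_l2 (P_inf m) (fourier g)"
proof -
  define w where "w n = real (Suc n)" for n
  have w: "w n > 0" for n by (simp add: w_def)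
  \<comment> \<open>Yosida approximation: h is real by construction, and its symbol w P / (P + w) is
    at most P and tends to P as w grows.\<close>
  define h where "h n = w n *\<^sub>R (g - w n *\<^sub>R res m (w n) g)" for n
  let ?a = "\<lambda>n p. 1 / (P_inf m p + w n)"
  let ?f = "\<lambda>n p. (w n * (P_inf m p * ?a n p)) *\<^sub>R rep_l2 (fourier g) p"
  let ?G = "\<lambda>p. P_inf m p *\<^sub>R rep_l2 (fourier g) p"
  have Gq: "square_integrable ?G" using g by (simp add: mult_domain_def)
  have pos: "P_inf m p + w n > 0" for n p by (rule symbol_pos[OF w])
  have h: "fourier (h n) = abs_l2 (?f n)" for n
  proof -
    have am: "?a n \<in> borel_measurable borel" by measurable
    have pm: "(\<lambda>p. P_inf m p * ?a n p) \<in> borel_measurable borel" by measurable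
    have d: "fourier g \<in> mult_domain (?a n)" by (rule mult_l2_bounded_symbol(1)[OF am symbol_bounds(1)[OF w order_refl]])
    have d2: "fourier g \<in> mult_domain (\<lambda>p. P_inf m p * ?a n p)"
      by (rule mult_l2_bounded_symbol(1)[OF pm, of 1]) (use symbol_bounds(2)[OF w order_refl] in simp)
    have "fourier (h n) = w n *\<^sub>R mult_l2 (P_inf m) (mult_l2 (?a n) (fourier g))"
      unfolding h_def fourier_scaleR res_right_inverse[OF w, symmetric] fourier_res[OF w] ..
    also have "mult_l2 (P_inf m) (mult_l2 (?a n) (fourier g)) = mult_l2 (\<lambda>p. P_inf m p * ?a n p) (fourier g)"
      by (rule mult_l2_mult[OF P_inf_measurable am d d2])
    also have "w n *\<^sub>R \<dots> = mult_l2 (\<lambda>p. w n * (P_inf m p * ?a n p)) (fourier g)"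
      by (rule mult_l2_scale_symbol(2)[OF d2, symmetric])
    finally show ?thesis by (simp add: mult_l2_def)
  qed
  have "(\<lambda>n. abs_l2 (?f n)) \<longlonglongrightarrow> abs_l2 ?G"
  proof (rule l2_dominated_convergence(3)[OF _ _ square_integrable_of_norm[OF Gq]])
    show "AE p in lborel. norm (?f n p) \<le> norm (?G p)" for n
    proof (rule AE_I2)
      fix p :: R3
      have "\<bar>w n * (P_inf m p * ?a n p)\<bar> \<le> \<bar>P_inf m p\<bar>"
      proof -
        have "w n * ?a n p \<le> 1" using pos[of p n] P_inf_nonneg[OF m, of p] by simp
        moreover have "0 \<le> w n * ?a n p" using pos[of p n] w[of n] by simp
        ultimately have "\<bar>w n * ?a n p\<bar> \<le> 1" by linarith
        then have "\<bar>P_inf m p\<bar> * \<bar>w n * ?a n p\<bar> \<le> \<bar>P_inf m p\<bar> * 1"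
          by (rule mult_left_mono) simp
        then show ?thesis by (simp add: abs_mult mult_ac)
      qed
      then show "norm (?f n p) \<le> norm (?G p)" unfolding norm_scaleR by (rule mult_right_mono) simp
    qed
    show "AE p in lborel. (\<lambda>n. ?f n p) \<longlonglongrightarrow> ?G p"
    proof (intro AE_I2 tendsto_scaleR tendsto_const)
      fix p :: R3
      have "(\<lambda>n. 1 - P_inf m p * ?a n p) \<longlonglongrightarrow> 1 - P_inf m p * 0"
      proof (intro tendsto_intros)
        have "filterlim (\<lambda>n. P_inf m p + w n) at_top sequentially"
          unfolding w_def by (intro filterlim_tendsto_add_at_top[OF tendsto_const] filterlim_compose[OF filterlim_real_sequentially filterlim_Suc])
        then show "(\<lambda>n. ?a n p) \<longlonglongrightarrow> 0"
          using tendsto_inverse_0_at_top by (auto simp: divide_inverse)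
      qed
      then have "(\<lambda>n. P_inf m p * (1 - P_inf m p * ?a n p)) \<longlonglongrightarrow> P_inf m p * 1"
        by (intro tendsto_mult tendsto_const) simp
      moreover have "P_inf m p * (1 - P_inf m p * ?a n p) = w n * (P_inf m p * ?a n p)" for n
        using pos[of p n] by (simp add: field_simps)
      ultimately show "(\<lambda>n. w n * (P_inf m p * ?a n p)) \<longlonglongrightarrow> P_inf m p" by simp
    qed
  qed measurable
  then have "(\<lambda>n. fourier (h n)) \<longlonglongrightarrow> mult_l2 (P_inf m) (fourier g)" unfolding h mult_l2_def .
  then obtain u where u: "fourier u = mult_l2 (P_inf m) (fourier g)" by (rule fourier_range_closed)
  have "P_op m g = u"
    unfolding fourier_multiplier_def by (rule the_equality) (auto simp: has_fourier_iff u[symmetric] fourier_inject)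
  then show ?thesis by (simp add: u)
qed

text \<open>Proved on the whole domain of P, over which the uniqueness in the description defining
  \<open>resolvent\<close> ranges.\<close>

lemma res_left_inverse_domain:
  assumes w: "w > 0" and d: "fourier g \<in> mult_domain (P_inf m)"
  shows "res m w (P_op m g + w *\<^sub>R g) = g"
proof -
  let ?a = "\<lambda>p. 1 / (P_inf m p + w)"
  have am: "?a \<in> borel_measurable borel" by measurable
  let ?u = "P_op m g + w *\<^sub>R g"
  have "fourier ?u = mult_l2 (P_inf m) (fourier g) + mult_l2 (\<lambda>p. w) (fourier g)"
    by (simp add: fourier_add fourier_scaleR fourier_multiplier_P_inf[OF d] mult_l2_const)
  also have "\<dots> = mult_l2 (\<lambda>p. P_inf m p + w) (fourier g)"
    by (intro mult_l2_add_symbol(2)[symmetric] mult_l2_const d)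
  finally have e: "fourier ?u = mult_l2 (\<lambda>p. P_inf m p + w) (fourier g)" .
  have one: "?a p * (P_inf m p + w) = 1" for p using symbol_pos[OF w, of p] by simp
  have "fourier (res m w ?u) = mult_l2 (\<lambda>p. ?a p * (P_inf m p + w)) (fourier g)"
    unfolding fourier_res[OF w] e
    by (rule mult_l2_mult(2)[OF am]) (simp_all only: one mult_l2_one mult_l2_add_symbol(1) mult_l2_const d, measurable)
  then show ?thesis unfolding one mult_l2_one fourier_inject .
qed

lemmas res_left_inverse = res_left_inverse_domain[OF _ sobolev_2_imp(1)]

lemma res_solves:
  assumes w: "w > 0"
  shows "P_op m (res m w u) + w *\<^sub>R res m w u = u"
proof -
  have d: "fourier (res m w u) \<in> mult_domain (P_inf m)"
    by (rule sobolev_2_imp(1)[OF res_sobolev(1)[OF w order_refl]])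
  have "fourier (P_op m (res m w u)) = fourier (u - w *\<^sub>R res m w u)"
    unfolding fourier_multiplier_P_inf[OF d] by (rule res_right_inverse[OF w])
  then show ?thesis by (simp add: fourier_inject)
qed

lemma resolvent_eq_res:
  assumes w: "w > 0"
  shows "R_op m 0 w u = res m w u"
  unfolding resolvent_def P_symbol_def if_P[OF refl]
  by (rule the_equality)
    (use res_solves[OF w, of u] sobolev_2_imp(1)[OF res_sobolev(1)[OF w order_refl]] res_left_inverse_domain[OF w] in auto)

lemma res_add:
  assumes w: "w > 0"
  shows "res m w (u + v) = res m w u + res m w v"
proof -
  have "(\<lambda>p. 1 / (P_inf m p + w)) \<in> borel_measurable borel" by measurable
  from mult_add(2)[OF this mult_l2_bounded_symbol(1) mult_l2_bounded_symbol(1), OF this symbol_bounds(1)[OF w order_refl] this symbol_bounds(1)[OF w order_refl]]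
  have "fourier (res m w (u + v)) = fourier (res m w u + res m w v)"
    by (simp add: fourier_res[OF w] fourier_add)
  then show ?thesis by (simp add: fourier_inject)
qed

lemma res_scaleR:
  assumes w: "w > 0"
  shows "res m w (c *\<^sub>R u) = c *\<^sub>R res m w u"
proof -
  have "(\<lambda>p. 1 / (P_inf m p + w)) \<in> borel_measurable borel" by measurable
  from mult_scaleR(2)[OF this mult_l2_bounded_symbol(1), OF this symbol_bounds(1)[OF w order_refl]]
  have "fourier (res m w (c *\<^sub>R u)) = fourier (c *\<^sub>R res m w u)"
    by (simp add: fourier_res[OF w] fourier_scaleR)
  then show ?thesis by (simp add: fourier_inject)
qed

lemma res_diff:
  assumes w: "w > 0"
  shows "res m w (u - v) = res m w u - res m w v"
  using res_add[OF w, of u "(-1) *\<^sub>R v"] res_scaleR[OF w, of "-1" v] by simp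

text \<open>Makes the dependence on w algebraic: the derivative in w, which is -R^2, comes with an
  exact remainder, without differentiating the kernel.\<close>

lemma resolvent_identity:
  assumes w: "w > 0" and w': "w' > 0"
  shows "res m w' u - res m w u = (w - w') *\<^sub>R res m w' (res m w u)"
proof -
  let ?g = "res m w u"
  have "u = (P_op m ?g + w' *\<^sub>R ?g) + (w - w') *\<^sub>R ?g"
    using res_solves[OF w, of u] by (simp add: algebra_simps)
  then have "res m w' u = res m w' ((P_op m ?g + w' *\<^sub>R ?g) + (w - w') *\<^sub>R ?g)"
    by (rule arg_cong)
  also have "\<dots> = ?g + (w - w') *\<^sub>R res m w' ?g"
    by (simp only: res_add[OF w', of "P_op m ?g + w' *\<^sub>R ?g"] res_scaleR[OF w']
        res_left_inverse[OF w' res_sobolev(1)[OF w order_refl]])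
  finally show ?thesis by simp
qed

lemma fourier_multiplier_add:
  assumes "u \<in> H2" "v \<in> H2"
  shows "P_op m (u + v) = P_op m u + P_op m v"
proof -
  note d = sobolev_2_imp(1)[OF assms(1), of m] sobolev_2_imp(1)[OF assms(2), of m]
  have "fourier (u + v) \<in> mult_domain (P_inf m)" unfolding fourier_add by (rule mult_add[OF P_inf_measurable d])
  from fourier_multiplier_P_inf[OF this] show ?thesis
    by (simp add: fourier_inject[symmetric] fourier_add fourier_multiplier_P_inf d mult_add(2)[OF P_inf_measurable d])
qed

lemma fourier_multiplier_scaleR:
  assumes "u \<in> H2"
  shows "P_op m (c *\<^sub>R u) = c *\<^sub>R P_op m u"
proof -
  note d = sobolev_2_imp(1)[OF assms, of m]
  have "fourier (c *\<^sub>R u) \<in> mult_domain (P_inf m)" unfolding fourier_scaleR by (rule mult_scaleR[OF P_inf_measurable d])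
  from fourier_multiplier_P_inf[OF this] show ?thesis
    by (simp add: fourier_inject[symmetric] fourier_scaleR fourier_multiplier_P_inf d mult_scaleR(2)[OF P_inf_measurable d])
qed

lemma norm_fourier_multiplier_le:
  assumes "u \<in> H2"
  shows "norm (P_op m u) \<le> 1 / (2 * m) * norm_H2 u"
  using sobolev_2_imp(2)[OF assms, of m] m
  by (simp add: norm_fourier[symmetric] fourier_multiplier_P_inf[OF sobolev_2_imp(1)[OF assms, of m]])

text \<open>The Sobolev embedding into bounded functions: u is the convolution of
  \<open>P_op m u + u\<close> with an L2 kernel. The last summand 1 in the constant makes it
  positive.\<close>

lemma sobolev_sup_bound:
  obtains C where "C > 0" "\<And>u. u \<in> H2 \<Longrightarrow> AE x in lborel. \<bar>rep_l2 u x\<bar> \<le> C * norm_H2 u"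
proof -
  let ?K = "res_kernel m 1"
  have K: "square_integrable ?K" by (rule res_kernel_L2[OF m]) simp
  let ?C = "norm (abs_l2 ?K) * (1 / (2 * m) + 1) + 1"
  show ?thesis
  proof (rule that)
    show "?C > 0" using m by (simp add: add_nonneg_pos)
    fix u assume u: "u \<in> H2"
    let ?f = "P_op m u + 1 *\<^sub>R u"
    have N: "0 \<le> norm_H2 u" by (simp add: sobolev_norm_def)
    have "norm ?f \<le> (1 / (2 * m) + 1) * norm_H2 u"
      using norm_triangle_ineq[of "P_op m u" u] norm_fourier_multiplier_le[OF u] sobolev_2_imp(3)[OF u]
      by (simp add: algebra_simps)
    then have "norm (abs_l2 ?K) * norm ?f \<le> norm (abs_l2 ?K) * ((1 / (2 * m) + 1) * norm_H2 u)"
      by (rule mult_left_mono) simp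
    also have "\<dots> \<le> ?C * norm_H2 u" using N by (simp add: algebra_simps)
    finally have le: "norm (abs_l2 ?K) * norm ?f \<le> ?C * norm_H2 u" .
    have "u = abs_l2 (convolve ?K (rep_l2 ?f))"
      using res_left_inverse[OF _ u, of 1] by (simp add: res_def)
    then have "AE x in lborel. rep_l2 u x = convolve ?K (rep_l2 ?f) x"
      using rep_abs_l2[OF square_integrable_res[of 1 ?f]] by simp
    then show "AE x in lborel. \<bar>rep_l2 u x\<bar> \<le> ?C * norm_H2 u"
    proof eventually_elim
      case (elim x)
      show ?case
        using convolve_L2(2)[OF K square_integrable_rep, of ?f x] le by (simp add: elim abs_rep_l2)
    qed
  qed
qed

end

subsection \<open>Rotation invariance\<close>

lemma orthogonal_measurable:
  fixes g :: "R3 \<Rightarrow> R3"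
  assumes "orthogonal_transformation g"
  shows "g \<in> borel_measurable borel"
  using orthogonal_transformation_linear[OF assms]
  by (intro borel_measurable_continuous_onI linear_continuous_on linear_conv_bounded_linear[THEN iffD1]) auto

text \<open>The preimage of a box is a rotated box; its volume is computed in Lebesgue measure,
  where orthogonal maps preserve the measure of images.\<close>

lemma lborel_distr_orthogonal:
  fixes g :: "R3 \<Rightarrow> R3"
  assumes g: "orthogonal_transformation g"
  shows "distr lborel borel g = lborel"
proof (rule lborel_eqI[symmetric])
  have gm: "g \<in> borel_measurable borel" by (rule orthogonal_measurable[OF g])
  have gi: "orthogonal_transformation (inv g)" by (rule orthogonal_transformation_inv[OF g])
  fix l u :: R3 assume lu: "\<And>b. b \<in> Basis \<Longrightarrow> l \<bullet> b \<le> u \<bullet> b"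
  have pre: "g -` box l u = inv g ` box l u"
    using bij_vimage_eq_inv_image[OF orthogonal_transformation_bij[OF g]] .
  have meas: "g -` box l u \<in> sets borel" using measurable_sets[OF gm, of "box l u"] by simp
  have "emeasure (distr lborel borel g) (box l u) = emeasure lborel (g -` box l u)"
    using gm by (subst emeasure_distr) auto
  also have "\<dots> = emeasure lebesgue (g -` box l u)" using meas by simp
  also have "\<dots> = ennreal (measure lebesgue (inv g ` box l u))"
    unfolding pre by (rule emeasure_eq_measure2[OF measurable_orthogonal_image[OF gi lmeasurable_box]])
  also have "measure lebesgue (inv g ` box l u) = measure lebesgue (box l u)"
    by (rule measure_orthogonal_image[OF gi lmeasurable_box])
  also have "ennreal (measure lebesgue (box l u)) = (\<Prod>b\<in>Basis. (u - l) \<bullet> b)"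
    using lu by (simp add: emeasure_eq_measure2[OF lmeasurable_box, symmetric])
  finally show "emeasure (distr lborel borel g) (box l u) = (\<Prod>b\<in>Basis. (u - l) \<bullet> b)" .
qed simp

lemma lborel_integral_orthogonal:
  fixes g :: "R3 \<Rightarrow> R3" and f :: "R3 \<Rightarrow> real"
  assumes g: "orthogonal_transformation g" and f: "f \<in> borel_measurable borel"
  shows "(LINT x|lborel. f (g x)) = (LINT x|lborel. f x)"
proof -
  have gm: "g \<in> borel_measurable borel" by (rule orthogonal_measurable[OF g])
  have "(LINT x|distr lborel borel g. f x) = (LINT x|lborel. f (g x))"
    using gm f by (intro integral_distr) auto
  then show ?thesis by (simp add: lborel_distr_orthogonal[OF g])
qed

text \<open>Some orthogonal map takes x to y; substituting it preserves the measure and, by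
  radiality, the values of K and f.\<close>

lemma convolve_radial:
  assumes K: "K \<in> borel_measurable borel" "\<And>x y. norm x = norm y \<Longrightarrow> K x = K y"
    and f: "f \<in> borel_measurable borel" "\<And>x y. norm x = norm y \<Longrightarrow> f x = f y"
    and xy: "norm x = norm y"
  shows "convolve K f x = convolve K f y"
proof -
  note K(1)[measurable] f(1)[measurable]
  obtain g where g: "orthogonal_transformation g" "g x = y" by (rule orthogonal_transformation_exists[OF xy])
  have "convolve K f y = (LINT z|lborel. K (g x - g z) * f (g z))"
    unfolding convolve_def g(2)[symmetric]
    by (rule lborel_integral_orthogonal[OF g(1), symmetric]) measurable
  also have "\<dots> = convolve K f x"
    unfolding convolve_def
  proof (intro Bochner_Integration.integral_cong refl arg_cong2[where f="(*)"] K(2) f(2))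
    fix z
    show "norm (g x - g z) = norm (x - z)"
      using orthogonal_transformation_norm[OF g(1), of "x - z"] linear_diff[OF orthogonal_transformation_linear[OF g(1)]] by simp
    show "norm (g z) = norm z" by (rule orthogonal_transformation_norm[OF g(1)])
  qed
  finally show ?thesis ..
qed

lemma convolve_cong_AE:
  assumes [measurable]: "K \<in> borel_measurable borel" "f \<in> borel_measurable borel" "g \<in> borel_measurable borel"
    and e: "AE x in lborel. f x = g x"
  shows "convolve K f x = convolve K g x"
  unfolding convolve_def by (rule integral_cong_AE) (use e in \<open>auto elim: eventually_mono\<close>)

lemma radialE:
  assumes "radial u"
  obtains f where "square_integrable f" "u = abs_l2 f" "AE x in lborel. rep_l2 u x = f x" "\<And>x y. norm x = norm y \<Longrightarrow> f x = f y"
  using assms unfolding radial_def by (metis rep_abs_l2)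

lemma radialI:
  assumes "square_integrable f" "\<And>x y. norm x = norm y \<Longrightarrow> f x = f y"
  shows "radial (abs_l2 f)"
  using assms unfolding radial_def by blast

lemma radial_res:
  assumes m: "m > 0" and w: "w > 0" and u: "radial u"
  shows "radial (res m w u)"
proof -
  obtain f where f: "square_integrable f" "AE x in lborel. rep_l2 u x = f x" "\<And>x y. norm x = norm y \<Longrightarrow> f x = f y"
    by (rule radialE[OF u]) blast
  let ?K = "res_kernel m w"
  have Km: "?K \<in> borel_measurable borel" by (rule l2_measurable[OF res_kernel_L2[OF m w]])
  have fm: "f \<in> borel_measurable borel" by (rule l2_measurable[OF f(1)])
  \<comment> \<open>\<open>rep_l2 u\<close> need not be radial pointwise, but convolution does not
    see null sets, so a radial representative can replace it with equality at every point.\<close>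
  have e: "convolve ?K (rep_l2 u) = convolve ?K f"
    by (intro ext convolve_cong_AE Km fm f rep_l2_measurable)
  show ?thesis
    unfolding res_def
  proof (rule radialI[OF square_integrable_res[OF m w]], unfold e)
    fix x y :: R3 assume "norm x = norm y"
    then show "convolve ?K f x = convolve ?K f y"
      by (intro convolve_radial Km fm f) (auto simp: res_kernel_def heat_kernel_def)
  qed
qed

subsection \<open>The Hartree nonlinearity on H2\<close>

lemma sobolev_add: "u \<in> sobolev s \<Longrightarrow> v \<in> sobolev s \<Longrightarrow> u + v \<in> sobolev s"
  by (simp add: sobolev_iff fourier_add mult_add)

lemma sobolev_scaleR: "u \<in> sobolev s \<Longrightarrow> c *\<^sub>R u \<in> sobolev s"
  by (simp add: sobolev_iff fourier_scaleR mult_scaleR)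

lemma sobolev_norm_nonneg: "0 \<le> sobolev_norm s u"
  by (simp add: sobolev_norm_def)

lemma dyadic_bracket:
  fixes r :: real
  assumes "0 < r" "r \<le> 1"
  obtains n where "(1 / 2) ^ Suc n < r" "r \<le> (1 / 2) ^ n"
proof -
  obtain k where k: "(1 / 2) ^ k < r" using real_arch_pow_inv[of r "1 / 2"] assms by auto
  define j where "j = (LEAST k. (1 / 2) ^ k < r)"
  have j: "(1 / 2) ^ j < r" unfolding j_def by (rule LeastI[of _ k]) (rule k)
  have "j \<noteq> 0" using j assms by (cases j) auto
  then obtain n where n: "j = Suc n" by (cases j) auto
  have "\<not> (1 / 2) ^ n < r"
    using not_less_Least[of n "\<lambda>k. (1 / 2) ^ k < r"] n by (simp add: j_def)
  then show ?thesis using j n that[of n] by auto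
qed

text \<open>Dyadic shells instead of polar coordinates: for 2^(-n-1) < |y| <= 2^(-n) the integrand
  is below 2^(n+1), and the ball of radius 2^(-n) has volume of order 8^(-n), which leaves a
  geometric series of ratio 1/4.\<close>

lemma inverse_norm_integrable:
  "integrable lborel (\<lambda>y::R3. indicator (cball 0 1) y / norm y :: real)"
proof (rule integrableI_nonneg)
  have [measurable]: "cball 0 r \<in> sets (borel :: R3 measure)" for r by simp
  show "(\<lambda>y::R3. indicator (cball 0 1) y / norm y :: real) \<in> borel_measurable lborel" by measurable
  show "AE y in lborel. 0 \<le> (indicator (cball 0 1) (y::R3) / norm y :: real)" by simp
  let ?t = "\<lambda>n (y::R3). 2 ^ Suc n * indicator (cball 0 ((1 / 2) ^ n)) y :: real"
  have "(\<integral>\<^sup>+ y. ennreal (indicator (cball 0 1) y / norm y) \<partial>(lborel :: R3 measure)) \<le> (\<integral>\<^sup>+ y. (\<Sum>n. ennreal (?t n y)) \<partial>(lborel :: R3 measure))"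
  proof (rule nn_integral_mono)
    fix y :: R3
    show "ennreal (indicator (cball 0 1) y / norm y) \<le> (\<Sum>n. ennreal (?t n y))"
    proof (cases "y \<noteq> 0 \<and> norm y \<le> 1")
      case True
      then obtain n where n: "(1 / 2) ^ Suc n < norm y" "norm y \<le> (1 / 2) ^ n"
        using dyadic_bracket[of "norm y"] by auto
      have "1 / norm y \<le> 1 / (1 / 2) ^ Suc n" 
        using n(1) True by (intro divide_left_mono mult_pos_pos) auto
      also have "\<dots> = 2 ^ Suc n" by (simp add: power_one_over)
      finally have "1 / norm y \<le> 2 ^ Suc n" .
      then have "ennreal (indicator (cball 0 1) y / norm y) \<le> ennreal (?t n y)"
        using True n by (intro ennreal_leI) auto
      also have "\<dots> \<le> (\<Sum>n. ennreal (?t n y))"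
        using sum_le_suminf[of "\<lambda>n. ennreal (?t n y)" "{n}", OF summableI]
        by (simp only: sum.insert sum.empty finite.emptyI finite.insertI empty_iff not_False_eq_True add_0_right zero_le simp_thms)
      finally show ?thesis .
    next
      case False
      \<comment> \<open>Either |y| > 1, or y = 0 and division by zero gives 0.\<close>
      then have "indicator (cball 0 1) y / norm y = (0 :: real)" by (auto simp: indicator_def)
      then show ?thesis by (simp only: ennreal_0 zero_le)
    qed
  qed
  also have "\<dots> = (\<Sum>n. \<integral>\<^sup>+ y. ennreal (?t n y) \<partial>(lborel :: R3 measure))"
  proof (rule nn_integral_suminf)
    show "(\<lambda>y. ennreal (?t n y)) \<in> borel_measurable lborel" for n
      by (intro measurable_compose[OF _ measurable_ennreal] borel_measurable_times borel_measurable_const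
          borel_measurable_indicator) simp
  qed
  also have "\<dots> = (\<Sum>n. ennreal (2 * unit_ball_vol 3 * (1 / 4) ^ n))"
  proof (rule suminf_cong)
    fix n
    have "(\<integral>\<^sup>+ y. ennreal (?t n y) \<partial>(lborel :: R3 measure)) = ennreal (2 ^ Suc n) * emeasure lborel (cball (0::R3) ((1 / 2) ^ n))"
      by (subst nn_integral_cmult_indicator[symmetric]) (auto simp: ennreal_mult' ennreal_indicator intro!: nn_integral_cong)
    also have "\<dots> = ennreal (2 ^ Suc n * (unit_ball_vol 3 * ((1 / 2) ^ n) ^ 3))"
      by (simp add: emeasure_cball DIM_R3 flip: ennreal_mult')
    also have "2 ^ Suc n * (unit_ball_vol 3 * ((1 / 2) ^ n) ^ 3) = 2 * unit_ball_vol 3 * (2 * (1 / 2) ^ 3) ^ n"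
    proof -
      have "((1 / 2 :: real) ^ n) ^ 3 = ((1 / 2) ^ 3) ^ n" by (simp only: power_mult[symmetric] mult.commute)
      then show ?thesis unfolding power_mult_distrib[of 2] power_Suc by simp
    qed
    finally show "(\<integral>\<^sup>+ y. ennreal (?t n y) \<partial>(lborel :: R3 measure)) = ennreal (2 * unit_ball_vol 3 * (1 / 4) ^ n)"
      by (simp add: power3_eq_cube)
  qed
  also have "\<dots> < \<infinity>"
    using summable_geometric[of "1 / 4 :: real"]
    by (subst suminf_ennreal2) (auto intro!: summable_mult simp: unit_ball_vol_def)
  finally show "(\<integral>\<^sup>+ y. ennreal (indicator (cball 0 1) y / norm y) \<partial>(lborel :: R3 measure)) < \<infinity>" .
qed

definition coulomb_mass :: real where
  "coulomb_mass = (LINT y|(lborel::R3 measure). indicator (cball 0 1) y / norm y)"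

lemma coulomb_mass_nonneg: "0 \<le> coulomb_mass"
  unfolding coulomb_mass_def by (intro Bochner_Integration.integral_nonneg) simp

text \<open>Split at |x - y| = 1: inside, the bound M against the integrable singularity; outside,
  the kernel is at most 1 and f is integrable.\<close>

lemma coulomb_bound:
  assumes f: "integrable lborel f" and M: "AE x in lborel. \<bar>f x\<bar> \<le> M" and M0: "0 \<le> M"
  shows "integrable lborel (\<lambda>y. f y / norm (x - y))" "\<bar>coulomb f x\<bar> \<le> M * coulomb_mass + (LINT y|lborel. \<bar>f y\<bar>)"
proof -
  have [measurable]: "f \<in> borel_measurable borel" using f by auto
  let ?k = "\<lambda>y::R3. indicator (cball 0 1) y / norm y :: real"
  have ki: "integrable lborel (\<lambda>y. ?k (x - y))"
    using lborel_integrable_affine[OF inverse_norm_integrable, of "-1" x] by simp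
  have [measurable]: "cball 0 r \<in> sets (borel :: R3 measure)" for r by simp
  have kI: "(LINT y|lborel. ?k (x - y)) = coulomb_mass"
    unfolding coulomb_mass_def using lborel_integral_affine[of ?k "-1" x] by simp
  let ?w = "\<lambda>y. M * ?k (x - y) + \<bar>f y\<bar>"
  have wi: "integrable lborel ?w"
    by (intro Bochner_Integration.integrable_add integrable_mult_right ki integrable_abs f)
  have le: "AE y in lborel. norm (f y / norm (x - y)) \<le> ?w y"
    using M
  proof eventually_elim
    case (elim y)
    show ?case
    proof (cases "norm (x - y) \<le> 1")
      case True
      have "\<bar>f y\<bar> / norm (x - y) \<le> M / norm (x - y)" using elim by (rule divide_right_mono) simp
      then show ?thesis using True by (simp add: abs_divide add_increasing2)
    next
      case False
      then have "\<bar>f y\<bar> / norm (x - y) \<le> \<bar>f y\<bar>" by (simp add: divide_le_eq mult_le_cancel_left1)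
      then show ?thesis using M0 by (simp add: abs_divide add_increasing)
    qed
  qed
  show i: "integrable lborel (\<lambda>y. f y / norm (x - y))"
  proof (rule Bochner_Integration.integrable_bound[OF wi])
    show "AE y in lborel. norm (f y / norm (x - y)) \<le> norm (?w y)"
      using le by eventually_elim (simp add: abs_le_iff)
  qed measurable
  have "\<bar>coulomb f x\<bar> \<le> (LINT y|lborel. norm (f y / norm (x - y)))"
    unfolding coulomb_def using integral_norm_bound[of lborel "\<lambda>y. f y / norm (x - y)"] by simp
  also have "\<dots> \<le> (LINT y|lborel. ?w y)"
    by (rule integral_mono_AE[OF integrable_norm[OF i] wi le])
  also have "\<dots> = M * coulomb_mass + (LINT y|lborel. \<bar>f y\<bar>)"
    by (subst Bochner_Integration.integral_add[OF integrable_mult_right[OF ki] integrable_abs[OF f]])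
      (simp only: integral_mult_right_zero kI)
  finally show "\<bar>coulomb f x\<bar> \<le> M * coulomb_mass + (LINT y|lborel. \<bar>f y\<bar>)" .
qed

lemma coulomb_measurable[measurable]:
  assumes [measurable]: "f \<in> borel_measurable borel"
  shows "coulomb f \<in> borel_measurable borel"
  unfolding coulomb_def by (rule borel_measurable_lborel_integral) measurable

lemma coulomb_cong_AE:
  assumes "f \<in> borel_measurable borel" "g \<in> borel_measurable borel" "AE x in lborel. f x = g x"
  shows "coulomb f x = coulomb g x"
proof -
  note assms(1,2)[measurable]
  show ?thesis
    unfolding coulomb_def by (rule integral_cong_AE) (use assms(3) in \<open>auto elim: eventually_mono\<close>)
qed

abbreviation "potential a b \<equiv> coulomb (\<lambda>y. rep_l2 a y * rep_l2 b y)"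

text \<open>A product of two H2 functions is bounded by the Sobolev embedding and integrable by
  Cauchy-Schwarz, as the Coulomb estimate asks. H2 does not involve m, so the embedding is taken at
  m = 1.\<close>

lemma coulomb_sobolev:
  obtains C where "C > 0"
    "\<And>a b x. a \<in> H2 \<Longrightarrow> b \<in> H2 \<Longrightarrow> integrable lborel (\<lambda>y. rep_l2 a y * rep_l2 b y / norm (x - y))"
    "\<And>a b x. a \<in> H2 \<Longrightarrow> b \<in> H2 \<Longrightarrow>
      \<bar>potential a b x\<bar> \<le> C * norm_H2 a * norm_H2 b"
proof -
  obtain B where B: "B > 0" "\<And>u. u \<in> H2 \<Longrightarrow> AE x in lborel. \<bar>rep_l2 u x\<bar> \<le> B * norm_H2 u"
    using sobolev_sup_bound[of 1] by auto
  have main: "integrable lborel (\<lambda>y. rep_l2 a y * rep_l2 b y / norm (x - y)) \<and>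
      \<bar>potential a b x\<bar> \<le> (B^2 * coulomb_mass + 1) * norm_H2 a * norm_H2 b"
    if a: "a \<in> H2" and b: "b \<in> H2" for a b x
  proof -
    let ?f = "\<lambda>y. rep_l2 a y * rep_l2 b y" and ?M = "(B * norm_H2 a) * (B * norm_H2 b)"
    have M0: "0 \<le> ?M" using B(1) by (simp add: sobolev_norm_nonneg)
    have M: "AE y in lborel. \<bar>?f y\<bar> \<le> ?M"
      using B(2)[OF a] B(2)[OF b] by eventually_elim (simp add: abs_mult mult_mono)
    have i: "integrable lborel ?f"
      using square_integrable_inner[OF square_integrable_rep square_integrable_rep, of a b] by simp
    have "(LINT y|lborel. \<bar>?f y\<bar>) \<le> norm a * norm b"
      using L2_Cauchy_Schwarz[OF square_integrable_rep square_integrable_rep, of a b] by (simp add: abs_mult abs_rep_l2)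
    also have "\<dots> \<le> norm_H2 a * norm_H2 b"
      using sobolev_2_imp(3)[OF a] sobolev_2_imp(3)[OF b] by (intro mult_mono) (auto simp: sobolev_norm_nonneg)
    finally have "\<bar>coulomb ?f x\<bar> \<le> ?M * coulomb_mass + norm_H2 a * norm_H2 b"
      using coulomb_bound(2)[OF i M M0, of x] by linarith
    then show ?thesis
      using coulomb_bound(1)[OF i M M0, of x] by (simp add: algebra_simps power2_eq_square)
  qed
  show ?thesis
    by (rule that[of "B^2 * coulomb_mass + 1"]) (use main B(1) coulomb_mass_nonneg in \<open>auto simp: add_nonneg_pos\<close>)
qed

text \<open>Polarisation of the cubic term. The third argument may be any L2 function, since the
  potential of two H2 functions is bounded.\<close>

definition tri :: "real l2 \<Rightarrow> real l2 \<Rightarrow> real l2 \<Rightarrow> real l2" where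
  "tri a b c = abs_l2 (\<lambda>x. potential a b x * rep_l2 c x)"

lemma tri_bound:
  obtains C where "C > 0" "\<And>a b c. a \<in> H2 \<Longrightarrow> b \<in> H2 \<Longrightarrow> norm (tri a b c) \<le> C * norm_H2 a * norm_H2 b * norm c"
    and "\<And>a b c. a \<in> H2 \<Longrightarrow> b \<in> H2 \<Longrightarrow> square_integrable c \<Longrightarrow>
      square_integrable (\<lambda>x. potential a b x * c x)"
proof -
  obtain C where C: "C > 0" "\<And>a b x. a \<in> H2 \<Longrightarrow> b \<in> H2 \<Longrightarrow>
      \<bar>potential a b x\<bar> \<le> C * norm_H2 a * norm_H2 b"
    by (rule coulomb_sobolev) blast
  have le: "AE x in lborel. norm (potential a b x * c x) \<le> C * norm_H2 a * norm_H2 b * norm (c x)"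
    if "a \<in> H2" "b \<in> H2" for a b and c :: "R3 \<Rightarrow> real"
    using C(2)[OF that] by (intro AE_I2) (auto simp: abs_mult intro!: mult_right_mono)
  have pos: "0 \<le> C * norm_H2 a * norm_H2 b" for a b using C(1) by (simp add: sobolev_norm_nonneg)
  show ?thesis
  proof (rule that[OF C(1)])
    fix a b assume ab: "a \<in> H2" "b \<in> H2"
    show "norm (tri a b c) \<le> C * norm_H2 a * norm_H2 b * norm c" for c
      using norm_l2_bounded_ae(2)[OF square_integrable_rep _ pos le[OF ab], of c] by (simp add: tri_def abs_rep_l2)
    fix c :: "R3 \<Rightarrow> real" assume c: "square_integrable c"
    note l2_measurable[OF c, measurable]
    show "square_integrable (\<lambda>x. potential a b x * c x)"
      by (rule norm_l2_bounded_ae(1)[OF c _ pos le[OF ab]]) measurable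
  qed
qed

lemma tri_L2:
  assumes "a \<in> H2" "b \<in> H2" "square_integrable c"
  shows "square_integrable (\<lambda>x. potential a b x * c x)"
  by (rule tri_bound) (use assms in blast)

lemma tri_commute: "tri a b c = tri b a c"
  by (simp add: tri_def mult.commute)

text \<open>\<open>rep_l2\<close> of a sum or a multiple is the sum or the multiple only almost
  everywhere. Exchanging representatives here, once, reduces the algebra of \<open>tri\<close> to
  that of integrals.\<close>

lemma tri_eq:
  assumes ab: "a \<in> H2" "b \<in> H2"
    and f: "square_integrable f" "AE x in lborel. rep_l2 a x = f x"
    and g: "square_integrable g" "AE x in lborel. rep_l2 b x = g x"
    and h: "square_integrable h" "AE x in lborel. rep_l2 c x = h x"
  shows "square_integrable (\<lambda>x. coulomb (\<lambda>y. f y * g y) x * h x)"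
    "tri a b c = abs_l2 (\<lambda>x. coulomb (\<lambda>y. f y * g y) x * h x)"
proof -
  note [measurable] = l2_measurable[OF f(1)] l2_measurable[OF g(1)] l2_measurable[OF h(1)]
  have "AE y in lborel. rep_l2 a y * rep_l2 b y = f y * g y"
    using f(2) g(2) by eventually_elim simp
  then have e: "potential a b = coulomb (\<lambda>y. f y * g y)"
    by (intro ext coulomb_cong_AE) auto
  show "square_integrable (\<lambda>x. coulomb (\<lambda>y. f y * g y) x * h x)"
    using tri_L2[OF ab h(1)] unfolding e .
  show "tri a b c = abs_l2 (\<lambda>x. coulomb (\<lambda>y. f y * g y) x * h x)"
    unfolding tri_def e
  proof (rule abs_l2_cong)
    show "square_integrable (\<lambda>x. coulomb (\<lambda>y. f y * g y) x * rep_l2 c x)"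
      using tri_L2[OF ab square_integrable_rep[of c]] unfolding e .
    show "AE x in lborel. coulomb (\<lambda>y. f y * g y) x * rep_l2 c x = coulomb (\<lambda>y. f y * g y) x * h x"
      using h(2) by eventually_elim simp
  qed measurable
qed

lemma tri_add3:
  assumes ab: "a \<in> H2" "b \<in> H2"
  shows "tri a b (c + d) = tri a b c + tri a b d"
proof -
  have "tri a b (c + d) = abs_l2 (\<lambda>x. potential a b x * (rep_l2 c x + rep_l2 d x))"
    by (intro tri_eq ab square_integrable_rep square_integrable_add rep_l2_add) auto
  also have "\<dots> = tri a b c + tri a b d"
    unfolding tri_def distrib_left by (intro abs_l2_add[symmetric] tri_L2 ab square_integrable_rep)
  finally show ?thesis .
qed

lemma tri_scaleR3:
  assumes ab: "a \<in> H2" "b \<in> H2"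
  shows "tri a b (r *\<^sub>R c) = r *\<^sub>R tri a b c"
proof -
  have "tri a b (r *\<^sub>R c) = abs_l2 (\<lambda>x. potential a b x * (r *\<^sub>R rep_l2 c x))"
    by (intro tri_eq ab square_integrable_rep square_integrable_scaleR rep_l2_scaleR) auto
  also have "\<dots> = r *\<^sub>R tri a b c"
    unfolding tri_def mult_scaleR_right by (intro abs_l2_scaleR[symmetric] tri_L2 ab square_integrable_rep)
  finally show ?thesis .
qed

lemma tri_add1:
  assumes a: "a \<in> H2" "a' \<in> H2" and b: "b \<in> H2"
  shows "tri (a + a') b c = tri a b c + tri a' b c"
proof -
  have i: "integrable lborel (\<lambda>y. rep_l2 v y * rep_l2 b y / norm (x - y))" if "v \<in> H2" for v x
    by (rule coulomb_sobolev) (use that b in blast)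
  have e: "coulomb (\<lambda>y. (rep_l2 a y + rep_l2 a' y) * rep_l2 b y) x =
      potential a b x + potential a' b x" for x
    unfolding coulomb_def distrib_right add_divide_distrib
    by (intro Bochner_Integration.integral_add i a)
  have "tri (a + a') b c = abs_l2 (\<lambda>x. coulomb (\<lambda>y. (rep_l2 a y + rep_l2 a' y) * rep_l2 b y) x * rep_l2 c x)"
    by (intro tri_eq sobolev_add a b square_integrable_rep square_integrable_add rep_l2_add) auto
  also have "\<dots> = tri a b c + tri a' b c"
  proof -
    have e': "coulomb (\<lambda>y. (rep_l2 a y + rep_l2 a' y) * rep_l2 b y) x * z =
        potential a b x * z + potential a' b x * z" for x z
      unfolding e by (rule distrib_right)
    show ?thesis
      unfolding tri_def e' by (intro abs_l2_add[symmetric] tri_L2 a b square_integrable_rep)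
  qed
  finally show ?thesis .
qed

lemma tri_scaleR1:
  assumes a: "a \<in> H2" and b: "b \<in> H2"
  shows "tri (r *\<^sub>R a) b c = r *\<^sub>R tri a b c"
proof -
  have e: "coulomb (\<lambda>y. (r *\<^sub>R rep_l2 a y) * rep_l2 b y) x * z = r *\<^sub>R (potential a b x * z)" for x z
    by (simp add: coulomb_def mult.assoc flip: times_divide_eq_right)
  have "tri (r *\<^sub>R a) b c = abs_l2 (\<lambda>x. coulomb (\<lambda>y. (r *\<^sub>R rep_l2 a y) * rep_l2 b y) x * rep_l2 c x)"
    by (intro tri_eq sobolev_scaleR a b square_integrable_rep square_integrable_scaleR rep_l2_scaleR) auto
  also have "\<dots> = r *\<^sub>R tri a b c"
    unfolding tri_def e by (intro abs_l2_scaleR[symmetric] tri_L2 a b square_integrable_rep)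
  finally show ?thesis .
qed

lemma tri_add2:
  assumes "a \<in> H2" "b \<in> H2" "b' \<in> H2"
  shows "tri a (b + b') c = tri a b c + tri a b' c"
  using tri_add1[OF assms(2,3,1)] by (simp add: tri_commute[of a])

lemma tri_scaleR2:
  assumes "a \<in> H2" "b \<in> H2"
  shows "tri a (r *\<^sub>R b) c = r *\<^sub>R tri a b c"
  using tri_scaleR1[OF assms(2,1)] by (simp add: tri_commute[of a])

lemma hartree_eq_tri: "hartree u = tri u u u"
  by (simp add: hartree_def tri_def power2_eq_square)

lemma hartree_deriv_eq_tri:
  assumes u: "u \<in> H2" and p: "\<phi> \<in> H2"
  shows "hartree_deriv u \<phi> = tri u u \<phi> + 2 *\<^sub>R tri u \<phi> u"
proof -
  let ?c = "\<lambda>x. coulomb (\<lambda>y. rep_l2 u y * rep_l2 \<phi> y) x * rep_l2 u x"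
  have q: "square_integrable ?c" by (intro tri_L2 u p square_integrable_rep)
  have "hartree_deriv u \<phi> = abs_l2 (\<lambda>x. potential u u x * rep_l2 \<phi> x + 2 *\<^sub>R ?c x)"
    by (simp add: hartree_deriv_def power2_eq_square mult.assoc)
  also have "\<dots> = abs_l2 (\<lambda>x. potential u u x * rep_l2 \<phi> x) + abs_l2 (\<lambda>x. 2 *\<^sub>R ?c x)"
    by (intro abs_l2_add[symmetric] square_integrable_scaleR q tri_L2 u square_integrable_rep)
  also have "abs_l2 (\<lambda>x. 2 *\<^sub>R ?c x) = 2 *\<^sub>R abs_l2 ?c" by (rule abs_l2_scaleR[OF q, symmetric])
  finally show ?thesis by (simp add: tri_def)
qed

text \<open>The terms of \<open>hartree (u + w)\<close> of second and third order in w.\<close>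

definition hartree_remainder :: "real l2 \<Rightarrow> real l2 \<Rightarrow> real l2" where
  "hartree_remainder u w = tri w w u + 2 *\<^sub>R tri u w w + tri w w w"

lemma hartree_expand:
  assumes u: "u \<in> H2" and w: "w \<in> H2"
  shows "hartree (u + w) = hartree u + hartree_deriv u w + hartree_remainder u w"
proof -
  have "tri (u + w) (u + w) c = tri u u c + 2 *\<^sub>R tri u w c + tri w w c" for c
    by (simp add: tri_add1 tri_add2 u w sobolev_add tri_commute[of w u] scaleR_2 add_ac)
  then show ?thesis
    unfolding hartree_eq_tri hartree_deriv_eq_tri[OF u w] hartree_remainder_def
    by (simp add: tri_add3 u w sobolev_add scaleR_2 add_ac)
qed

lemma hartree_deriv_bound:
  obtains C where "C > 0" "\<And>u \<phi>. u \<in> H2 \<Longrightarrow> \<phi> \<in> H2 \<Longrightarrow>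
     norm (hartree_deriv u \<phi>) \<le> C * (norm_H2 u)^2 * norm_H2 \<phi>"
    "\<And>u w. u \<in> H2 \<Longrightarrow> w \<in> H2 \<Longrightarrow> 
     norm (hartree_remainder u w) \<le> C * (norm_H2 u + norm_H2 w) * (norm_H2 w)^2"
proof -
  obtain C where C: "C > 0" "\<And>a b c. a \<in> H2 \<Longrightarrow> b \<in> H2 \<Longrightarrow>
    norm (tri a b c) \<le> C * norm_H2 a * norm_H2 b * norm c" by (rule tri_bound) blast
  have T: "norm (tri a b c) \<le> C * norm_H2 a * norm_H2 b * norm_H2 c"
    if "a \<in> H2" "b \<in> H2" "c \<in> H2" for a b c
  proof -
    have "C * norm_H2 a * norm_H2 b * norm c \<le> C * norm_H2 a * norm_H2 b * norm_H2 c"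
      using C(1) by (intro mult_left_mono sobolev_2_imp(3) that) (simp add: sobolev_norm_nonneg)
    then show ?thesis using C(2)[OF that(1,2), of c] by linarith
  qed
  show ?thesis
  proof (rule that[of "3 * C"])
    show "3 * C > 0" using C(1) by simp
  next
    fix u \<phi> assume uw: "u \<in> H2" "\<phi> \<in> H2"
    show "norm (hartree_deriv u \<phi>) \<le> 3 * C * (norm_H2 u)^2 * norm_H2 \<phi>"
      using norm_triangle_ineq[of "tri u u \<phi>" "2 *\<^sub>R tri u \<phi> u"] T[of u u \<phi>] T[of u \<phi> u] uw
      by (simp add: hartree_deriv_eq_tri power2_eq_square mult_ac)
  next
    fix u w assume uw: "u \<in> H2" "w \<in> H2"
    have "norm (hartree_remainder u w) \<le> norm (tri w w u) + 2 * norm (tri u w w) + norm (tri w w w)"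
      unfolding hartree_remainder_def
      using norm_triangle_ineq[of "tri w w u + 2 *\<^sub>R tri u w w" "tri w w w"] norm_triangle_ineq[of "tri w w u" "2 *\<^sub>R tri u w w"] by simp
    also have "\<dots> \<le> 3 * C * norm_H2 u * (norm_H2 w)^2 + C * norm_H2 w * (norm_H2 w)^2"
      using T[of w w u] T[of u w w] T[of w w w] uw by (simp add: power2_eq_square mult_ac)
    also have "\<dots> \<le> 3 * C * (norm_H2 u + norm_H2 w) * (norm_H2 w)^2"
      using C(1) by (simp add: algebra_simps sobolev_norm_nonneg)
    finally show "norm (hartree_remainder u w) \<le> 3 * C * (norm_H2 u + norm_H2 w) * (norm_H2 w)^2" .
  qed
qed

lemma coulomb_eq_convolve: "coulomb f = convolve (\<lambda>z. 1 / norm z) f"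
  by (simp add: coulomb_def convolve_def fun_eq_iff)

lemma radial_tri:
  assumes ab: "a \<in> H2" "b \<in> H2" and r: "radial a" "radial b" "radial c"
  shows "radial (tri a b c)"
proof -
  obtain f where f: "square_integrable f" "AE x in lborel. rep_l2 a x = f x" "\<And>x y. norm x = norm y \<Longrightarrow> f x = f y"
    by (rule radialE[OF r(1)]) blast
  obtain g where g: "square_integrable g" "AE x in lborel. rep_l2 b x = g x" "\<And>x y. norm x = norm y \<Longrightarrow> g x = g y"
    by (rule radialE[OF r(2)]) blast
  obtain h where h: "square_integrable h" "AE x in lborel. rep_l2 c x = h x" "\<And>x y. norm x = norm y \<Longrightarrow> h x = h y"
    by (rule radialE[OF r(3)]) blast
  note [measurable] = l2_measurable[OF f(1)] l2_measurable[OF g(1)]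
  note t = tri_eq[OF ab f(1,2) g(1,2) h(1,2)]
  have cr: "coulomb (\<lambda>y. f y * g y) x = coulomb (\<lambda>y. f y * g y) y" if "norm x = norm y" for x y
    unfolding coulomb_eq_convolve
  proof (rule convolve_radial[OF _ _ _ _ that])
    fix x y :: R3 assume n: "norm x = norm y"
    show "1 / norm x = 1 / norm y" using n by simp
    show "f x * g x = f y * g y" using f(3)[OF n] g(3)[OF n] by simp
  qed measurable
  show ?thesis
    unfolding t(2)
  proof (rule radialI[OF t(1)])
    fix x y :: R3 assume n: "norm x = norm y"
    show "coulomb (\<lambda>y. f y * g y) x * h x = coulomb (\<lambda>y. f y * g y) y * h y"
      using cr[OF n] h(3)[OF n] by simp
  qed
qed

subsection \<open>Dilations\<close>

definition dilate :: "real \<Rightarrow> real l2 \<Rightarrow> real l2" where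
  "dilate c u = abs_l2 (\<lambda>x. rep_l2 u (c *\<^sub>R x))"

lemma square_integrable_dilate:
  fixes f :: "R3 \<Rightarrow> real"
  assumes f: "square_integrable f" and c: "c > 0"
  shows "square_integrable (\<lambda>x. f (c *\<^sub>R x))"
  using square_integrable_affine(1)[OF f, of c 0] c by simp

text \<open>Dilation respects almost everywhere equality: a difference of norm zero keeps norm zero
  after scaling.\<close>

lemma dilate_abs:
  assumes f: "square_integrable f" and c: "c > 0"
  shows "dilate c (abs_l2 f) = abs_l2 (\<lambda>x. f (c *\<^sub>R x))"
proof -
  let ?d = "\<lambda>x. rep_l2 (abs_l2 f) x - f x"
  have d: "square_integrable ?d" by (intro square_integrable_diff square_integrable_rep f)
  have "abs_l2 ?d = 0"
    by (simp add: abs_l2_diff[symmetric] square_integrable_rep f abs_rep_l2)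
  then have "norm (abs_l2 (\<lambda>x. ?d (c *\<^sub>R x))) = 0"
    using square_integrable_affine(2)[OF d, of c 0] c by simp
  then show ?thesis
    using f c by (simp add: dilate_def abs_l2_diff[symmetric] square_integrable_dilate square_integrable_rep)
qed

lemma rep_dilate:
  assumes "c > 0"
  shows "AE x in lborel. rep_l2 (dilate c u) x = rep_l2 u (c *\<^sub>R x)"
  unfolding dilate_def by (intro rep_abs_l2 square_integrable_dilate square_integrable_rep assms)

lemma norm_dilate:
  assumes "c > 0"
  shows "c ^ 3 * (norm (dilate c u))^2 = (norm u)^2"
  using square_integrable_affine(2)[OF square_integrable_rep, of c u 0] assms by (simp add: dilate_def abs_rep_l2)

lemma dilate_tendsto:
  assumes "c \<longlonglongrightarrow> 1" "\<And>n. c n \<ge> 1 / 2"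
  shows "(\<lambda>n. dilate (c n) u) \<longlonglongrightarrow> u"
  using tendsto_l2_affine[OF square_integrable_rep tendsto_const assms, of u] by (simp add: dilate_def abs_rep_l2)

lemma radial_dilate:
  assumes c: "c > 0" and u: "radial u"
  shows "radial (dilate c u)"
proof -
  obtain f where f: "square_integrable f" "u = abs_l2 f" "\<And>x y. norm x = norm y \<Longrightarrow> f x = f y"
    by (rule radialE[OF u]) blast
  show ?thesis
    unfolding f(2) dilate_abs[OF f(1) c]
    by (rule radialI[OF square_integrable_dilate[OF f(1) c]]) (rule f(3), simp)
qed

text \<open>The Jacobian c^3 and the homogeneity -1 of the kernel combine to c^2.\<close>

lemma coulomb_dilate:
  assumes [measurable]: "f \<in> borel_measurable borel" and c: "c > 0"
  shows "coulomb (\<lambda>y. f (c *\<^sub>R y)) x = coulomb f (c *\<^sub>R x) / c^2"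
proof -
  have "coulomb f (c *\<^sub>R x) = c ^ 3 * (LINT y|lborel. f (c *\<^sub>R y) / norm (c *\<^sub>R x - c *\<^sub>R y))"
    unfolding coulomb_def
    using c by (subst lborel_integral_affine[of _ c 0]) simp_all
  also have "(LINT y|lborel. f (c *\<^sub>R y) / norm (c *\<^sub>R x - c *\<^sub>R y)) = (LINT y|lborel. (1 / c) * (f (c *\<^sub>R y) / norm (x - y)))"
    using c by (simp flip: scaleR_diff_right)
  also have "\<dots> = (1 / c) * coulomb (\<lambda>y. f (c *\<^sub>R y)) x"
    by (simp only: integral_mult_right_zero coulomb_def)
  finally show ?thesis using c by (simp add: power2_eq_square power3_eq_cube)
qed

lemma tri_dilate:
  assumes c: "c > 0" and ab: "a \<in> H2" "b \<in> H2" "dilate c a \<in> H2" "dilate c b \<in> H2"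
  shows "tri (dilate c a) (dilate c b) (dilate c d) = (1 / c^2) *\<^sub>R dilate c (tri a b d)"
proof -
  let ?t = "\<lambda>x. potential a b x * rep_l2 d x"
  have tq: "square_integrable ?t" by (rule tri_L2[OF ab(1,2) square_integrable_rep])
  have "tri (dilate c a) (dilate c b) (dilate c d) =
      abs_l2 (\<lambda>x. coulomb (\<lambda>y. rep_l2 a (c *\<^sub>R y) * rep_l2 b (c *\<^sub>R y)) x * rep_l2 d (c *\<^sub>R x))"
    by (intro tri_eq ab square_integrable_dilate square_integrable_rep c rep_dilate)
  also have "\<dots> = abs_l2 (\<lambda>x. (1 / c^2) *\<^sub>R ?t (c *\<^sub>R x))"
    using coulomb_dilate[of "\<lambda>y. rep_l2 a y * rep_l2 b y" c] c by simp
  also have "\<dots> = (1 / c^2) *\<^sub>R dilate c (tri a b d)"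
    unfolding tri_def dilate_abs[OF tq c] by (intro abs_l2_scaleR[symmetric] square_integrable_dilate tq c)
  finally show ?thesis .
qed

text \<open>Parabolic scaling: a dilation of space by c goes with a factor c^2 in time.\<close>

lemma heat_kernel_dilate:
  assumes c: "c > 0"
  shows "heat_kernel m (t / c^2) x = c ^ 3 * heat_kernel m t (c *\<^sub>R x)"
proof -
  have "sqrt (m / (t / c^2)) = c * sqrt (m / t)"
    using c by (simp add: real_sqrt_mult real_sqrt_divide field_simps)
  then show ?thesis using c by (simp add: heat_kernel_def power_mult_distrib power_divide mult_ac)
qed

lemma res_kernel_dilate:
  assumes c: "c > 0"
  shows "res_kernel m (c^2 * w) x = c * res_kernel m w (c *\<^sub>R x)"
proof -
  let ?g = "\<lambda>t. indicator {0<..} t * exp (- (c^2 * w) * t) * heat_kernel m t x :: real"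
  have "res_kernel m (c^2 * w) x = \<bar>1 / c^2\<bar> *\<^sub>R (LINT t|lborel. ?g (0 + 1 / c^2 * t))"
    unfolding res_kernel_def using c by (intro lborel_integral_real_affine) auto
  also have "(LINT t|lborel. ?g (0 + 1 / c^2 * t)) =
      (LINT t|lborel. c ^ 3 * (indicator {0<..} t * exp (- w * t) * heat_kernel m t (c *\<^sub>R x)))"
  proof (intro Bochner_Integration.integral_cong refl)
    fix t
    show "?g (0 + 1 / c^2 * t) = c ^ 3 * (indicator {0<..} t * exp (- w * t) * heat_kernel m t (c *\<^sub>R x))"
      using c heat_kernel_dilate[OF c, of m t x] by (simp add: indicator_def zero_less_divide_iff)
  qed
  also have "\<bar>1 / c^2\<bar> *\<^sub>R \<dots> = c * res_kernel m w (c *\<^sub>R x)"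
    unfolding integral_mult_right_zero res_kernel_def[symmetric]
    using c by (simp add: power2_eq_square power3_eq_cube)
  finally show ?thesis .
qed

text \<open>The scaling law of P(D), put in terms of resolvents, where it is a substitution in the
  convolution and involves no dilation of Fourier transforms.\<close>

lemma res_dilate:
  assumes m: "m > 0" and w: "w > 0" and c: "c > 0"
  shows "res m (c^2 * w) (dilate c u) = (1 / c^2) *\<^sub>R dilate c (res m w u)"
proof -
  have w': "c^2 * w > 0" using w c by simp
  let ?K = "res_kernel m w"
  have [measurable]: "?K \<in> borel_measurable borel" "res_kernel m (c^2 * w) \<in> borel_measurable borel"
    by (intro l2_measurable res_kernel_L2 m w w')+
  have q: "square_integrable (convolve ?K (rep_l2 u))" by (rule square_integrable_res[OF m w])
  have e: "convolve (res_kernel m (c^2 * w)) (rep_l2 (dilate c u)) x = (1 / c^2) *\<^sub>R convolve ?K (rep_l2 u) (c *\<^sub>R x)" for x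
  proof -
    have "convolve (res_kernel m (c^2 * w)) (rep_l2 (dilate c u)) x =
        convolve (res_kernel m (c^2 * w)) (\<lambda>y. rep_l2 u (c *\<^sub>R y)) x"
      by (intro convolve_cong_AE rep_dilate c) measurable
    also have "\<dots> = (LINT y|lborel. c * (?K (c *\<^sub>R x - c *\<^sub>R y) * rep_l2 u (c *\<^sub>R y)))"
      unfolding convolve_def res_kernel_dilate[OF c] scaleR_diff_right by (simp only: mult.assoc)
    also have "\<dots> = c * (LINT y|lborel. ?K (c *\<^sub>R x - c *\<^sub>R y) * rep_l2 u (c *\<^sub>R y))"
      by (rule integral_mult_right_zero)
    finally have 1: "convolve (res_kernel m (c^2 * w)) (rep_l2 (dilate c u)) x =
      c * (LINT y|lborel. ?K (c *\<^sub>R x - c *\<^sub>R y) * rep_l2 u (c *\<^sub>R y))" .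
    have "convolve ?K (rep_l2 u) (c *\<^sub>R x) = c ^ 3 * (LINT y|lborel. ?K (c *\<^sub>R x - c *\<^sub>R y) * rep_l2 u (c *\<^sub>R y))"
      unfolding convolve_def using c by (subst lborel_integral_affine[of _ c 0]) simp_all
    then show ?thesis using 1 c by (simp add: power2_eq_square power3_eq_cube)
  qed
  have "res m (c^2 * w) (dilate c u) = abs_l2 (\<lambda>x. (1 / c^2) *\<^sub>R convolve ?K (rep_l2 u) (c *\<^sub>R x))"
    unfolding res_def by (rule arg_cong[where f=abs_l2], rule ext) (rule e)
  also have "\<dots> = (1 / c^2) *\<^sub>R dilate c (res m w u)"
    unfolding res_def dilate_abs[OF q c] by (intro abs_l2_scaleR[symmetric] square_integrable_dilate q c)
  finally show ?thesis .
qed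

text \<open>u is in the range of a resolvent, and the scaling law puts its dilation, up to a factor,
  into the range of another one; such ranges lie in H2.\<close>

lemma sobolev_dilate:
  assumes c: "c > 0" and u: "u \<in> H2"
  shows "dilate c u \<in> H2"
proof -
  let ?f = "P_op 1 u + 1 *\<^sub>R u"
  have c2: "c^2 > 0" using c by simp
  have "res 1 (c^2 * 1) (dilate c ?f) = (1 / c^2) *\<^sub>R dilate c u"
    using res_dilate[of 1 1 c ?f] res_left_inverse[of 1 1 u] c u by simp
  then have "(1 / c^2) *\<^sub>R dilate c u \<in> H2"
    using res_sobolev(1)[of 1 "c^2" "c^2" "dilate c ?f"] c2 by simp
  from sobolev_scaleR[OF this, of "c^2"] show ?thesis using c by simp
qed

subsection \<open>The linearised operator\<close>

text \<open>At s = 0 the Sobolev condition is void by Plancherel, so closure properties of radial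
  functions follow from those of the Sobolev spaces.\<close>

lemma radial_sobolev_0_iff: "u \<in> radial_sobolev 0 \<longleftrightarrow> radial u"
  by (simp add: radial_sobolev_def sobolev_0)

lemma radial_add: "radial u \<Longrightarrow> radial v \<Longrightarrow> radial (u + v)"
  using radial_sobolev_add[of u 0 v] by (simp add: radial_sobolev_0_iff)

lemma radial_scaleR: "radial u \<Longrightarrow> radial (c *\<^sub>R u)"
  using radial_sobolev_scaleR[of u 0 c] by (simp add: radial_sobolev_0_iff)

lemma radial_diff: "radial u \<Longrightarrow> radial v \<Longrightarrow> radial (u - v)"
  using radial_add[of u "(-1) *\<^sub>R v"] radial_scaleR[of v "-1"] by simp

lemma sobolev_diff: "u \<in> sobolev s \<Longrightarrow> v \<in> sobolev s \<Longrightarrow> u - v \<in> sobolev s"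
  using sobolev_add[of u s "(-1) *\<^sub>R v"] sobolev_scaleR[of v s "-1"] by simp

lemma hartree_deriv_add:
  assumes "u \<in> H2" "\<phi> \<in> H2" "\<psi> \<in> H2"
  shows "hartree_deriv u (\<phi> + \<psi>) = hartree_deriv u \<phi> + hartree_deriv u \<psi>"
  using assms by (simp add: hartree_deriv_eq_tri sobolev_add tri_add3 tri_add2 scaleR_add_right)

lemma hartree_deriv_scaleR:
  assumes "u \<in> H2" "\<phi> \<in> H2"
  shows "hartree_deriv u (c *\<^sub>R \<phi>) = c *\<^sub>R hartree_deriv u \<phi>"
  using assms by (simp add: hartree_deriv_eq_tri sobolev_scaleR tri_scaleR3 tri_scaleR2 scaleR_add_right)

lemma linearized_add:
  assumes "m > 0" "u \<in> H2" "\<phi> \<in> H2" "\<psi> \<in> H2"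
  shows "linearized m w u (\<phi> + \<psi>) = linearized m w u \<phi> + linearized m w u \<psi>"
  using assms by (simp add: linearized_def fourier_multiplier_add hartree_deriv_add scaleR_add_right)

lemma linearized_scaleR:
  assumes "m > 0" "u \<in> H2" "\<phi> \<in> H2"
  shows "linearized m w u (c *\<^sub>R \<phi>) = c *\<^sub>R linearized m w u \<phi>"
  using assms by (simp add: linearized_def fourier_multiplier_scaleR hartree_deriv_scaleR algebra_simps)

lemma radial_hartree:
  assumes "u \<in> H2r"
  shows "radial (hartree u)"
  using assms by (auto simp: hartree_eq_tri radial_sobolev_def intro: radial_tri)

lemma radial_hartree_deriv:
  assumes "u \<in> H2r" "\<phi> \<in> H2r"
  shows "radial (hartree_deriv u \<phi>)"
  using assms by (auto simp: hartree_deriv_eq_tri radial_sobolev_def intro!: radial_tri radial_add radial_scaleR)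

text \<open>The rescaled ground states c^2 u(c x) solve the equation with multiplier c^2 w and have
  squared norm c. Their difference from u, divided by c - 1, therefore tends to -2 w times the
  preimage of u, and its scalar product with u tends to 1/2. Difference quotients replace the
  derivative x . grad u, for which membership in H2 would need decay estimates.\<close>

lemma ground_state_preimage_not_orthogonal:
  assumes m: "m > 0" and w: "w > 0" and u: "u \<in> H2r" and u1: "norm u = 1"
    and EL: "P_op m u + w *\<^sub>R u = hartree u"
    and inv: "\<And>\<phi>. \<phi> \<in> H2r \<Longrightarrow> norm_H2 \<phi> \<le> C * norm (linearized m w u \<phi>)"
    and eta: "\<eta> \<in> H2r" "linearized m w u \<eta> = u"
  shows "u \<bullet> \<eta> \<noteq> 0"
proof
  assume orth: "u \<bullet> \<eta> = 0"
  have us: "u \<in> H2" and ur: "radial u" and es: "\<eta> \<in> H2" and er: "radial \<eta>"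
    using u eta by (auto simp: radial_sobolev_def)
  let ?T = "linearized m w u"
  \<comment> \<open>The estimate \<open>inv\<close> at u itself, with norm u = 1, forces C to be
    positive.\<close>
  have C0: "C > 0"
  proof -
    have "0 < norm u" using u1 by simp
    also have "norm u \<le> norm_H2 u" by (rule sobolev_2_imp(3)[OF us])
    also have "\<dots> \<le> C * norm (?T u)" by (rule inv[OF u])
    finally show ?thesis by (auto simp: zero_less_mult_iff)
  qed
  define d where "d n = 1 / real (Suc n)" for n
  define c where "c n = 1 + d n" for n
  define v where "v n = (c n)^2 *\<^sub>R dilate (c n) u" for n
  define z where "z n = v n - u" for n
  \<comment> \<open>The change of the multiplier, from w to c^2 w.\<close>
  define g where "g n = ((c n)^2 - 1) * w" for n
  define s where "s n = norm_H2 (z n)" for n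
  let ?A = "\<lambda>v. P_op m v + w *\<^sub>R v"
  let ?Q = "\<lambda>n. hartree_remainder u (z n)"
  have d: "d n > 0" "d n \<le> 1" for n by (simp_all add: d_def)
  have d0: "d \<longlonglongrightarrow> 0" unfolding d_def by (rule lim_1_over_n[THEN LIMSEQ_Suc, unfolded o_def])
  have c: "c n > 0" "c n \<ge> 1 / 2" "c n \<le> 2" for n using d[of n] by (simp_all add: c_def)
  have c1: "c \<longlonglongrightarrow> 1" unfolding c_def using tendsto_add[OF tendsto_const d0, of 1] by simp
  have vs: "v n \<in> H2" for n
    unfolding v_def by (intro sobolev_scaleR sobolev_dilate c us)
  have vr: "radial (v n)" for n
    unfolding v_def by (intro radial_scaleR radial_dilate c ur)
  have zs: "z n \<in> H2" for n unfolding z_def by (intro sobolev_diff vs us)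
  have zr: "z n \<in> H2r" for n
    using zs unfolding radial_sobolev_def z_def by (auto intro!: radial_diff vr ur)
  have ures: "res m w (hartree u) = u"
    using res_left_inverse[OF m w us] by (simp add: EL)
  have Hv: "hartree (v n) = (c n) ^ 4 *\<^sub>R dilate (c n) (hartree u)" for n
  proof -
    let ?D = "dilate (c n) u"
    have D: "?D \<in> H2" by (intro sobolev_dilate c us)
    have "hartree (v n) = ((c n)^2 * (c n)^2 * (c n)^2) *\<^sub>R tri ?D ?D ?D"
      unfolding hartree_eq_tri v_def
      by (simp add: tri_scaleR1 tri_scaleR2 tri_scaleR3 sobolev_scaleR D)
    also have "tri ?D ?D ?D = (1 / (c n)^2) *\<^sub>R dilate (c n) (hartree u)"
      unfolding hartree_eq_tri by (intro tri_dilate c us D)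
    also have "((c n)^2 * (c n)^2 * (c n)^2) *\<^sub>R \<dots> = (c n) ^ 4 *\<^sub>R dilate (c n) (hartree u)"
      using c(1)[of n] by (simp add: eval_nat_numeral)
    finally show ?thesis .
  qed
  \<comment> \<open>The cubic term acquires c^4 and the resolvent c^(-2), so the resolvent at c^2 w
    applied to \<open>hartree (v n)\<close> returns c^2 u(c x).\<close>
  have vEL: "P_op m (v n) + ((c n)^2 * w) *\<^sub>R v n = hartree (v n)" for n
  proof -
    have w': "(c n)^2 * w > 0" using c(1)[of n] w by simp
    have "res m ((c n)^2 * w) (hartree (v n)) = (c n) ^ 4 *\<^sub>R ((1 / (c n)^2) *\<^sub>R dilate (c n) u)"
      by (simp only: Hv res_scaleR[OF m w'] res_dilate[OF m w c(1)] ures)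
    also have "\<dots> = v n" using c(1)[of n] by (simp add: v_def eval_nat_numeral)
    finally show ?thesis using res_solves[OF m w', of "hartree (v n)"] by simp
  qed
  have Az: "?A (z n) = hartree (v n) - hartree u - g n *\<^sub>R v n" for n
  proof -
    have "P_op m (z n + u) = P_op m (z n) + P_op m u"
      by (rule fourier_multiplier_add[OF m zs us])
    then have e: "P_op m (z n) = P_op m (v n) - P_op m u"
      by (simp add: z_def)
    have "?A (z n) =
      (P_op m (v n) + ((c n)^2 * w) *\<^sub>R v n) - (?A u) - g n *\<^sub>R v n"
      unfolding e by (simp add: z_def g_def algebra_simps)
    then show ?thesis unfolding vEL EL .
  qed
  \<comment> \<open>c^4 from the amplitude, c^(-3) from the volume. That the squared norm varies at
    first order in c - 1 is the source of the contradiction.\<close>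
  have nv: "(norm (v n))^2 = c n" for n
  proof -
    have "(norm (v n))^2 = ((c n)^2)^2 * (norm (dilate (c n) u))^2"
      by (simp add: v_def power_mult_distrib)
    also have "\<dots> = c n * (c n ^ 3 * (norm (dilate (c n) u))^2)"
      by (simp add: power2_eq_square power3_eq_cube)
    finally show ?thesis by (simp add: norm_dilate[OF c(1)] u1)
  qed
  have nv2: "norm (v n) \<le> 2" for n
  proof (rule power2_le_imp_le)
    show "(norm (v n))^2 \<le> 2^2" unfolding nv using c(3)[of n] by simp
  qed simp
  \<comment> \<open>Continuity of dilations is available in L2 only. Convergence of z in H2 is
    recovered from z = R (A z), where A z is expressed by dilations of fixed L2 functions.\<close>
  have "(\<lambda>n. norm (hartree (v n) - hartree u - g n *\<^sub>R v n)) \<longlonglongrightarrow>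
      norm (1 ^ 4 *\<^sub>R hartree u - hartree u - ((1^2 - 1) * w) *\<^sub>R (1^2 *\<^sub>R u))"
    unfolding Hv g_def unfolding v_def
    by (intro tendsto_norm tendsto_diff tendsto_scaleR tendsto_mult tendsto_power tendsto_const dilate_tendsto c1 c)
  then have r0: "(\<lambda>n. norm (?A (z n))) \<longlonglongrightarrow> 0" unfolding Az by simp
  have "(\<lambda>n. (2 * m + 1 / w) * norm (?A (z n))) \<longlonglongrightarrow> 0"
    by (rule tendsto_mult_right_zero[OF r0])
  then have z0: "s \<longlonglongrightarrow> 0"
  proof (rule tendsto_sandwich[rotated 3])
    show "\<forall>\<^sub>F n in sequentially. s n \<le> (2 * m + 1 / w) * norm (?A (z n))"
    proof (intro always_eventually allI)
      fix n
      show "s n \<le> (2 * m + 1 / w) * norm (?A (z n))"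
        using res_sobolev(2)[OF m w order_refl, of "?A (z n)"]
        by (simp add: res_left_inverse[OF m w zs] s_def)
    qed
  qed (auto simp: s_def sobolev_norm_nonneg)
  have s0: "0 \<le> s n" for n by (simp add: s_def sobolev_norm_nonneg)
  have zn: "norm (z n) \<le> s n" for n unfolding s_def by (rule sobolev_2_imp(3)[OF zs])
  obtain Q where Q: "Q > 0" "\<And>u w. u \<in> H2 \<Longrightarrow> w \<in> H2 \<Longrightarrow>
     norm (hartree_remainder u w) \<le> Q * (norm_H2 u + norm_H2 w) * (norm_H2 w)^2"
    by (rule hartree_deriv_bound) blast
  have Lz: "?T (z n) = ?Q n - g n *\<^sub>R v n" for n
    using Az[of n] hartree_expand[OF us zs, of n] by (simp add: linearized_def z_def algebra_simps)
  have c2: "(c n)^2 - 1 = (2 + d n) * d n" for n by (simp add: c_def power2_eq_square algebra_simps)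
  have c2b: "0 \<le> g n" "g n \<le> 3 * w * d n" for n
  proof -
    show "0 \<le> g n" unfolding g_def c2 using d[of n] w by simp
    have "(2 + d n) * d n * w \<le> 3 * d n * w" using d[of n] w by (intro mult_right_mono) auto
    then show "g n \<le> 3 * w * d n" unfolding g_def c2 by (simp add: mult_ac)
  qed
  let ?N = "norm_H2 u"
  have "(\<lambda>n. C * Q * (?N + s n) * s n) \<longlonglongrightarrow> C * Q * (?N + 0) * 0"
    by (intro tendsto_intros z0)
  then have ev1: "\<forall>\<^sub>F n in sequentially. C * Q * (?N + s n) * s n < 1 / 2"
    by (rule order_tendstoD) simp
  have ev2: "\<forall>\<^sub>F n in sequentially. s n < 1"
    by (rule order_tendstoD[OF z0]) simp
  \<comment> \<open>The estimate gives s <= C (|Q| + 6 w d); when the quadratic term is absorbed as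
    s / 2, this becomes s <= 12 C w d.\<close>
  define B where "B = 12 * C * w"
  have B0: "B > 0" using C0 w by (simp add: B_def)
  have zB: "s n \<le> B * d n"
    if n: "C * Q * (?N + s n) * s n < 1 / 2" for n
  proof -
    have "s n \<le> C * norm (?T (z n))" unfolding s_def by (rule inv[OF zr])
    also have "\<dots> \<le> C * (norm (?Q n) + (3 * w * d n) * 2)"
    proof (intro mult_left_mono)
      have "norm (?T (z n)) \<le> norm (?Q n) + g n * norm (v n)"
        unfolding Lz using norm_triangle_ineq4[of "?Q n" "g n *\<^sub>R v n"] c2b(1)[of n] by simp
      also have "g n * norm (v n) \<le> (3 * w * d n) * 2"
        by (rule mult_mono[OF c2b(2) nv2]) (use d[of n] w in auto)
      finally show "norm (?T (z n)) \<le> norm (?Q n) + (3 * w * d n) * 2" by simp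
    qed (use C0 in simp)
    also have "\<dots> \<le> C * (Q * (?N + s n) * s n^2 + (3 * w * d n) * 2)"
      using Q(2)[OF us zs, of n, folded s_def] C0 by (intro mult_left_mono add_right_mono) auto
    also have "\<dots> = (C * Q * (?N + s n) * s n) * s n + B / 2 * d n" by (simp add: B_def algebra_simps power2_eq_square)
    also have "\<dots> \<le> 1 / 2 * s n + B / 2 * d n"
      using n s0[of n] by (intro add_right_mono mult_right_mono) auto
    finally show ?thesis by simp
  qed
  \<comment> \<open>The linear part of z cancels: T (z + g \<eta>) = Q - g z is of order d^2, and K
    collects the coefficients.\<close>
  define K where "K = C * (Q * (?N + 1) * B^2 + 3 * w * B)"
  have zeta: "norm (z n + g n *\<^sub>R \<eta>) \<le> K * (d n)^2"
    if n: "C * Q * (?N + s n) * s n < 1 / 2" "s n < 1" for n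
  proof -
    have sB: "s n \<le> B * d n" by (rule zB[OF n(1)])
    have r: "z n + g n *\<^sub>R \<eta> \<in> H2r"
      by (intro radial_sobolev_add radial_sobolev_scaleR zr eta)
    have "?T (z n + g n *\<^sub>R \<eta>) = ?T (z n) + g n *\<^sub>R u"
      by (simp add: linearized_add linearized_scaleR m us zs es sobolev_scaleR eta)
    also have "\<dots> = ?Q n - g n *\<^sub>R z n"
      unfolding Lz by (simp add: z_def algebra_simps)
    finally have L: "?T (z n + g n *\<^sub>R \<eta>) = ?Q n - g n *\<^sub>R z n" .
    have s2: "s n^2 \<le> (B * d n)^2" using sB s0[of n] by (rule power_mono)
    have "norm (?Q n) \<le> Q * (?N + s n) * s n^2" unfolding s_def by (rule Q(2)[OF us zs])
    also have "\<dots> \<le> Q * (?N + 1) * (B * d n)^2"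
      by (rule mult_mono[OF mult_left_mono s2]) (use Q(1) n(2) sobolev_norm_nonneg[of 2 u] in auto)
    finally have 1: "norm (?Q n) \<le> Q * (?N + 1) * (B * d n)^2" .
    have 2: "norm (g n *\<^sub>R z n) \<le> (3 * w * d n) * (B * d n)"
    proof -
      have "norm (g n *\<^sub>R z n) = g n * norm (z n)" using c2b(1)[of n] by simp
      also have "\<dots> \<le> (3 * w * d n) * (B * d n)"
        by (rule mult_mono[OF c2b(2) order_trans[OF zn sB]]) (use d[of n] w in auto)
      finally show ?thesis .
    qed
    have "norm (z n + g n *\<^sub>R \<eta>) \<le> norm_H2 (z n + g n *\<^sub>R \<eta>)"
      using r by (intro sobolev_2_imp(3)) (simp add: radial_sobolev_def)
    also have "\<dots> \<le> C * norm (?Q n - g n *\<^sub>R z n)"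
      using inv[OF r] unfolding L .
    also have "\<dots> \<le> C * (Q * (?N + 1) * (B * d n)^2 + (3 * w * d n) * (B * d n))"
      using norm_triangle_ineq4[of "?Q n" "g n *\<^sub>R z n"] 1 2 C0 by (intro mult_left_mono) auto
    also have "\<dots> = K * (d n)^2" by (simp add: K_def power2_eq_square algebra_simps)
    finally show ?thesis .
  qed
  \<comment> \<open>c = |u + z|^2 gives d = 2 <u, z> + |z|^2. By orthogonality <u, z> = <u, z + g
    \<eta>>, so the right side is of order d^2, which fails for small d.\<close>
  have key: "1 \<le> (B^2 + 2 * K) * d n"
    if n: "C * Q * (?N + s n) * s n < 1 / 2" "s n < 1" for n
  proof -
    have "c n = (norm (u + z n))^2" using nv[of n] by (simp add: z_def)
    also have "\<dots> = 1 + 2 * (u \<bullet> z n) + (norm (z n))^2"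
      using u1 by (simp add: power2_norm_eq_inner inner_add inner_commute norm_eq_1)
    finally have "d n = 2 * (u \<bullet> z n) + (norm (z n))^2" by (simp add: c_def)
    also have "u \<bullet> z n = u \<bullet> (z n + g n *\<^sub>R \<eta>)"
      by (simp add: inner_add_right orth)
    also have "\<dots> \<le> norm (z n + g n *\<^sub>R \<eta>)"
      using norm_cauchy_schwarz[of u "z n + g n *\<^sub>R \<eta>"] u1 by simp
    also have "\<dots> \<le> K * (d n)^2" by (rule zeta[OF n])
    also have "(norm (z n))^2 \<le> (B * d n)^2"
      using zn[of n] zB[OF n(1)] by (intro power_mono) auto
    finally have "1 * d n \<le> ((B^2 + 2 * K) * d n) * d n" by (simp add: power2_eq_square algebra_simps)
    then show ?thesis by (rule mult_right_le_imp_le) (rule d)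
  qed
  have "(\<lambda>n. (B^2 + 2 * K) * d n) \<longlonglongrightarrow> 0" by (rule tendsto_mult_right_zero[OF d0])
  then have "\<forall>\<^sub>F n in sequentially. (B^2 + 2 * K) * d n < 1" by (rule order_tendstoD) simp
  with ev1 ev2 have "\<forall>\<^sub>F n in sequentially. False"
    by eventually_elim (use key in fastforce)
  then show False by simp
qed

subsection \<open>The derivative and its inverse\<close>

lemma has_derivative_quadratic_remainder:
  fixes f :: "'a::real_normed_vector \<Rightarrow> 'b::real_normed_vector"
  assumes L: "bounded_linear L" and d: "d > 0"
    and b: "\<And>h. norm h < d \<Longrightarrow> norm (f (x + h) - f x - L h) \<le> C * (norm h)^2"
  shows "(f has_derivative L) (at x)"
  unfolding has_derivative_at
proof (intro conjI L)
  have l: "((\<lambda>h. C * norm h) \<longlongrightarrow> 0) (at (0 :: 'a))"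
    by (rule tendsto_mult_right_zero[OF tendsto_norm_zero[OF tendsto_ident_at]])
  have e: "\<forall>\<^sub>F h in at 0. norm (norm (f (x + h) - f x - L h) / norm h) \<le> C * norm h"
    unfolding eventually_at
  proof (intro exI[of _ d] conjI d ballI impI)
    fix h :: 'a assume h: "h \<noteq> 0 \<and> dist h 0 < d"
    then have "norm (f (x + h) - f x - L h) \<le> (C * norm h) * norm h"
      using b[of h] by (simp add: power2_eq_square mult.assoc)
    then show "norm (norm (f (x + h) - f x - L h) / norm h) \<le> C * norm h"
      using h by (simp add: divide_le_eq)
  qed
  show "((\<lambda>h. norm (f (x + h) - f x - L h) / norm h) \<longlongrightarrow> 0) (at 0)"
    by (rule Lim_null_comparison[OF e l])
qed

text \<open>The explicit lower bound takes the place of the open mapping theorem, which would ask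
  for completeness of the spaces.\<close>

lemma bounded_linear_inv_of_lower_bound:
  assumes L: "bounded_linear L" and s: "surj L" and K: "\<And>x. norm x \<le> K * norm (L x)"
  shows "bij L" "bounded_linear (inv L)"
proof -
  have lin: "linear L" by (rule bounded_linear.linear[OF L])
  have "x = 0" if "L x = 0" for x using K[of x] that by simp
  then have i: "inj L" by (simp add: linear_injective_0[OF lin])
  then show "bij L" using s by (simp add: bij_def)
  have fi: "L (inv L y) = y" for y by (rule surj_f_inv_f[OF s])
  show "bounded_linear (inv L)"
  proof (rule bounded_linear_intro[of _ K])
    show "inv L (x + y) = inv L x + inv L y" for x y
      by (rule inv_f_eq[OF i]) (simp add: linear_add[OF lin] fi)
    show "inv L (r *\<^sub>R x) = r *\<^sub>R inv L x" for r x
      by (rule inv_f_eq[OF i]) (simp add: linear_scale[OF lin] fi)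
    show "norm (inv L x) \<le> norm x * K" for x
      using K[of "inv L x"] by (simp add: fi mult.commute)
  qed
qed

lemma l2_of_h2r_sobolev: "l2_of_h2r \<phi> \<in> H2r" "l2_of_h2r \<phi> \<in> H2" "radial (l2_of_h2r \<phi>)"
  using l2_of_h2r[of \<phi>] by (simp_all add: radial_sobolev_def)

lemma norm_l2_of_h2r_le: "norm (l2_of_h2r \<phi>) \<le> norm \<phi>"
  unfolding norm_h2r.rep_eq by (rule sobolev_2_imp(3)[OF l2_of_h2r_sobolev(2)])

lemma bounded_linear_l2_of_h2r: "bounded_linear l2_of_h2r"
  by (rule bounded_linear_intro[of _ 1]) (simp_all add: plus_h2r.rep_eq scaleR_h2r.rep_eq norm_l2_of_h2r_le)

lemma res_radial_sobolev:
  assumes "m > 0" "w > 0" "radial f"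
  shows "res m w f \<in> H2r"
  using res_sobolev(1)[OF assms(1,2) order_refl] radial_res[OF assms] by (simp add: radial_sobolev_def)

lemma l2_of_h2r_res:
  assumes "m > 0" "w > 0" "radial f"
  shows "l2_of_h2r (h2r_of_l2 (res m w f)) = res m w f"
  by (rule h2r_of_l2_inverse[OF res_radial_sobolev[OF assms]])

lemma norm_h2r_res:
  assumes "m > 0" "w0 > 0" "w0 \<le> w" "radial f"
  shows "norm (h2r_of_l2 (res m w f)) \<le> (2 * m + 1 / w0) * norm f"
proof -
  have "w > 0" using assms by simp
  then show ?thesis
    unfolding norm_h2r.rep_eq using res_sobolev(2)[OF assms(1-3)] assms by (simp add: l2_of_h2r_res)
qed

section \<open>Frechet derivative of the map at \<beta> = 0\<close>

definition linearization :: "real \<Rightarrow> real \<Rightarrow> real l2 \<Rightarrow> h2r \<times> real \<Rightarrow> h2r \<times> real" where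
  "linearization m w u = (\<lambda>x. (fst x - h2r_of_l2 (res m w (hartree_deriv u (l2_of_h2r (fst x))))
     + snd x *\<^sub>R h2r_of_l2 (res m w (res m w (hartree u))), 2 * (u \<bullet> l2_of_h2r (fst x))))"

lemma bounded_linear_linearization:
  assumes m: "m > 0" and w: "w > 0" and u: "u \<in> H2r"
  shows "bounded_linear (linearization m w u)"
proof -
  have us: "u \<in> H2" using u by (simp add: radial_sobolev_def)
  obtain C where C: "C > 0" "\<And>u \<phi>. u \<in> H2 \<Longrightarrow> \<phi> \<in> H2 \<Longrightarrow>
     norm (hartree_deriv u \<phi>) \<le> C * (norm_H2 u)^2 * norm_H2 \<phi>"
    by (rule hartree_deriv_bound) blast
  let ?A = "\<lambda>\<phi>. h2r_of_l2 (res m w (hartree_deriv u (l2_of_h2r \<phi>)))"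
  have r: "radial (hartree_deriv u (l2_of_h2r \<phi>))" for \<phi>
    by (rule radial_hartree_deriv[OF u l2_of_h2r_sobolev(1)])
  have A: "bounded_linear ?A"
  proof (rule bounded_linear_intro)
    show "?A (\<phi> + \<psi>) = ?A \<phi> + ?A \<psi>" for \<phi> \<psi>
      by (simp add: l2_of_h2r_inject[symmetric] l2_of_h2r_res m w r plus_h2r.rep_eq[of "?A \<phi>"])
         (simp add: plus_h2r.rep_eq hartree_deriv_add us l2_of_h2r_sobolev res_add m w)
    show "?A (c *\<^sub>R \<phi>) = c *\<^sub>R ?A \<phi>" for c \<phi>
      by (simp add: l2_of_h2r_inject[symmetric] l2_of_h2r_res m w r scaleR_h2r.rep_eq[of c "?A \<phi>"])
         (simp add: scaleR_h2r.rep_eq hartree_deriv_scaleR us l2_of_h2r_sobolev res_scaleR m w)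
    show "norm (?A \<phi>) \<le> norm \<phi> * ((2 * m + 1 / w) * (C * (norm_H2 u)^2))" for \<phi>
    proof -
      have "norm (?A \<phi>) \<le> (2 * m + 1 / w) * norm (hartree_deriv u (l2_of_h2r \<phi>))"
        by (rule norm_h2r_res[OF m w order_refl r])
      also have "\<dots> \<le> (2 * m + 1 / w) * (C * (norm_H2 u)^2 * norm \<phi>)"
        using C(2)[OF us l2_of_h2r_sobolev(2), of \<phi>] m w unfolding norm_h2r.rep_eq by (intro mult_left_mono) auto
      finally show ?thesis by (simp add: mult_ac)
    qed
  qed
  have "bounded_linear (\<lambda>x. u \<bullet> l2_of_h2r (fst x))"
    by (rule bounded_linear_compose[OF bounded_linear_inner_right
        bounded_linear_compose[OF bounded_linear_l2_of_h2r bounded_linear_fst]])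
  then have "bounded_linear (\<lambda>x. 2 * (u \<bullet> l2_of_h2r (fst x)))"
    by (rule bounded_linear_const_mult)
  then show ?thesis
    unfolding linearization_def
    by (intro bounded_linear_Pair bounded_linear_add bounded_linear_sub bounded_linear_fst
        bounded_linear_compose[OF A bounded_linear_fst]
        bounded_linear_compose[OF bounded_linear_scaleR_left bounded_linear_snd])
qed

text \<open>\<open>F_map\<close> is \<open>undefined\<close> off its domain;
  \<open>\<beta>\<^sub>0 > 0\<close> and \<open>w \<in> I\<close> place the arguments
  inside.\<close>

lemma F_map_0:
  assumes "m > 0" "\<beta>\<^sub>0 > 0" "w \<in> I" "w > 0"
  shows "F_map m \<beta>\<^sub>0 I (0, v, w) = (v - h2r_of_l2 (res m w (hartree (l2_of_h2r v))), (norm (l2_of_h2r v))^2 - 1)"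
  using assms by (simp add: F_map_def resolvent_eq_res)

text \<open>For w' = w + \<tau> the resolvent identity turns the remainder into (- R(w') X,
  |\<phi>|^2) exactly, the second entry in the L2 norm, with X at least quadratic in (\<phi>,
  \<tau>). Bounds for X then suffice.\<close>

lemma F_map_has_derivative:
  assumes m: "m > 0" and w: "w > 0" and u: "u \<in> H2r" and b: "\<beta>\<^sub>0 > 0"
    and I: "I \<subseteq> {0<..}" "w \<in> interior I"
  shows "((\<lambda>(v, w). F_map m \<beta>\<^sub>0 I (0, v, w)) has_derivative linearization m w u) (at (h2r_of_l2 u, w))"
proof -
  let ?f = "\<lambda>(v, w). F_map m \<beta>\<^sub>0 I (0, v, w)"
  let ?L = "linearization m w u"
  let ?H = h2r_of_l2
  let ?U = "h2r_of_l2 u"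
  let ?r = "\<lambda>x. ?f ((?U, w) + x) - ?f (?U, w) - ?L x"
  let ?N = "norm_H2 u"
  have us: "u \<in> H2" and ur: "radial u" using u by (auto simp: radial_sobolev_def)
  have U: "l2_of_h2r ?U = u" by (rule h2r_of_l2_inverse[OF u])
  obtain Q where Q: "Q > 0" "\<And>u \<phi>. u \<in> H2 \<Longrightarrow> \<phi> \<in> H2 \<Longrightarrow>
     norm (hartree_deriv u \<phi>) \<le> Q * (norm_H2 u)^2 * norm_H2 \<phi>"
    "\<And>u w. u \<in> H2 \<Longrightarrow> w \<in> H2 \<Longrightarrow>
     norm (hartree_remainder u w) \<le> Q * (norm_H2 u + norm_H2 w) * (norm_H2 w)^2"
    by (rule hartree_deriv_bound) blast
  obtain e where e: "e > 0" "ball w e \<subseteq> I"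
    using I(2) by (auto simp: mem_interior)
  \<comment> \<open>1 lets the cubic part of the Hartree remainder be bounded by a quadratic one, e
    keeps w + \<tau> in I, and w / 2 keeps it at least w / 2, where the resolvents are uniformly
    bounded.\<close>
  define d where "d = min 1 (min e (w / 2))"
  have d: "d > 0" "d \<le> 1" "d \<le> e" "d \<le> w / 2" using e(1) w by (auto simp: d_def)
  let ?R = "res m w"
  let ?h = "hartree u"
  define E where "E = norm (?R (?R ?h))"
  \<comment> \<open>The bound from L2 to H2 for all resolvents at parameters at least w / 2.\<close>
  define K where "K = 2 * m + 1 / (w / 2)"
  have K0: "K \<ge> 0" using m w by (simp add: K_def)
  define M where "M = Q * (?N + 1) + Q * ?N^2 / w + E"
  define C where "C = K * M + 1"
  have N0: "0 \<le> ?N" by (rule sobolev_norm_nonneg)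
  show ?thesis
  proof (rule has_derivative_quadratic_remainder[OF bounded_linear_linearization[OF m w u] d(1)])
    fix x :: "h2r \<times> real" assume x: "norm x < d"
    obtain \<phi> \<tau> where xp: "x = (\<phi>, \<tau>)" by (cases x)
    let ?p = "l2_of_h2r \<phi>"
    have n: "norm \<phi> \<le> norm x" "\<bar>\<tau>\<bar> \<le> norm x"
      using norm_fst_le[of \<phi> \<tau>] norm_snd_le[of \<tau> \<phi>] by (simp_all add: xp)
    have ps: "?p \<in> H2" and pr: "?p \<in> H2r" by (rule l2_of_h2r_sobolev)+
    have np: "norm_H2 ?p = norm \<phi>" by (simp add: norm_h2r.rep_eq)
    define w' where "w' = w + \<tau>"
    have w'I: "w' \<in> I"
      using n(2) x d(3) e(2) by (auto simp: w'_def dist_real_def subset_iff)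
    have w'2: "w / 2 \<le> w'" using n(2) x d(4) by (auto simp: w'_def)
    have w'0: "w' > 0" using w'2 w by simp
    have wI: "w \<in> I" using I(2) interior_subset by auto
    let ?d = "hartree_deriv u ?p" and ?q = "hartree_remainder u ?p"
    define X where "X = ?q - \<tau> *\<^sub>R ?R ?d + \<tau>^2 *\<^sub>R ?R (?R ?h)"
    have hr: "radial ?h" "radial ?d" by (rule radial_hartree[OF u], rule radial_hartree_deriv[OF u pr])
    have upr: "u + ?p \<in> H2r" by (rule radial_sobolev_add[OF u pr])
    have ex: "hartree (u + ?p) = ?h + ?d + ?q" by (rule hartree_expand[OF us ps])
    have qr: "radial ?q"
    proof -
      have "?q = hartree (u + ?p) - ?h - ?d" using ex by simp
      then show ?thesis by (simp add: radial_diff radial_hartree upr hr)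
    qed
    let ?Y = "h2r_of_l2 (res m w' X)"
    have Xr: "radial X"
      unfolding X_def by (intro radial_add radial_diff radial_scaleR radial_res m w qr hr)
    \<comment> \<open>The identity serves once on \<open>?d\<close> and twice on \<open>?h\<close>:
      the part of first order in \<tau> cancels against the correction \<tau> R R \<open>?h\<close>,
      leaving \<tau>^2.\<close>
    have RX: "res m w' (hartree (u + ?p)) - ?R ?h - ?R ?d + \<tau> *\<^sub>R ?R (?R ?h) = res m w' X"
    proof -
      have ri: "res m w' f = ?R f - \<tau> *\<^sub>R res m w' (?R f)" for f
        using resolvent_identity[OF m w w'0, of f] by (simp add: w'_def algebra_simps)
      have "res m w' X = res m w' ?q - \<tau> *\<^sub>R res m w' (?R ?d) + \<tau>^2 *\<^sub>R res m w' (?R (?R ?h))"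
        by (simp add: X_def res_add res_diff res_scaleR m w'0)
      then have 1: "res m w' X = res m w' ?q - \<tau> *\<^sub>R res m w' (?R ?d) + \<tau> *\<^sub>R \<tau> *\<^sub>R res m w' (?R (?R ?h))"
        by (simp add: power2_eq_square)
      have 2: "\<tau> *\<^sub>R res m w' (?R (?R ?h)) = ?R (?R ?h) - res m w' (?R ?h)"
        using ri[of "?R ?h"] by (simp add: algebra_simps)
      have 3: "\<tau> *\<^sub>R res m w' (?R ?d) = ?R ?d - res m w' ?d" "\<tau> *\<^sub>R res m w' (?R ?h) = ?R ?h - res m w' ?h"
        using ri[of ?d] ri[of ?h] by (simp_all add: algebra_simps)
      have "res m w' X = res m w' ?q - (?R ?d - res m w' ?d) + (\<tau> *\<^sub>R ?R (?R ?h) - (?R ?h - res m w' ?h))"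
        unfolding 1 2 scaleR_diff_right 3 ..
      then show ?thesis by (simp add: ex res_add m w'0)
    qed
    have fx: "?r x = (- ?Y, (norm ?p)^2)"
    proof (rule prod_eqI)
      have "fst (?r x) =
          (?U + \<phi> - ?H (res m w' (hartree (u + ?p)))) - (?U - ?H (?R ?h)) -
          (\<phi> - ?H (?R ?d) + \<tau> *\<^sub>R ?H (?R (?R ?h)))"
        using w'I wI w'0 w by (simp add: xp F_map_0 m b linearization_def U plus_h2r.rep_eq flip: w'_def)
      also have "\<dots> = - (?H (res m w' (hartree (u + ?p))) - ?H (?R ?h) - ?H (?R ?d) + \<tau> *\<^sub>R ?H (?R (?R ?h)))"
        by simp
      also have "?H (res m w' (hartree (u + ?p))) - ?H (?R ?h) - ?H (?R ?d) + \<tau> *\<^sub>R ?H (?R (?R ?h)) = ?Y"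
        using RX by (simp add: l2_of_h2r_inject[symmetric] plus_h2r.rep_eq minus_h2r.rep_eq scaleR_h2r.rep_eq
            l2_of_h2r_res m w w'0 hr radial_res radial_hartree[OF upr] Xr)
      finally show "fst (?r x) = fst (- ?Y, (norm ?p)^2)" by simp
      have "snd (?r x) = (norm (u + ?p))^2 - (norm u)^2 - 2 * (u \<bullet> ?p)"
        using w'I wI w'0 w by (simp add: xp F_map_0 m b linearization_def U plus_h2r.rep_eq flip: w'_def)
      also have "\<dots> = (norm ?p)^2"
        by (simp add: power2_norm_eq_inner inner_add inner_commute)
      finally show "snd (?r x) = snd (- ?Y, (norm ?p)^2)" by simp
    qed
    let ?x = "norm x"
    have p2: "(norm \<phi>)^2 \<le> ?x^2" by (rule power_mono[OF n(1)]) simp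
    have t1: "norm ?q \<le> Q * (?N + 1) * ?x^2"
    proof -
      have "norm ?q \<le> Q * (?N + norm \<phi>) * (norm \<phi>)^2" using Q(3)[OF us ps] by (simp only: np)
      also have "\<dots> \<le> Q * (?N + 1) * ?x^2"
        by (rule mult_mono[OF mult_left_mono p2]) (use n(1) x d(2) Q(1) N0 in auto)
      finally show ?thesis .
    qed
    have t2: "norm (\<tau> *\<^sub>R ?R ?d) \<le> Q * ?N^2 / w * ?x^2"
    proof -
      have "norm (?R ?d) \<le> norm ?d / w" by (rule norm_res_le[OF m w])
      also have "\<dots> \<le> (Q * ?N^2 * norm \<phi>) / w"
        using Q(2)[OF us ps] w by (simp add: np divide_right_mono)
      also have "\<dots> = (Q * ?N^2 / w) * norm \<phi>" by simp
      also have "\<dots> \<le> (Q * ?N^2 / w) * ?x" using n(1) Q(1) w by (intro mult_left_mono) auto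
      finally have "\<bar>\<tau>\<bar> * norm (?R ?d) \<le> ?x * ((Q * ?N^2 / w) * ?x)"
        using n(2) by (intro mult_mono) auto
      then show ?thesis by (simp add: power2_eq_square mult_ac)
    qed
    have t3: "norm (\<tau>^2 *\<^sub>R ?R (?R ?h)) \<le> E * ?x^2"
    proof -
      have "\<bar>\<tau>\<bar>^2 \<le> ?x^2" by (rule power_mono[OF n(2)]) simp
      then have "\<bar>\<tau>\<bar>^2 * E \<le> ?x^2 * E" by (rule mult_right_mono) (simp add: E_def)
      then show ?thesis by (simp add: E_def mult.commute)
    qed
    have "norm X \<le> norm ?q + norm (\<tau> *\<^sub>R ?R ?d) + norm (\<tau>^2 *\<^sub>R ?R (?R ?h))"
      unfolding X_def
      using norm_triangle_ineq[of "?q - \<tau> *\<^sub>R ?R ?d" "\<tau>^2 *\<^sub>R ?R (?R ?h)"] norm_triangle_ineq4[of ?q "\<tau> *\<^sub>R ?R ?d"] by linarith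
    also have "\<dots> \<le> M * ?x^2"
      using add_mono[OF add_mono[OF t1 t2] t3] by (simp only: M_def distrib_right)
    finally have X: "norm X \<le> M * ?x^2" .
    have "norm ?Y \<le> K * norm X"
      unfolding K_def by (rule norm_h2r_res[OF m _ w'2 Xr]) (use w in simp)
    also have "\<dots> \<le> K * (M * ?x^2)" by (rule mult_left_mono[OF X K0])
    finally have R: "norm ?Y \<le> K * (M * ?x^2)" .
    have P: "(norm ?p)^2 \<le> ?x^2"
      using norm_l2_of_h2r_le[of \<phi>] n(1) by (intro power_mono) auto
    have "norm (?r x) \<le> norm ?Y + (norm ?p)^2"
      unfolding fx using norm_Pair_le[of "- ?Y" "(norm ?p)^2"] by simp
    also have "\<dots> \<le> C * ?x^2"
      using add_mono[OF R P] by (simp add: C_def distrib_right mult.assoc)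
    finally show "norm (?r x) \<le> C * ?x^2" .
  qed
qed

section \<open>Bijectivity and bounded inverse of the derivative\<close>

lemma linearization_eq:
  assumes m: "m > 0" and w: "w > 0" and u: "u \<in> H2r"
    and EL: "P_op m u + w *\<^sub>R u = hartree u"
    and lin: "\<And>\<phi>. \<phi> \<in> H2r \<Longrightarrow> radial (linearized m w u \<phi>)"
  shows "linearization m w u (\<phi>, \<tau>) =
    (h2r_of_l2 (res m w (linearized m w u (l2_of_h2r \<phi>) + \<tau> *\<^sub>R u)), 2 * (u \<bullet> l2_of_h2r \<phi>))"
proof -
  have us: "u \<in> H2" and ur: "radial u" using u by (auto simp: radial_sobolev_def)
  let ?p = "l2_of_h2r \<phi>"
  \<comment> \<open>The Euler-Lagrange equation under the resolvent, which turns R R N(u) into R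
    u.\<close>
  have ures: "res m w (hartree u) = u"
    using res_left_inverse[OF m w us] by (simp add: EL)
  have "res m w (linearized m w u ?p + \<tau> *\<^sub>R u) =
      res m w ((P_op m ?p + w *\<^sub>R ?p) - hartree_deriv u ?p + \<tau> *\<^sub>R u)"
    by (simp add: linearized_def)
  also have "\<dots> = ?p - res m w (hartree_deriv u ?p) + \<tau> *\<^sub>R res m w u"
    by (simp only: res_add[OF m w, of _ "\<tau> *\<^sub>R u"] res_diff[OF m w] res_scaleR[OF m w, of \<tau>] res_left_inverse[OF m w l2_of_h2r_sobolev(2)])
  finally have e: "res m w (linearized m w u ?p + \<tau> *\<^sub>R u) = ?p - res m w (hartree_deriv u ?p) + \<tau> *\<^sub>R res m w u" .
  have "radial (linearized m w u ?p + \<tau> *\<^sub>R u)"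
    by (intro radial_add radial_scaleR ur lin l2_of_h2r_sobolev)
  from l2_of_h2r_res[OF m w this]
  have "l2_of_h2r (h2r_of_l2 (res m w (linearized m w u ?p + \<tau> *\<^sub>R u))) =
      l2_of_h2r (\<phi> - h2r_of_l2 (res m w (hartree_deriv u ?p)) + \<tau> *\<^sub>R h2r_of_l2 (res m w u))"
    unfolding e by (simp add: plus_h2r.rep_eq minus_h2r.rep_eq scaleR_h2r.rep_eq l2_of_h2r_res m w ur
        radial_hartree_deriv[OF u l2_of_h2r_sobolev(1)])
  then show ?thesis by (simp add: linearization_def ures l2_of_h2r_inject)
qed



text \<open>With A = P + w, solving for (g, \<sigma>) means T \<phi> + \<tau> u = A g and 2 <u,
  \<phi>> = \<sigma>. If T p = A g, the first equation gives \<phi> = p - \<tau> \<eta>, and the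
  second determines \<tau> as <u, \<eta>> is nonzero. The lower bound follows the same
  elimination.\<close>

lemma linearization_invertible:
  assumes m: "m > 0" and w: "w > 0" and u: "u \<in> H2r" and u1: "norm u = 1"
    and EL: "P_op m u + w *\<^sub>R u = hartree u"
    and nondeg: "sobolev_invertible 2 0 (linearized m w u)"
  shows "bij (linearization m w u)" "bounded_linear (inv (linearization m w u))"
    "\<And>\<phi> \<tau>. linearization m w u (\<phi>, \<tau>) =
      (h2r_of_l2 (res m w (linearized m w u (l2_of_h2r \<phi>) + \<tau> *\<^sub>R u)), 2 * (u \<bullet> l2_of_h2r \<phi>))"
proof -
  let ?T = "linearized m w u" and ?L = "linearization m w u"
  have us: "u \<in> H2" and ur: "radial u" using u by (auto simp: radial_sobolev_def)
  obtain C where bij: "bij_betw ?T (H2r) (radial_sobolev 0)"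
    and C: "\<And>\<phi>. \<phi> \<in> H2r \<Longrightarrow> norm_H2 \<phi> \<le> C * norm (?T \<phi>)"
    using nondeg unfolding sobolev_invertible_def by (auto simp: sobolev_0)
  have Tr: "radial (?T \<phi>)" if "\<phi> \<in> H2r" for \<phi>
    using bij_betwE[OF bij] that by (auto simp: radial_sobolev_0_iff)
  have C': "norm_H2 \<phi> \<le> \<bar>C\<bar> * norm (?T \<phi>)" if "\<phi> \<in> H2r" for \<phi>
    using C[OF that] mult_right_mono[OF abs_ge_self[of C] norm_ge_zero[of "?T \<phi>"]] by linarith
  have pre: "\<exists>\<phi>\<in>H2r. ?T \<phi> = f" if "radial f" for f
    using bij_betw_imp_surj_on[OF bij] that by (metis imageE radial_sobolev_0_iff)
  obtain \<eta> where eta: "\<eta> \<in> H2r" "?T \<eta> = u" using pre[OF ur] by blast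
  have es: "\<eta> \<in> H2" using eta by (simp add: radial_sobolev_def)
  let ?a = "u \<bullet> \<eta>"
  have a: "?a \<noteq> 0"
    by (rule ground_state_preimage_not_orthogonal[OF m w u u1 EL C eta])
  let ?A = "\<lambda>g. P_op m g + w *\<^sub>R g"
  show Leq: "?L (\<phi>, \<tau>) = (h2r_of_l2 (res m w (?T (l2_of_h2r \<phi>) + \<tau> *\<^sub>R u)), 2 * (u \<bullet> l2_of_h2r \<phi>))" for \<phi> \<tau>
    by (rule linearization_eq[OF m w u EL Tr])
  have Teta: "?T (p + \<tau> *\<^sub>R \<eta>) = ?T p + \<tau> *\<^sub>R u" if "p \<in> H2r" for p \<tau>
    using that by (simp add: radial_sobolev_def linearized_add linearized_scaleR m us es sobolev_scaleR eta)
  \<comment> \<open>Radiality of A g is read off from the range of T, to which only the Hartree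
    derivative has to be added.\<close>
  have Ar: "radial (?A g)" if g: "g \<in> H2r" for g
  proof -
    have "?A g = ?T g + hartree_deriv u g" by (simp add: linearized_def)
    then show ?thesis by (simp add: radial_add Tr g radial_hartree_deriv u)
  qed
  have surj: "surj ?L"
  proof -
    have "\<exists>x. ?L x = y" for y :: "h2r \<times> real"
    proof -
      define g where "g = l2_of_h2r (fst y)"
      have g: "g \<in> H2r" "g \<in> H2" unfolding g_def by (rule l2_of_h2r_sobolev)+
      obtain p where p: "p \<in> H2r" "?T p = ?A g" using pre[OF Ar[OF g(1)]] by blast
      \<comment> \<open>The solution of 2 <u, p - \<tau> \<eta>> = \<open>snd y\<close>.\<close>
      define \<tau> where "\<tau> = (u \<bullet> p - snd y / 2) / ?a"
      define q where "q = p + (- \<tau>) *\<^sub>R \<eta>"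
      have qr: "q \<in> H2r"
        unfolding q_def by (intro radial_sobolev_add radial_sobolev_scaleR p eta)
      have "?T q = ?A g + (- \<tau>) *\<^sub>R u" unfolding q_def Teta[OF p(1)] p(2) ..
      then have 1: "?T q + \<tau> *\<^sub>R u = ?A g" by simp
      have 2: "2 * (u \<bullet> q) = snd y"
        using a by (simp add: q_def inner_diff_right \<tau>_def)
      have "?L (h2r_of_l2 q, \<tau>) = (h2r_of_l2 g, snd y)"
        unfolding Leq h2r_of_l2_inverse[OF qr] 1 2 res_left_inverse[OF m w g(2)] ..
      then show ?thesis by (intro exI) (simp add: g_def l2_of_h2r_inverse)
    qed
    then show ?thesis by (metis surjI)
  qed
  \<comment> \<open>D bounds z = \<phi> + \<tau> \<eta>, for which T z = A g. S bounds \<tau>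
    through <u, z> - <u, \<phi>>, where 1/2 undoes the factor 2 of the second component. K combines
    both, since \<phi> = z - \<tau> \<eta>.\<close>
  define D where "D = \<bar>C\<bar> * (1 / (2 * m) + w)"
  have D0: "D \<ge> 0" using m w by (simp add: D_def)
  define S where "S = (1 / 2 + D) / \<bar>?a\<bar>"
  have S0: "S \<ge> 0" using D0 by (simp add: S_def)
  define K where "K = D + S * norm_H2 \<eta> + S"
  have K: "norm x \<le> K * norm (?L x)" for x
  proof -
    obtain \<phi> \<tau> where xp: "x = (\<phi>, \<tau>)" by (cases x)
    let ?p = "l2_of_h2r \<phi>" and ?y = "norm (?L x)"
    have pr: "?p \<in> H2r" by (rule l2_of_h2r_sobolev)
    define g where "g = res m w (?T ?p + \<tau> *\<^sub>R u)"
    have fr: "radial (?T ?p + \<tau> *\<^sub>R u)" by (intro radial_add radial_scaleR ur Tr pr)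
    have gr: "g \<in> H2r" unfolding g_def by (rule res_radial_sobolev[OF m w fr])
    have gs: "g \<in> H2" using gr by (simp add: radial_sobolev_def)
    have Lx: "?L x = (h2r_of_l2 g, 2 * (u \<bullet> ?p))" unfolding xp Leq g_def ..
    have ng: "norm_H2 g \<le> ?y"
      using norm_fst_le[of "h2r_of_l2 g" "2 * (u \<bullet> ?p)"] by (simp add: Lx norm_h2r.rep_eq h2r_of_l2_inverse[OF gr])
    have ns: "\<bar>2 * (u \<bullet> ?p)\<bar> \<le> ?y"
      using norm_snd_le[of "2 * (u \<bullet> ?p)" "h2r_of_l2 g"] by (simp add: Lx)
    define z where "z = ?p + \<tau> *\<^sub>R \<eta>"
    have zr: "z \<in> H2r" unfolding z_def by (intro radial_sobolev_add radial_sobolev_scaleR pr eta)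
    have zs: "z \<in> H2" using zr by (simp add: radial_sobolev_def)
    have Tz: "?T z = ?A g"
      unfolding z_def Teta[OF pr] g_def by (rule res_solves[OF m w, symmetric])
    have nz: "norm_H2 z \<le> D * ?y"
    proof -
      have "norm (?A g) \<le> norm (P_op m g) + w * norm g"
        using norm_triangle_ineq[of "P_op m g" "w *\<^sub>R g"] w by simp
      also have "\<dots> \<le> 1 / (2 * m) * norm_H2 g + w * norm_H2 g"
        using w by (intro add_mono mult_left_mono norm_fourier_multiplier_le[OF m gs] sobolev_2_imp(3)[OF gs]) auto
      also have "\<dots> = (1 / (2 * m) + w) * norm_H2 g" by (simp only: distrib_right)
      also have "\<dots> \<le> (1 / (2 * m) + w) * ?y" by (rule mult_left_mono[OF ng]) (use m w in simp)
      finally have A: "norm (?A g) \<le> (1 / (2 * m) + w) * ?y" .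
      have "norm_H2 z \<le> \<bar>C\<bar> * norm (?A g)" using C'[OF zr] unfolding Tz .
      also have "\<dots> \<le> \<bar>C\<bar> * ((1 / (2 * m) + w) * ?y)" by (rule mult_left_mono[OF A]) simp
      finally show ?thesis by (simp add: D_def mult.assoc)
    qed
    have nt: "\<bar>\<tau>\<bar> \<le> S * ?y"
    proof -
      have "\<bar>\<tau> * ?a\<bar> = \<bar>u \<bullet> z - u \<bullet> ?p\<bar>" by (simp add: z_def inner_add_right)
      also have "\<dots> \<le> \<bar>u \<bullet> z\<bar> + \<bar>u \<bullet> ?p\<bar>" by (rule abs_triangle_ineq4)
      also have "\<bar>u \<bullet> z\<bar> \<le> norm z" using Cauchy_Schwarz_ineq2[of u z] u1 by simp
      also have "norm z \<le> D * ?y" using sobolev_2_imp(3)[OF zs] nz by linarith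
      also have "\<bar>u \<bullet> ?p\<bar> \<le> 1 / 2 * ?y" using ns by (simp add: abs_mult)
      finally have "\<bar>\<tau>\<bar> * \<bar>?a\<bar> \<le> (1 / 2 + D) * ?y" by (simp add: abs_mult algebra_simps)
      then show ?thesis using a by (simp add: S_def field_simps)
    qed
    have np: "norm \<phi> \<le> D * ?y + S * ?y * norm_H2 \<eta>"
    proof -
      have "?p = z + (- \<tau>) *\<^sub>R \<eta>" by (simp add: z_def)
      then have "norm \<phi> = norm_H2 (z + (- \<tau>) *\<^sub>R \<eta>)" by (simp add: norm_h2r.rep_eq)
      also have "\<dots> \<le> norm_H2 z + norm_H2 ((- \<tau>) *\<^sub>R \<eta>)"
        by (intro sobolev_norm_add radial_sobolev_scaleR zr eta)
      also have "norm_H2 ((- \<tau>) *\<^sub>R \<eta>) = \<bar>\<tau>\<bar> * norm_H2 \<eta>"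
        using sobolev_norm_scaleR[OF eta(1), of "- \<tau>"] by simp
      also have "\<dots> \<le> S * ?y * norm_H2 \<eta>" by (rule mult_right_mono[OF nt sobolev_norm_nonneg])
      finally show ?thesis using nz by linarith
    qed
    have "norm x \<le> norm \<phi> + \<bar>\<tau>\<bar>" unfolding xp using norm_Pair_le[of \<phi> \<tau>] by simp
    also have "\<dots> \<le> K * ?y" using np nt by (simp add: K_def algebra_simps)
    finally show ?thesis .
  qed
  show "bij ?L" "bounded_linear (inv ?L)"
    by (rule bounded_linear_inv_of_lower_bound[OF bounded_linear_linearization[OF m w u] surj K])+
qed

theorem proposition2p5:
  fixes m \<omega>_inf \<beta>\<^sub>0 :: real and u_inf :: "real l2" and I :: "real set"
  assumes m: "m > 0"
    and minimizer: "energy_minimizer m u_inf" "positive_l2 u_inf" "radial u_inf"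
    and minimizer_unique:
      "\<And>v. energy_minimizer m v \<Longrightarrow> positive_l2 v \<Longrightarrow> radial v \<Longrightarrow> v = u_inf"
    and \<omega>_pos: "\<omega>_inf > 0"
    and euler_lagrange:
      "fourier_multiplier (P_inf m) u_inf + \<omega>_inf *\<^sub>R u_inf = hartree u_inf"
    and decreasing: "symmetric_decreasing u_inf"
    and smooth: "\<And>s. s > 0 \<Longrightarrow> u_inf \<in> sobolev s"
    and nondegenerate:
      "\<And>s. s \<ge> 0 \<Longrightarrow> sobolev_invertible (s + 2) s (linearized m \<omega>_inf u_inf)"
    and \<beta>\<^sub>0: "\<beta>\<^sub>0 > 0"
    and I: "compact I" "is_interval I" "I \<subseteq> {0<..}" "\<omega>_inf \<in> interior I"
  shows "\<exists>L :: h2r \<times> real \<Rightarrow> h2r \<times> real.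
      ((\<lambda>(u, \<omega>). F_map m \<beta>\<^sub>0 I (0, u, \<omega>)) has_derivative L) (at (h2r_of_l2 u_inf, \<omega>_inf)) \<and>
      (\<forall>\<phi> \<tau>. L (\<phi>, \<tau>) =
        (\<phi> - h2r_of_l2 (R_op m 0 \<omega>_inf (hartree_deriv u_inf (l2_of_h2r \<phi>)))
           + \<tau> *\<^sub>R h2r_of_l2 (R_op m 0 \<omega>_inf (R_op m 0 \<omega>_inf (hartree u_inf))),
         2 * (u_inf \<bullet> l2_of_h2r \<phi>))) \<and>
      (\<forall>\<phi> \<tau>. L (\<phi>, \<tau>) =
        (h2r_of_l2 (R_op m 0 \<omega>_inf (linearized m \<omega>_inf u_inf (l2_of_h2r \<phi>) + \<tau> *\<^sub>R u_inf)),
         2 * (u_inf \<bullet> l2_of_h2r \<phi>))) \<and>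
      bij L \<and> bounded_linear (inv L)"
proof -
  have u: "u_inf \<in> H2r"
    using smooth[of 2] minimizer(3) by (simp add: radial_sobolev_def)
  have u1: "norm u_inf = 1" using minimizer(1) by (simp add: energy_minimizer_def)
  \<comment> \<open>s = 0 is the case that fits: T maps radial H2 onto radial L2, the space on which
    the resolvent acts.\<close>
  have nd: "sobolev_invertible 2 0 (linearized m \<omega>_inf u_inf)" using nondegenerate[of 0] by simp
  note inv = linearization_invertible[OF m \<omega>_pos u u1 euler_lagrange nd]
  show ?thesis
  proof (intro exI conjI allI)
    show "((\<lambda>(u, \<omega>). F_map m \<beta>\<^sub>0 I (0, u, \<omega>)) has_derivative linearization m \<omega>_inf u_inf) (at (h2r_of_l2 u_inf, \<omega>_inf))"
      by (rule F_map_has_derivative[OF m \<omega>_pos u \<beta>\<^sub>0 I(3,4)])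
  qed (simp_all only: inv(1,2), simp_all only: resolvent_eq_res[OF m \<omega>_pos] inv(3)[symmetric], simp add: linearization_def)
qed

end
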